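(* For each non-empty regular language $F$ over a finite alphabet, the nondeterministic regular realizability problem $\mathrm{RR}^n(F)$ is $\mathbf{NL}$-complete (under deterministic logspace many-one reductions).
   Context: For a language $F\subseteq\Delta^*$ over a finite alphabet $\Delta$ (called a filter), the nondeterministic regular realizability problem is $$\mathrm{RR}^n(F)=\{\mathcal A \mid \mathcal A \text{ is an NFA over }\Delta\text{ and } L(\mathcal A)\cap F\neq\varnothing\},$$ where NFAs are given by a standard encoding as strings (explicit list of states, transitions, initial state, accepting states). NFAs are allowed to have $\varepsilon$-transitions. $\mathbf{NL}$ denotes nondeterministic logarithmic space. *)

theory Defs
  imports Complex_Main "HOL-Library.Landau_Symbols"
begin

section \<open>Logarithmic space\<close>

text \<open>Symbols are natural numbers, so that the words over all finite alphabets live in one type and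
  completeness can quantify over the alphabet of the reduced language. An alphabet is a finite set
  of symbols; the words over it are \<^term>\<open>lists \<Sigma>\<close>.\<close>

type_synonym symbol = nat

subsection \<open>Turing machines\<close>

text \<open>The machines have a read-only input tape with end markers and a two-way head, a fixed number
  of one-way infinite work tapes, and a write-only one-way output tape. The work symbol 0 is the
  blank. Acceptors ignore the output tape; deterministic machines compute functions with it.\<close>

datatype cell = LeftEnd | Letter symbol | RightEnd

datatype move = MoveLeft | Stay | MoveRight

text \<open>The left-hand side of a rule consists of the current state, the scanned input cell, and the
  symbols scanned on the work tapes. The right-hand side consists of the new state, the move of the
  input head, for each work tape the symbol written and the move, and possibly an output symbol.\<close>

type_synonym lhs = "nat \<times> cell \<times> symbol list"
type_synonym rhs = "nat \<times> move \<times> (symbol \<times> move) list \<times> symbol option"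

record tm =
  ntapes :: nat
  start_state :: nat
  halt_state :: nat
  rules :: "(lhs \<times> rhs) set"

text \<open>Only the states and work symbols that occur in the finitely many rules matter, so the finite
  state set and the finite work alphabet are left implicit.\<close>

definition is_tm :: "tm \<Rightarrow> bool" where
  "is_tm M \<longleftrightarrow> finite (rules M) \<and>
     (\<forall>((q, x, ss), (q', d, as, y)) \<in> rules M.
        length ss = ntapes M \<and> length as = ntapes M \<and> q \<noteq> halt_state M)"

definition deterministic :: "tm \<Rightarrow> bool" where
  "deterministic M \<longleftrightarrow> single_valued (rules M)"

text \<open>A work tape is its contents together with the head position.\<close>

type_synonym wtape = "(nat \<Rightarrow> symbol) \<times> nat"

datatype config =
  Config (state: nat) (input_pos: nat) (work: "wtape list") (written: "symbol list")

text \<open>Position 0 of the input tape carries the left marker, and position \<open>length w + 1\<close> the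
  right one; the input head never leaves this range.\<close>

definition input_cell :: "symbol list \<Rightarrow> nat \<Rightarrow> cell" where
  "input_cell w i =
     (if i = 0 then LeftEnd else if i \<le> length w then Letter (w ! (i - 1)) else RightEnd)"

text \<open>A left move from position 0 has no effect (truncated subtraction).\<close>

fun move_head :: "move \<Rightarrow> nat \<Rightarrow> nat" where
  "move_head MoveLeft p = p - 1"
| "move_head Stay p = p"
| "move_head MoveRight p = p + 1"

definition act :: "wtape \<Rightarrow> symbol \<times> move \<Rightarrow> wtape" where
  "act = (\<lambda>(t, h) (s, d). (t(h := s), move_head d h))"

definition initial :: "tm \<Rightarrow> config" where
  "initial M = Config (start_state M) 0 (replicate (ntapes M) (\<lambda>_. 0, 0)) []"

inductive step :: "tm \<Rightarrow> symbol list \<Rightarrow> config \<Rightarrow> config \<Rightarrow> bool" for M w where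
  "((q, input_cell w i, map (\<lambda>(t, h). t h) ts), (q', d, as, y)) \<in> rules M \<Longrightarrow>
   step M w (Config q i ts out)
     (Config q' (min (length w + 1) (move_head d i)) (map2 act ts as)
        (out @ (case y of None \<Rightarrow> [] | Some s \<Rightarrow> [s])))"

definition reaches :: "tm \<Rightarrow> symbol list \<Rightarrow> config \<Rightarrow> bool" where
  "reaches M w = (step M w)\<^sup>*\<^sup>* (initial M)"

text \<open>At most \<open>s n\<close> cells of each work tape are visited, in every computation on an input of
  length \<open>n\<close>. The input and output tapes are not charged.\<close>

definition space_bounded :: "tm \<Rightarrow> symbol set \<Rightarrow> (nat \<Rightarrow> nat) \<Rightarrow> bool" where
  "space_bounded M \<Sigma> s \<longleftrightarrow>
     (\<forall>w \<in> lists \<Sigma>. \<forall>c. reaches M w c \<longrightarrow> (\<forall>(t, h) \<in> set (work c). h < s (length w)))"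

definition logspace :: "tm \<Rightarrow> symbol set \<Rightarrow> bool" where
  "logspace M \<Sigma> \<longleftrightarrow>
     (\<exists>s. (\<lambda>n. real (s n)) \<in> O(\<lambda>n. ln (real n)) \<and> space_bounded M \<Sigma> s)"

subsection \<open>The class NL, reductions, completeness\<close>

definition accepts :: "tm \<Rightarrow> symbol list \<Rightarrow> bool" where
  "accepts M w \<longleftrightarrow> (\<exists>c. reaches M w c \<and> state c = halt_state M)"

definition NL :: "symbol set \<Rightarrow> symbol list set set" where
  "NL \<Sigma> = {L. L \<subseteq> lists \<Sigma> \<and>
     (\<exists>M. is_tm M \<and> logspace M \<Sigma> \<and> (\<forall>w \<in> lists \<Sigma>. w \<in> L \<longleftrightarrow> accepts M w))}"

definition computes :: "tm \<Rightarrow> symbol set \<Rightarrow> (symbol list \<Rightarrow> symbol list) \<Rightarrow> bool" where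
  "computes M \<Sigma> f \<longleftrightarrow>
     (\<forall>w \<in> lists \<Sigma>. \<exists>c. reaches M w c \<and> state c = halt_state M \<and> written c = f w)"

definition logspace_computable :: "symbol set \<Rightarrow> (symbol list \<Rightarrow> symbol list) \<Rightarrow> bool" where
  "logspace_computable \<Sigma> f \<longleftrightarrow>
     (\<exists>M. is_tm M \<and> deterministic M \<and> logspace M \<Sigma> \<and> computes M \<Sigma> f)"

definition logspace_reducible ::
  "symbol set \<Rightarrow> symbol list set \<Rightarrow> symbol set \<Rightarrow> symbol list set \<Rightarrow> bool" where
  "logspace_reducible \<Sigma> A \<Gamma> B \<longleftrightarrow>
     (\<exists>f. logspace_computable \<Sigma> f \<and>
          (\<forall>w \<in> lists \<Sigma>. f w \<in> lists \<Gamma> \<and> (w \<in> A \<longleftrightarrow> f w \<in> B)))"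

definition NL_complete :: "symbol set \<Rightarrow> symbol list set \<Rightarrow> bool" where
  "NL_complete \<Gamma> B \<longleftrightarrow> finite \<Gamma> \<and> B \<in> NL \<Gamma> \<and>
     (\<forall>\<Sigma> A. finite \<Sigma> \<longrightarrow> A \<in> NL \<Sigma> \<longrightarrow> logspace_reducible \<Sigma> A \<Gamma> B)"

section \<open>Nondeterministic finite automata\<close>

text \<open>A transition labelled \<^term>\<open>None\<close> is an \<open>\<epsilon>\<close>-transition.\<close>

record 'q nfa =
  states :: "'q set"
  trans :: "('q \<times> symbol option \<times> 'q) set"
  init :: 'q
  final :: "'q set"

definition is_nfa :: "symbol set \<Rightarrow> 'q nfa \<Rightarrow> bool" where
  "is_nfa \<Delta> A \<longleftrightarrow> finite (states A) \<and>
     trans A \<subseteq> states A \<times> (insert None (Some ` \<Delta>)) \<times> states A \<and>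
     init A \<in> states A \<and> final A \<subseteq> states A"

inductive nfa_path :: "'q nfa \<Rightarrow> 'q \<Rightarrow> symbol list \<Rightarrow> 'q \<Rightarrow> bool" for A where
  empty: "nfa_path A p [] p"
| epsilon: "(p, None, q) \<in> trans A \<Longrightarrow> nfa_path A q w r \<Longrightarrow> nfa_path A p w r"
| letter: "(p, Some a, q) \<in> trans A \<Longrightarrow> nfa_path A q w r \<Longrightarrow> nfa_path A p (a # w) r"

definition lang :: "'q nfa \<Rightarrow> symbol list set" where
  "lang A = {w. \<exists>q \<in> final A. nfa_path A (init A) w q}"

definition regular :: "symbol set \<Rightarrow> symbol list set \<Rightarrow> bool" where
  "regular \<Delta> L \<longleftrightarrow> (\<exists>A :: nat nfa. is_nfa \<Delta> A \<and> lang A = L)"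

subsection \<open>Encoding of automata as words\<close>

text \<open>States are named by bit strings. The symbols 0 and 1 are the bits, 2 ends a state name, 3
  separates the four sections (states, transitions, initial state, accepting states), 4 is the
  label of an \<open>\<epsilon>\<close>-transition, and \<open>a + 5\<close> stands for the letter \<open>a\<close>. No symbol is needed
  between transitions, since a state name is self-delimiting and a label is a single symbol.\<close>

definition enc_state :: "bool list \<Rightarrow> symbol list" where
  "enc_state q = map of_bool q @ [2]"

fun enc_label :: "symbol option \<Rightarrow> symbol" where
  "enc_label None = 4"
| "enc_label (Some a) = a + 5"

fun enc_trans :: "bool list \<times> symbol option \<times> bool list \<Rightarrow> symbol list" where
  "enc_trans (p, x, q) = enc_state p @ [enc_label x] @ enc_state q"

definition nfa_alphabet :: "symbol set \<Rightarrow> symbol set" where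
  "nfa_alphabet \<Delta> = {0, 1, 2, 3, 4} \<union> (\<lambda>a. a + 5) ` \<Delta>"

text \<open>An automaton has several encodings, since its finite sets may be listed in any order and with
  repetitions; every word encodes at most one automaton.\<close>

definition encodes :: "symbol list \<Rightarrow> bool list nfa \<Rightarrow> bool" where
  "encodes w A \<longleftrightarrow>
     (\<exists>qs ts fs. set qs = states A \<and> set ts = trans A \<and> set fs = final A \<and>
        w = concat (map enc_state qs) @ [3] @ concat (map enc_trans ts) @ [3] @
            enc_state (init A) @ [3] @ concat (map enc_state fs))"

subsection \<open>Regular realizability\<close>

definition RRn :: "symbol set \<Rightarrow> symbol list set \<Rightarrow> symbol list set" where
  "RRn \<Delta> F = {w. \<exists>A. is_nfa \<Delta> A \<and> encodes w A \<and> lang A \<inter> F \<noteq> {}}"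

end

theory Submission
  imports Defs "HOL-Library.Countable"
begin

text \<open>Both directions go through programs with finitely many registers holding numbers below a
  bound \<open>N\<close> that is polynomial in the input length. A register is a work tape with a fixed number
  of digits, logarithmic in the input length, and an increment that would overflow blocks. Hence
  every computation of the compiled machine, halting or not, stays in logarithmic space.

  Membership: registers are used as pointers into the input. A nondeterministic program checks the
  format of the encoding, guesses for every state name in the last three sections an equal name in
  the first one, and then walks through the product with an automaton for \<open>F\<close>, keeping a pointer to
  some occurrence of the name of the current state. Names may be as long as the input, so they are
  compared letter by letter with two pointers.

  Hardness: a configuration of a machine is a vector of numbers, namely the state, the position of
  the input head, and for each work tape the two numbers whose digits are the cells to the left and
  to the right of the head. These are polynomially bounded, so a state of the automaton is a
  configuration named in unary. A rule acts on each component by finitely many linear maps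
  \<open>\<alpha> x + \<beta> \<mapsto> \<gamma> x + \<delta>\<close>, so nested loops over registers print all transitions without any
  division. The automaton reads a fixed word of \<open>F\<close> and then follows the machine by
  \<open>\<epsilon>\<close>-transitions to a halting configuration. As lists may contain repetitions, the states are
  printed as the endpoints of the transitions.\<close>

section \<open>A programming language with bounded registers\<close>

text \<open>The space bound concerns every reachable configuration, so a machine has to mark off its
  space on its own tapes. Counting the input positions in base 2 produces \<open>width n\<close>
  cells with \<open>2 ^ width n > n + 2\<close>. The same cells are afterwards read in base
  \<open>2 ^ C\<close>, so that a register ranges over roughly \<open>n ^ C\<close> values. Counting
  directly in the larger base would leave only linearly many. The degree of the polynomial thus sits
  in the work alphabet, and the number of cells is the same for all programs.

  The printed graph contains many edges between vectors that code no configuration, because the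
  loops range over all small numbers. They do no harm: paths are followed forward from the initial
  configuration, and an edge whose source codes a reachable configuration is shown to be a genuine
  step.

  Machine states are natural numbers, so the control states of the compiler are passed through
  \<open>to_nat\<close>; this is the purpose of the countability instances.\<close>

instance cell :: countable by countable_datatype
instance move :: countable by countable_datatype

text \<open>The test \<open>Any\<close> may have either outcome; it is the only source of nondeterminism.\<close>

datatype test = IsZero nat | IsMax nat | Scans "cell list" | Any

datatype com =
    Skip
  | Inc nat
  | Dec nat
  | Move move
  | Out symbol
  | Seq com com (infixr ";;" 60)
  | Cond test com com
  | Until test com

instance test :: countable by countable_datatype
instance com :: countable by countable_datatype

type_synonym store = "nat \<times> (nat \<Rightarrow> nat) \<times> symbol list"

fun holds :: "symbol list \<Rightarrow> nat \<Rightarrow> test \<Rightarrow> store \<Rightarrow> bool \<Rightarrow> bool" where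
  "holds w N (IsZero j) (i, v, out) b \<longleftrightarrow> b = (v j = 0)"
| "holds w N (IsMax j) (i, v, out) b \<longleftrightarrow> b = (v j + 1 = N)"
| "holds w N (Scans xs) (i, v, out) b \<longleftrightarrow> b = (input_cell w i \<in> set xs)"
| "holds w N Any s b \<longleftrightarrow> True"

text \<open>Of the two blocking commands, \<open>Inc\<close> never reaches \<open>N\<close> and \<open>Dec\<close> never applies to \<open>0\<close>.
  \<open>Until t a\<close> repeats \<open>a\<close> until \<open>t\<close> has the outcome \<open>True\<close>.\<close>

fun sem :: "symbol list \<Rightarrow> nat \<Rightarrow> com \<Rightarrow> store rel" where
  "sem w N Skip = Id"
| "sem w N (Inc j) = {((i, v, out), (i, v(j := v j + 1), out)) | i v out. v j + 1 < N}"
| "sem w N (Dec j) = {((i, v, out), (i, v(j := v j - 1), out)) | i v out. 0 < v j}"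
| "sem w N (Move d) = {((i, v, out), (min (length w + 1) (move_head d i), v, out)) | i v out. True}"
| "sem w N (Out y) = {((i, v, out), (i, v, out @ [y])) | i v out. True}"
| "sem w N (Seq a b) = sem w N a O sem w N b"
| "sem w N (Cond t a b) = {(s, s'). holds w N t s True \<and> (s, s') \<in> sem w N a \<or>
                                    holds w N t s False \<and> (s, s') \<in> sem w N b}"
| "sem w N (Until t a) = {(s, s'). holds w N t s False \<and> (s, s') \<in> sem w N a}\<^sup>* O
                         {(s, s'). s' = s \<and> holds w N t s True}"

lemma sem_Until_unfold:
  "(s, s') \<in> sem w N (Until t a) \<longleftrightarrow>
     holds w N t s False \<and> (s, s') \<in> sem w N a O sem w N (Until t a) \<or> holds w N t s True \<and> s' = s"
proof -
  define R where "R = {(s, s'). holds w N t s False \<and> (s, s') \<in> sem w N a}"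
  define G where "G = {(s, s'). s' = s \<and> holds w N t s True}"
  have sem: "sem w N (Until t a) = R\<^sup>* O G" by (simp only: sem.simps R_def G_def)
  have "R\<^sup>* = Id \<union> R O R\<^sup>*" by (metis rtrancl_trancl_reflcl trancl_unfold_left sup_commute)
  then have "R\<^sup>* O G = (Id \<union> R O R\<^sup>*) O G" by simp
  then have "R\<^sup>* O G = G \<union> R O R\<^sup>* O G" by (simp add: relcomp_distrib2 O_assoc)
  then have "(s, s') \<in> R\<^sup>* O G \<longleftrightarrow> (s, s') \<in> G \<or> (s, s') \<in> R O R\<^sup>* O G" by blast
  moreover have "(s, s') \<in> R O X \<longleftrightarrow> holds w N t s False \<and> (s, s') \<in> sem w N a O X" for X
    unfolding R_def by blast
  ultimately show ?thesis unfolding sem by (auto simp: G_def)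
qed

section \<open>Small-step semantics and its agreement with the relational one\<close>

inductive sstep :: "symbol list \<Rightarrow> nat \<Rightarrow> com list \<times> store \<Rightarrow> com list \<times> store \<Rightarrow> bool" for w N where
  Prim: "c \<in> {Skip} \<union> range Inc \<union> range Dec \<union> range Move \<union> range Out \<Longrightarrow> (s, s') \<in> sem w N c \<Longrightarrow>
         sstep w N (c # k, s) (k, s')"
| Seq: "sstep w N (Seq a b # k, s) (a # b # k, s)"
| CondT: "holds w N t s True \<Longrightarrow> sstep w N (Cond t a b # k, s) (a # k, s)"
| CondF: "holds w N t s False \<Longrightarrow> sstep w N (Cond t a b # k, s) (b # k, s)"
| UntilF: "holds w N t s False \<Longrightarrow> sstep w N (Until t a # k, s) (a # Until t a # k, s)"
| UntilT: "holds w N t s True \<Longrightarrow> sstep w N (Until t a # k, s) (k, s)"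

lemma sem_imp_ssteps: "(s, s') \<in> sem w N c \<Longrightarrow> (sstep w N)\<^sup>*\<^sup>* (c # k, s) (k, s')"
proof (induction c arbitrary: s s' k)
  case (Seq a b)
  then obtain s1 where 1: "(s, s1) \<in> sem w N a" "(s1, s') \<in> sem w N b" by auto
  have "(sstep w N)\<^sup>*\<^sup>* (a # b # k, s) (k, s')"
    using Seq.IH(1)[OF 1(1)] Seq.IH(2)[OF 1(2)] by (meson rtranclp_trans)
  then show ?case by (meson sstep.Seq converse_rtranclp_into_rtranclp)
next
  case (Cond t a b)
  then consider "holds w N t s True" "(s, s') \<in> sem w N a" | "holds w N t s False" "(s, s') \<in> sem w N b"
    by auto
  then show ?case
  proof cases
    case 1
    with Cond.IH(1) show ?thesis by (meson sstep.CondT converse_rtranclp_into_rtranclp)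
  next
    case 2
    with Cond.IH(2) show ?thesis by (meson sstep.CondF converse_rtranclp_into_rtranclp)
  qed
next
  case (Until t a)
  then have *: "(s, s') \<in> {(s, s'). holds w N t s False \<and> (s, s') \<in> sem w N a}\<^sup>*" "holds w N t s' True"
    by auto
  from *(1) show ?case
  proof (induction rule: converse_rtrancl_induct)
    case base
    then show ?case using *(2) by (blast intro: sstep.UntilT)
  next
    case (step y z)
    then have 1: "holds w N t y False" "(y, z) \<in> sem w N a" by auto
    have "(sstep w N)\<^sup>*\<^sup>* (a # Until t a # k, y) (k, s')"
      using Until.IH[OF 1(2)] step(3) by (meson rtranclp_trans)
    then show ?case using 1(1) by (meson sstep.UntilF converse_rtranclp_into_rtranclp)
  qed
qed (rule r_into_rtranclp, rule sstep.Prim, simp, simp)+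

fun ksem :: "symbol list \<Rightarrow> nat \<Rightarrow> com list \<Rightarrow> store rel" where
  "ksem w N [] = Id"
| "ksem w N (c # k) = sem w N c O ksem w N k"

text \<open>Stated backwards, so that a run ending in the empty stack can be treated by induction
  from its end. Only terminating runs are compared with \<open>sem\<close>, and acceptance sees no
  others.\<close>

lemma sstep_ksem:
  assumes "sstep w N (k, s) (k', s')" "(s', r) \<in> ksem w N k'"
  shows "(s, r) \<in> ksem w N k"
  using assms(1)
proof (cases rule: sstep.cases)
  case (Prim c)
  then show ?thesis using assms(2) by auto
next
  case (Seq a b)
  then show ?thesis using assms(2) by (auto simp del: sem.simps(1-5,7,8))
next
  case (CondT t a b)
  then show ?thesis using assms(2) by auto
next
  case (CondF t b a)
  then show ?thesis using assms(2) by auto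
next
  case (UntilF t a l)
  then obtain s1 s2 where "(s, s1) \<in> sem w N a" "(s1, s2) \<in> sem w N (Until t a)" "(s2, r) \<in> ksem w N l"
    using assms(2) by (auto simp del: sem.simps(8))
  moreover from this have "(s, s2) \<in> sem w N (Until t a)"
    using UntilF sem_Until_unfold by blast
  ultimately show ?thesis using UntilF by (auto simp del: sem.simps(8))
next
  case (UntilT t a)
  then have "(s, s) \<in> sem w N (Until t a)" using sem_Until_unfold by blast
  then show ?thesis using assms(2) UntilT by (auto simp del: sem.simps(8))
qed

lemma ssteps_ksem: "(sstep w N)\<^sup>*\<^sup>* (k, s) ([], s') \<Longrightarrow> (s, s') \<in> ksem w N k"
proof (induction k s rule: converse_rtranclp_induct2)
  case refl
  then show ?case by simp
next
  case (step k s k1 s1)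
  then show ?case using sstep_ksem by blast
qed

lemma ssteps_iff_sem: "(sstep w N)\<^sup>*\<^sup>* ([c], s) ([], s') \<longleftrightarrow> (s, s') \<in> sem w N c"
  using ssteps_ksem[of w N "[c]" s s'] sem_imp_ssteps[of s s' w N c "[]"]
  by (auto simp only: ksem.simps R_O_Id)

fun bounded :: "nat \<Rightarrow> com \<Rightarrow> bool" where
  "bounded K (Inc j) \<longleftrightarrow> j < K"
| "bounded K (Dec j) \<longleftrightarrow> j < K"
| "bounded K (Seq a b) \<longleftrightarrow> bounded K a \<and> bounded K b"
| "bounded K (Cond t a b) \<longleftrightarrow> (\<forall>j. t = IsZero j \<or> t = IsMax j \<longrightarrow> j < K) \<and> bounded K a \<and> bounded K b"
| "bounded K (Until t a) \<longleftrightarrow> (\<forall>j. t = IsZero j \<or> t = IsMax j \<longrightarrow> j < K) \<and> bounded K a"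
| "bounded K _ \<longleftrightarrow> True"

fun det :: "com \<Rightarrow> bool" where
  "det (Seq a b) \<longleftrightarrow> det a \<and> det b"
| "det (Cond t a b) \<longleftrightarrow> t \<noteq> Any \<and> det a \<and> det b"
| "det (Until t a) \<longleftrightarrow> t \<noteq> Any \<and> det a"
| "det _ \<longleftrightarrow> True"

text \<open>The stacks of pending commands that occur while \<open>c # k\<close> is processed are finitely many, so they
  can serve as control states.\<close>

fun stacks :: "com \<Rightarrow> com list \<Rightarrow> com list set" where
  "stacks (Seq a b) k = {Seq a b # k} \<union> stacks a (b # k) \<union> stacks b k"
| "stacks (Cond t a b) k = {Cond t a b # k} \<union> stacks a k \<union> stacks b k"
| "stacks (Until t a) k = {Until t a # k, k} \<union> stacks a (Until t a # k)"
| "stacks c k = {c # k, k}"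

lemma finite_stacks: "finite (stacks c k)"
  by (induction c k rule: stacks.induct) auto

lemma stacks_self: "c # k \<in> stacks c k" "k \<in> stacks c k"
  by (induction c k rule: stacks.induct) auto

lemma stacks_set:
  assumes "\<And>a b. P (Seq a b) \<Longrightarrow> P a \<and> P b"
    and "\<And>t a b. P (Cond t a b) \<Longrightarrow> P a \<and> P b"
    and "\<And>t a. P (Until t a) \<Longrightarrow> P a"
  shows "x \<in> stacks c k \<Longrightarrow> list_all P (c # k) \<Longrightarrow> list_all P x"
proof (induction c k rule: stacks.induct)
  case (1 a b k)
  then show ?case using assms(1)[of a b] by auto
next
  case (2 t a b k)
  then show ?case using assms(2)[of t a b] by auto
next
  case (3 t a k)
  then show ?case using assms(3)[of t a] by auto
qed auto

text \<open>An over-approximation of the control flow that ignores tests and stores; it serves only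
  to show that the finite set of stacks is closed under steps.\<close>

fun succs :: "com list \<Rightarrow> com list set" where
  "succs [] = {}"
| "succs (Seq a b # k) = {a # b # k}"
| "succs (Cond t a b # k) = {a # k, b # k}"
| "succs (Until t a # k) = {a # Until t a # k, k}"
| "succs (c # k) = {k}"

text \<open>The stack \<open>k\<close> is excluded because it is the exit of the block: what follows
  it belongs to the surrounding program.\<close>

lemma succs_stacks: "x \<in> stacks c k \<Longrightarrow> x \<noteq> k \<Longrightarrow> succs x \<subseteq> stacks c k"
proof (induction c k rule: stacks.induct)
  case (1 a b k)
  then show ?case by (cases "x = b # k") (auto simp: stacks_self)
next
  case (3 t a k)
  then show ?case by (cases "x = Until t a # k") (auto simp: stacks_self)
qed (auto simp: stacks_self)

section \<open>Compilation to Turing machines\<close>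

text \<open>A digit \<open>d < B\<close> is written as the symbol \<open>d + 1\<close>, least significant digit first, starting in
  cell 1; cell 0 carries the marker \<open>B + 1\<close>, where the head rests between operations. An operation
  sweeps to the right as long as \<open>table\<close> gives no outcome, and then returns to the marker; \<open>None\<close>
  means that the machine is stuck.\<close>

datatype sop = Count | Incr | Decr | TestZero | TestMax

instance sop :: countable by countable_datatype

fun table :: "nat \<Rightarrow> sop \<Rightarrow> symbol \<Rightarrow> (symbol \<times> bool option) option" where
  "table B Count s = (if s = B + 1 then Some (s, None) else
     if s = 2 then Some (1, None) else Some (2, Some True))"
| "table B Incr s = (if s = B + 1 then Some (s, None) else
     if s = 0 then None else if s = B then Some (1, None) else Some (s + 1, Some True))"
| "table B Decr s = (if s = B + 1 then Some (s, None) else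
     if s = 0 then None else if s = 1 then Some (B, None) else Some (s - 1, Some True))"
| "table B TestZero s = (if s = B + 1 then Some (s, None) else
     if s = 0 then Some (0, Some True) else if s = 1 then Some (1, None) else Some (s, Some False))"
| "table B TestMax s = (if s = B + 1 then Some (s, None) else
     if s = 0 then Some (0, Some True) else if s = B then Some (B, None) else Some (s, Some False))"

text \<open>The empty list stands for the first blank after the digits. Only \<open>Count\<close>
  writes there, which lengthens the list; the two tests leave the blank as it is, and
  \<open>Incr\<close> and \<open>Decr\<close> get stuck.\<close>

fun sweep :: "nat \<Rightarrow> sop \<Rightarrow> symbol list \<Rightarrow> (symbol list \<times> bool) option" where
  "sweep B op [] = (case table B op 0 of Some (s, Some e) \<Rightarrow> Some (if s = 0 then [] else [s], e) | _ \<Rightarrow> None)"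
| "sweep B op (d # ds) = (case table B op d of None \<Rightarrow> None
     | Some (s, None) \<Rightarrow> map_option (\<lambda>(ds', e). (s # ds', e)) (sweep B op ds)
     | Some (s, Some e) \<Rightarrow> Some (s # ds, e))"

text \<open>\<open>Sweep sel op a b\<close> and \<open>Back sel a\<close> operate on a single tape, or on all tapes in parallel if \<open>sel\<close>
  is \<open>None\<close>. The latter happens in the initial phase only, where the positions of the input tape are
  counted in binary on all tapes. This fixes the number of digits of the registers. What the count
  leaves behind is not erased, so a program starts with equal but unspecified register values and
  with the input head on the right marker.\<close>

datatype ctl = Start | Check | Run "com list" | Sweep "nat option" sop ctl ctl | Back "nat option" ctl

instance ctl :: countable by countable_datatype

definition acts :: "nat option \<Rightarrow> symbol \<Rightarrow> move \<Rightarrow> symbol list \<Rightarrow> (symbol \<times> move) list" where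
  "acts sel s d ss = map (\<lambda>j. if sel = None \<or> sel = Some j then (s, d) else (ss ! j, Stay)) [0..<length ss]"

definition scanned :: "nat option \<Rightarrow> symbol list \<Rightarrow> symbol" where
  "scanned sel ss = ss ! (case sel of None \<Rightarrow> 0 | Some j \<Rightarrow> j)"

definition idle :: "symbol list \<Rightarrow> (symbol \<times> move) list" where
  "idle ss = map (\<lambda>s. (s, Stay)) ss"

type_synonym instr = "ctl \<times> move \<times> (symbol \<times> move) list \<times> symbol option"

fun branch :: "test \<Rightarrow> ctl \<Rightarrow> ctl \<Rightarrow> cell \<Rightarrow> ctl list" where
  "branch (IsZero j) a b x = [Sweep (Some j) TestZero a b]"
| "branch (IsMax j) a b x = [Sweep (Some j) TestMax a b]"
| "branch (Scans xs) a b x = [if x \<in> set xs then a else b]"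
| "branch Any a b x = [a, b]"

fun delta :: "nat \<Rightarrow> com \<Rightarrow> ctl \<Rightarrow> cell \<Rightarrow> symbol list \<Rightarrow> instr list" where
  "delta B p Start x ss = [(Sweep None Count Check Check, Stay, acts None (B + 1) Stay ss, None)]"
| "delta B p Check x ss = (if x = RightEnd then [(Run [p], Stay, idle ss, None)]
     else [(Sweep None Count Check Check, MoveRight, idle ss, None)])"
| "delta B p (Sweep sel op a b) x ss = (case table B op (scanned sel ss) of
       None \<Rightarrow> []
     | Some (s, None) \<Rightarrow> [(Sweep sel op a b, Stay, acts sel s MoveRight ss, None)]
     | Some (s, Some e) \<Rightarrow> [(Back sel (if e then a else b), Stay, acts sel s Stay ss, None)])"
| "delta B p (Back sel a) x ss = (if scanned sel ss = B + 1 then [(a, Stay, idle ss, None)]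
     else [(Back sel a, Stay, acts sel (scanned sel ss) MoveLeft ss, None)])"
| "delta B p (Run []) x ss = []"
| "delta B p (Run (Skip # k)) x ss = [(Run k, Stay, idle ss, None)]"
| "delta B p (Run (Inc j # k)) x ss = [(Sweep (Some j) Incr (Run k) (Run k), Stay, idle ss, None)]"
| "delta B p (Run (Dec j # k)) x ss = [(Sweep (Some j) Decr (Run k) (Run k), Stay, idle ss, None)]"
| "delta B p (Run (Move d # k)) x ss = [(Run k, d, idle ss, None)]"
| "delta B p (Run (Out y # k)) x ss = [(Run k, Stay, idle ss, Some y)]"
| "delta B p (Run (Seq a b # k)) x ss = [(Run (a # b # k), Stay, idle ss, None)]"
| "delta B p (Run (Cond t a b # k)) x ss =
     map (\<lambda>q. (q, Stay, idle ss, None)) (branch t (Run (a # k)) (Run (b # k)) x)"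
| "delta B p (Run (Until t a # k)) x ss =
     map (\<lambda>q. (q, Stay, idle ss, None)) (branch t (Run k) (Run (a # Until t a # k)) x)"

definition run_ctls :: "com \<Rightarrow> ctl set" where
  "run_ctls p = Run ` stacks p []"

text \<open>Since \<open>rules\<close> is a finite set, only these controls receive rules. Sweeps
  over a single register always continue with a \<open>Run\<close> control, and the parallel sweep
  occurs only while counting.\<close>

definition ctls :: "nat \<Rightarrow> com \<Rightarrow> ctl set" where
  "ctls K p = {Start, Check, Sweep None Count Check Check, Back None Check} \<union> run_ctls p \<union>
     (\<lambda>(j, op, a, b). Sweep (Some j) op a b) `
       ({..<K} \<times> {Incr, Decr, TestZero, TestMax} \<times> run_ctls p \<times> run_ctls p) \<union>
     (\<lambda>(j, a). Back (Some j) a) ` ({..<K} \<times> run_ctls p)"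

definition cells :: "symbol set \<Rightarrow> cell set" where
  "cells \<Sigma> = {LeftEnd, RightEnd} \<union> Letter ` \<Sigma>"

definition scans :: "nat \<Rightarrow> nat \<Rightarrow> symbol list set" where
  "scans B K = {ss. set ss \<subseteq> {..B + 1} \<and> length ss = K}"

definition compile :: "nat \<Rightarrow> nat \<Rightarrow> symbol set \<Rightarrow> com \<Rightarrow> tm" where
  "compile B K \<Sigma> p = \<lparr>ntapes = K, start_state = to_nat Start, halt_state = to_nat (Run []),
     rules = (\<Union>q \<in> ctls K p. \<Union>x \<in> cells \<Sigma>. \<Union>ss \<in> scans B K.
        (\<lambda>(q', d, as, y). ((to_nat q, x, ss), (to_nat q', d, as, y))) ` set (delta B p q x ss))\<rparr>"

lemma length_acts [simp]: "length (acts sel s d ss) = length ss"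
  by (simp add: acts_def)

lemma length_idle [simp]: "length (idle ss) = length ss"
  by (simp add: idle_def)

lemma delta_length: "list_all (\<lambda>(q', d, as, y). length as = length ss) (delta B p q x ss)"
proof (induction B p q x ss rule: delta.induct)
  case (3 B p sel op a b x ss)
  show ?case
  proof (cases "table B op (scanned sel ss)")
    case (Some r)
    then show ?thesis by (cases r; cases "snd r") simp_all
  qed simp
qed (simp_all add: list_all_iff)

lemma det_stacks: "det p \<Longrightarrow> x \<in> stacks p [] \<Longrightarrow> list_all det x"
  by (erule stacks_set[rotated 3]) simp_all

lemma bounded_stacks: "bounded K p \<Longrightarrow> x \<in> stacks p [] \<Longrightarrow> list_all (bounded K) x"
  by (erule stacks_set[rotated 3]) simp_all

lemma branch_length: "t \<noteq> Any \<Longrightarrow> length (branch t a b x) = 1"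
  by (cases t) auto

lemma delta_det: "(\<And>k. q = Run k \<Longrightarrow> list_all det k) \<Longrightarrow> length (delta B p q x ss) \<le> 1"
proof (induction B p q x ss rule: delta.induct)
  case (3 B p sel op a b x ss)
  show ?case
  proof (cases "table B op (scanned sel ss)")
    case (Some r)
    then show ?thesis by (cases r; cases "snd r") simp_all
  qed simp
qed (simp_all add: branch_length)

lemma compile_sel [simp]:
  "ntapes (compile B K \<Sigma> p) = K" "start_state (compile B K \<Sigma> p) = to_nat Start"
  "halt_state (compile B K \<Sigma> p) = to_nat (Run [])"
  by (simp_all add: compile_def)

lemma compile_rule:
  assumes "(l, r) \<in> rules (compile B K \<Sigma> p)"
  obtains q x ss q' d as y where "q \<in> ctls K p" "x \<in> cells \<Sigma>" "ss \<in> scans B K"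
    "l = (to_nat q, x, ss)" "r = (to_nat q', d, as, y)" "(q', d, as, y) \<in> set (delta B p q x ss)"
proof -
  from assms obtain q x ss z where "q \<in> ctls K p" "x \<in> cells \<Sigma>" "ss \<in> scans B K"
    "z \<in> set (delta B p q x ss)" "(l, r) = (case z of (q', d, as, y) \<Rightarrow> ((to_nat q, x, ss), (to_nat q', d, as, y)))"
    unfolding compile_def by (simp only: tm.simps UN_iff image_iff) blast
  then show thesis using that by (cases z) simp
qed

lemma is_tm_compile:
  assumes "finite \<Sigma>"
  shows "is_tm (compile B K \<Sigma> p)"
proof -
  have "finite (ctls K p)" by (simp add: ctls_def run_ctls_def finite_stacks)
  moreover have "finite (cells \<Sigma>)" using assms by (simp add: cells_def)
  moreover have "finite (scans B K)" unfolding scans_def by (rule finite_lists_length_eq) simp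
  ultimately have "finite (rules (compile B K \<Sigma> p))" by (simp add: compile_def)
  moreover have "case r of ((q, x, ss), (q', d, as, y)) \<Rightarrow>
      length ss = K \<and> length as = K \<and> q \<noteq> to_nat (Run [])"
    if "r \<in> rules (compile B K \<Sigma> p)" for r
  proof -
    obtain l r' where r: "r = (l, r')" by (cases r)
    have "(l, r') \<in> rules (compile B K \<Sigma> p)" using that r by simp
    then obtain q x ss q' d as y where *: "ss \<in> scans B K" "l = (to_nat q, x, ss)"
      "r' = (to_nat q', d, as, y)" "(q', d, as, y) \<in> set (delta B p q x ss)"
      by (rule compile_rule)
    have "q \<noteq> Run []" using *(4) by auto
    moreover have "length as = length ss" using *(4) delta_length[of ss B p q x] by (force simp: list_all_iff)
    ultimately show ?thesis using *(1) by (simp add: r *(2,3) scans_def)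
  qed
  ultimately show ?thesis unfolding is_tm_def compile_sel
    by (intro conjI ballI) (assumption, simp only: split_paired_all prod.case not_False_eq_True simp_thms)
qed

lemma deterministic_compile:
  assumes "det p"
  shows "deterministic (compile B K \<Sigma> p)"
proof -
  have 1: "x = y" if "x \<in> set xs" "y \<in> set xs" "length xs \<le> 1" for x y :: instr and xs
  proof -
    from that(3) have "xs = [] \<or> (\<exists>z. xs = [z])"
      by (metis One_nat_def Suc_length_conv le_Suc_eq le_zero_eq length_0_conv)
    then show ?thesis using that(1,2) by (elim disjE exE) simp_all
  qed
  have 2: "k \<in> stacks p []" if "Run k \<in> ctls K p" for k
    using that by (auto simp: ctls_def run_ctls_def)
  have 3: "length (delta B p q x ss) \<le> 1" if "q \<in> ctls K p" for q x ss
  proof (rule delta_det)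
    fix k assume "q = Run k"
    with that have "k \<in> stacks p []" by (intro 2) simp
    then show "list_all det k" by (rule det_stacks[OF assms])
  qed
  show ?thesis
    unfolding deterministic_def
  proof (rule single_valuedI)
    fix l r1 r2
    assume r1: "(l, r1) \<in> rules (compile B K \<Sigma> p)" and r2: "(l, r2) \<in> rules (compile B K \<Sigma> p)"
    obtain q x ss q1 d1 as1 y1 where q: "q \<in> ctls K p" "l = (to_nat q, x, ss)"
        "r1 = (to_nat q1, d1, as1, y1)" "(q1, d1, as1, y1) \<in> set (delta B p q x ss)"
      using r1 by (rule compile_rule)
    obtain q' x' ss' q2 d2 as2 y2 where q': "l = (to_nat (q' :: ctl), x', ss')"
        "r2 = (to_nat q2, d2, as2, y2)" "(q2, d2, as2, y2) \<in> set (delta B p q' x' ss')"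
      using r2 by (rule compile_rule)
    have "(q2, d2, as2, y2) \<in> set (delta B p q x ss)" using q' q(2) by simp
    then have "(q1, d1, as1, y1) = (q2, d2, as2, y2)" by (rule 1[OF q(4) _ 3[OF q(1)]])
    then show "r1 = r2" using q(3) q'(2) by simp
  qed
qed

section \<open>Positional notation and the effect of the sweeps\<close>

fun digs :: "nat \<Rightarrow> nat \<Rightarrow> nat \<Rightarrow> symbol list" where
  "digs B 0 x = []"
| "digs B (Suc m) x = (x mod B + 1) # digs B m (x div B)"

lemma length_digs [simp]: "length (digs B m x) = m"
  by (induction m arbitrary: x) auto

lemma set_digs: "0 < B \<Longrightarrow> set (digs B m x) \<subseteq> {1..B}"
  by (induction m arbitrary: x) (auto simp: Suc_le_eq)

lemma digs_Suc: "r < B \<Longrightarrow> digs B (Suc m) (y * B + r) = (r + 1) # digs B m y"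
  by simp

lemma digit_split:
  fixes x :: nat
  assumes "x < B ^ Suc m" "0 < B"
  obtains y r where "x = y * B + r" "r < B" "y < B ^ m"
proof
  show "x = (x div B) * B + x mod B" by simp
  show "x mod B < B" using assms by simp
  show "x div B < B ^ m" using assms by (simp add: less_mult_imp_div_less mult.commute)
qed

lemma digit_bound:
  fixes r y :: nat
  assumes "r < B" "y < B ^ m"
  shows "y * B + r < B ^ Suc m"
proof -
  have "y * B + r < (y + 1) * B" using assms(1) by simp
  also have "\<dots> \<le> B ^ m * B" using assms(2) by (intro mult_right_mono) auto
  finally show ?thesis by (simp add: mult.commute)
qed

text \<open>Whatever digits the counting phase leaves behind, they denote some number; it becomes
  the common initial value of the registers.\<close>

lemma digs_surj:
  assumes "set ds \<subseteq> {1..B}"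
  shows "\<exists>x < B ^ length ds. ds = digs B (length ds) x"
  using assms
proof (induction ds)
  case (Cons d ds)
  then obtain x where x: "x < B ^ length ds" "ds = digs B (length ds) x" by auto
  have d: "d - 1 < B" "d - 1 + 1 = d" using Cons.prems by auto
  have "d # ds = digs B (length (d # ds)) (x * B + (d - 1))"
    using digs_Suc[OF d(1), of "length ds" x] d(2) x(2) by simp
  moreover have "x * B + (d - 1) < B ^ length (d # ds)" using digit_bound[OF d(1) x(1)] by simp
  ultimately show ?case by blast
qed simp

text \<open>Induction from the least significant digit. A digit \<open>B - 1\<close> turns into 0
  and carries into \<open>y\<close>; overflow is a carry that runs into the blank.\<close>

lemma sweep_Incr:
  assumes "2 \<le> B"
  shows "x < B ^ m \<Longrightarrow> sweep B Incr (digs B m x) = (if x + 1 < B ^ m then Some (digs B m (x + 1), True) else None)"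
proof (induction m arbitrary: x)
  case (Suc m)
  obtain y r where x: "x = y * B + r" "r < B" "y < B ^ m"
    using digit_split[OF Suc.prems] assms by auto
  have digs: "digs B (Suc m) x = (r + 1) # digs B m y" using x(1,2) digs_Suc by simp
  show ?case
  proof (cases "r + 1 = B")
    case True
    have "x + 1 = (y + 1) * B + 0" using True x(1) by simp
    moreover from this have "digs B (Suc m) (x + 1) = 1 # digs B m (y + 1)"
      using digs_Suc[of 0 B m "y + 1"] assms by simp
    moreover have "(y + 1) * B < B ^ Suc m \<longleftrightarrow> y + 1 < B ^ m"
      unfolding power_Suc2 mult_less_cancel2 using assms by simp
    ultimately show ?thesis using Suc.IH[OF x(3)] True assms unfolding digs by (simp del: digs.simps)
  next
    case False
    then have "x + 1 < B ^ Suc m" "digs B (Suc m) (x + 1) = (r + 2) # digs B m y"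
      using digit_bound[of "r + 1" B y m] digs_Suc[of "r + 1" B m y] x by simp_all
    then show ?thesis using False assms x(2) unfolding digs by (simp del: digs.simps)
  qed
qed simp

text \<open>A digit 0 borrows: it becomes \<open>B - 1\<close>, written as the symbol
  \<open>B\<close>, and the rest decreases. Only the number 0 has to borrow from the blank.\<close>

lemma sweep_Decr:
  assumes "2 \<le> B"
  shows "x < B ^ m \<Longrightarrow> sweep B Decr (digs B m x) = (if 0 < x then Some (digs B m (x - 1), True) else None)"
proof (induction m arbitrary: x)
  case (Suc m)
  obtain y r where x: "x = y * B + r" "r < B" "y < B ^ m"
    using digit_split[OF Suc.prems] assms by auto
  have digs: "digs B (Suc m) x = (r + 1) # digs B m y" using x(1,2) digs_Suc by simp
  show ?case
  proof (cases "r = 0")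
    case True
    have "digs B (Suc m) (x - 1) = B # digs B m (y - 1)" if "0 < y"
    proof -
      have "x - 1 = (y - 1) * B + (B - 1)"
        using that True x(1) assms by (cases y) simp_all
      then show ?thesis using digs_Suc[of "B - 1" B m "y - 1"] assms by simp
    qed
    moreover have "0 < x \<longleftrightarrow> 0 < y" using x(1) True assms by simp
    ultimately show ?thesis using Suc.IH[OF x(3)] True assms unfolding digs by (simp del: digs.simps)
  next
    case False
    then have "digs B (Suc m) (x - 1) = r # digs B m y" "0 < x"
      using digs_Suc[of "r - 1" B m y] x by simp_all
    then show ?thesis using False assms x(2) unfolding digs by (simp del: digs.simps)
  qed
qed simp

lemma sweep_TestZero:
  assumes "2 \<le> B"
  shows "x < B ^ m \<Longrightarrow> sweep B TestZero (digs B m x) = Some (digs B m x, x = 0)"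
proof (induction m arbitrary: x)
  case (Suc m)
  obtain y r where x: "x = y * B + r" "r < B" "y < B ^ m"
    using digit_split[OF Suc.prems] assms by auto
  have digs: "digs B (Suc m) x = (r + 1) # digs B m y" using x(1,2) digs_Suc by simp
  show ?case using Suc.IH[OF x(3)] assms x(1,2) unfolding digs by (simp del: digs.simps)
qed (simp add: assms)

lemma sweep_TestMax:
  assumes "2 \<le> B"
  shows "x < B ^ m \<Longrightarrow> sweep B TestMax (digs B m x) = Some (digs B m x, x + 1 = B ^ m)"
proof (induction m arbitrary: x)
  case (Suc m)
  obtain y r where x: "x = y * B + r" "r < B" "y < B ^ m"
    using digit_split[OF Suc.prems] assms by auto
  have digs: "digs B (Suc m) x = (r + 1) # digs B m y" using x(1,2) digs_Suc by simp
  \<comment> \<open>The largest number is the one all of whose digits are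
    \<open>B - 1\<close>.\<close>
  have "x + 1 = B ^ Suc m \<longleftrightarrow> r + 1 = B \<and> y + 1 = B ^ m"
  proof (cases "r + 1 = B")
    case True
    then have "x + 1 = B * (y + 1)" using x(1) by simp
    then have "x + 1 = B ^ Suc m \<longleftrightarrow> B * (y + 1) = B * B ^ m" by simp
    also have "\<dots> \<longleftrightarrow> y + 1 = B ^ m" using assms by (metis mult_cancel1 not_numeral_le_zero)
    finally show ?thesis using True by simp
  next
    case False
    then have "x + 1 < B ^ Suc m" using digit_bound[of "r + 1" B y m] x by simp
    then show ?thesis using False by simp
  qed
  then show ?case using Suc.IH[OF x(3)] assms x(2) unfolding digs by (simp del: digs.simps)
qed (simp add: assms)

section \<open>The binary counter\<close>

fun bits :: "nat \<Rightarrow> symbol list" where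
  "bits n = (if n = 0 then [] else (n mod 2 + 1) # bits (n div 2))"

declare bits.simps [simp del]

lemma bits_0 [simp]: "bits 0 = []"
  by (simp add: bits.simps)

lemma bits_pos: "0 < n \<Longrightarrow> bits n = (n mod 2 + 1) # bits (n div 2)"
  by (simp add: bits.simps[of n])

text \<open>The symbols 1 and 2 are the bits 0 and 1, so \<open>bits 0\<close> is a blank tape and a
  carry out of the last bit appends a cell. As \<open>B\<close> is at least 2, the same symbols are
  also digits in base \<open>B\<close>.\<close>

lemma sweep_Count:
  assumes "2 \<le> B"
  shows "sweep B Count (bits n) = Some (bits (n + 1), True)"
proof (induction n rule: bits.induct)
  case (1 n)
  show ?case
  proof (cases "n = 0")
    case True
    then show ?thesis using assms by (simp add: bits_pos)
  next
    case False
    then have IH: "sweep B Count (bits (n div 2)) = Some (bits (n div 2 + 1), True)" by (rule 1)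
    show ?thesis
    proof (cases "even n")
      case True
      then have "(n + 1) mod 2 = 1" "(n + 1) div 2 = n div 2" "n mod 2 = 0" by presburger+
      then show ?thesis using False assms by (simp add: bits_pos)
    next
      case odd: False
      then have "(n + 1) mod 2 = 0" "(n + 1) div 2 = n div 2 + 1" "n mod 2 = 1" by presburger+
      then show ?thesis using False assms IH by (simp add: bits_pos)
    qed
  qed
qed

lemma set_bits: "set (bits n) \<subseteq> {1..2}"
proof (induction n rule: bits.induct)
  case (1 n)
  then show ?case by (cases "n = 0") (auto simp: bits_pos)
qed

lemma length_bits_mono: "k \<le> n \<Longrightarrow> length (bits k) \<le> length (bits n)"
proof (induction n arbitrary: k rule: bits.induct)
  case (1 n)
  show ?case
  proof (cases "k = 0")
    case False
    then show ?thesis using 1 by (simp add: bits_pos div_le_mono)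
  qed simp
qed

lemma less_power_length_bits: "n < 2 ^ length (bits n)"
proof (induction n rule: bits.induct)
  case (1 n)
  show ?case
  proof (cases "n = 0")
    case False
    then have "n div 2 < 2 ^ length (bits (n div 2))" by (rule 1)
    then show ?thesis using False by (simp add: bits_pos)
  qed simp
qed

lemma power_length_bits_le: "0 < n \<Longrightarrow> 2 ^ length (bits n) \<le> 2 * n"
proof (induction n rule: bits.induct)
  case (1 n)
  show ?case
  proof (cases "n div 2 = 0")
    case True
    then have "n = 1" using 1 by auto
    then show ?thesis by (simp add: bits_pos)
  next
    case False
    then show ?thesis using 1 by (simp add: bits_pos)
  qed
qed

text \<open>The count ends at \<open>n + 2\<close>, one unit for each input position including both
  markers.\<close>

definition width :: "nat \<Rightarrow> nat" where
  "width n = length (bits (n + 2))"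

section \<open>Simulation of a program by the compiled machine\<close>

locale machine =
  fixes B K :: nat and \<Sigma> :: "symbol set" and p :: com and w :: "symbol list"
  assumes B: "2 \<le> B" and K: "0 < K" and w: "w \<in> lists \<Sigma>" and p: "bounded K p"
begin

abbreviation "n \<equiv> length w"
abbreviation "N \<equiv> B ^ width n"
abbreviation "M \<equiv> compile B K \<Sigma> p"

text \<open>Besides the digits this covers the marker in cell 0 and the blank after the digits,
  where a sweep may end.\<close>

definition S :: nat where
  "S = width n + 2"

lemma S_pos [simp]: "0 < S"
  by (simp add: S_def)

definition cfg :: "ctl \<Rightarrow> nat \<Rightarrow> wtape list \<Rightarrow> symbol list \<Rightarrow> config" where
  "cfg q i ts out = Config (to_nat q) i ts out"

abbreviation heads :: "wtape list \<Rightarrow> symbol list" where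
  "heads ts \<equiv> map (\<lambda>(t, h). t h) ts"

definition good :: "wtape list \<Rightarrow> bool" where
  "good ts \<longleftrightarrow> length ts = K \<and> set (heads ts) \<subseteq> {..B + 1}"

lemma input_cell_cells: "input_cell w i \<in> cells \<Sigma>"
proof -
  have "w ! (i - 1) \<in> \<Sigma>" if "i \<noteq> 0" "i \<le> length w"
    using w that by (meson Suc_pred' less_eq_Suc_le nth_mem in_lists_conv_set neq0_conv order_less_le_trans diff_less zero_less_one)
  then show ?thesis by (auto simp: input_cell_def cells_def)
qed

text \<open>As long as the scanned symbols are covered by the finite rule set, the machine has
  exactly the steps prescribed by \<open>delta\<close>; in particular it is stuck exactly where
  \<open>delta\<close> is empty.\<close>

lemma step_iff:
  assumes "q \<in> ctls K p" "good ts"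
  shows "step M w (cfg q i ts out) c' \<longleftrightarrow>
    (\<exists>q' d as y. (q', d, as, y) \<in> set (delta B p q (input_cell w i) (heads ts)) \<and>
       c' = cfg q' (min (length w + 1) (move_head d i)) (map2 act ts as)
              (out @ (case y of None \<Rightarrow> [] | Some s \<Rightarrow> [s])))" (is "_ = ?r")
proof
  assume "step M w (cfg q i ts out) c'"
  then obtain m d as y where r: "((to_nat q, input_cell w i, heads ts), (m, d, as, y)) \<in> rules M"
    and c': "c' = Config m (min (length w + 1) (move_head d i)) (map2 act ts as)
              (out @ (case y of None \<Rightarrow> [] | Some s \<Rightarrow> [s]))"
    unfolding cfg_def by (cases rule: step.cases) blast
  show ?r using r by (rule compile_rule) (auto simp: c' cfg_def)
next
  assume ?r
  then obtain q' d as y where r: "(q', d, as, y) \<in> set (delta B p q (input_cell w i) (heads ts))"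
    and c': "c' = cfg q' (min (length w + 1) (move_head d i)) (map2 act ts as)
              (out @ (case y of None \<Rightarrow> [] | Some s \<Rightarrow> [s]))" by blast
  have "heads ts \<in> scans B K" using assms(2) by (simp add: good_def scans_def)
  moreover have "((to_nat q, input_cell w i, heads ts), (to_nat q', d, as, y)) \<in>
     (\<lambda>(q', d, as, y). ((to_nat q, input_cell w i, heads ts), (to_nat q', d, as, y))) `
        set (delta B p q (input_cell w i) (heads ts))"
    using r by (rule rev_image_eqI) simp
  ultimately have "((to_nat q, input_cell w i, heads ts), (to_nat q', d, as, y)) \<in> rules M"
    unfolding compile_def tm.simps using assms(1) input_cell_cells by blast
  then show "step M w (cfg q i ts out) c'" unfolding c' cfg_def by (rule step.intros)
qed

text \<open>The two facts that every configuration inside a run must supply: one for the space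
  bound, and one saying that acceptance cannot happen in the middle of an operation.\<close>

definition quiet :: "config \<Rightarrow> bool" where
  "quiet c \<longleftrightarrow> (\<forall>(t, h) \<in> set (work c). h < S) \<and> state c \<noteq> to_nat (Run [])"

text \<open>A run without branching. Every computation through its first configuration stays on the run until
  it reaches the last one, so a forward simulation also gives the converse and the space bound.\<close>

inductive drun :: "config \<Rightarrow> config \<Rightarrow> bool" where
  refl: "drun c c"
| step: "quiet c \<Longrightarrow> (\<And>d. step M w c d \<longleftrightarrow> d = c1) \<Longrightarrow> drun c1 c2 \<Longrightarrow> drun c c2"

lemma drun_trans: "drun a b \<Longrightarrow> drun b c \<Longrightarrow> drun a c"
  by (induction rule: drun.induct) (auto intro: drun.step)

text \<open>The machine's form of a blocked command: the sweep runs on until \<open>table\<close>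
  gives no entry, without ever passing the halting state.\<close>

definition dead :: "config \<Rightarrow> bool" where
  "dead c \<longleftrightarrow> (\<exists>c'. drun c c' \<and> quiet c' \<and> (\<forall>d. \<not> step M w c' d))"

lemma drun_dead: "drun a b \<Longrightarrow> dead b \<Longrightarrow> dead a"
  unfolding dead_def by (meson drun_trans)

lemma drun_steps: "drun a b \<Longrightarrow> (step M w)\<^sup>*\<^sup>* a b"
  by (induction rule: drun.induct) (auto intro: converse_rtranclp_into_rtranclp)

definition tapes :: "nat option \<Rightarrow> wtape \<Rightarrow> (nat \<Rightarrow> wtape) \<Rightarrow> wtape list" where
  "tapes sel t f = map (\<lambda>j. if sel = None \<or> sel = Some j then t else f j) [0..<K]"

definition frozen :: "(nat \<Rightarrow> wtape) \<Rightarrow> bool" where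
  "frozen f \<longleftrightarrow> (\<forall>j. snd (f j) = 0 \<and> fst (f j) 0 \<le> B + 1)"

definition sel_ok :: "nat option \<Rightarrow> bool" where
  "sel_ok sel \<longleftrightarrow> (\<forall>j. sel = Some j \<longrightarrow> j < K)"

lemma good_tapes:
  assumes "frozen f" "t h \<le> B + 1"
  shows "good (tapes sel (t, h) f)"
proof -
  have "(case f j of (t, h) \<Rightarrow> t h) \<le> B + 1" for j
    using assms(1) by (cases "f j") (metis frozen_def fst_conv snd_conv case_prod_conv)
  then show ?thesis using assms(2) by (auto simp: good_def tapes_def simp del: One_nat_def add_Suc_right)
qed

lemma scanned_tapes: "sel_ok sel \<Longrightarrow> scanned sel (heads (tapes sel (t, h) f)) = t h"
  using K by (cases sel) (simp_all add: scanned_def tapes_def sel_ok_def)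

lemma act_idle: "map2 act ts (idle (heads ts)) = ts"
  by (induction ts) (auto simp: idle_def act_def)

lemma act_tapes:
  "map2 act (tapes sel (t, h) f) (acts sel s d (heads (tapes sel (t, h) f))) =
   tapes sel (t(h := s), move_head d h) f"
  by (rule nth_equalityI) (auto simp: acts_def tapes_def act_def split: prod.split)

definition tape_of :: "symbol list \<Rightarrow> nat \<Rightarrow> symbol" where
  "tape_of ds i = (if i = 0 then B + 1 else if i \<le> length ds then ds ! (i - 1) else 0)"

lemma tape_of_0 [simp]: "tape_of ds 0 = B + 1"
  by (simp add: tape_of_def)

lemma tape_of_le: "set ds \<subseteq> {..B} \<Longrightarrow> i \<noteq> 0 \<Longrightarrow> tape_of ds i \<le> B"
  using subsetD[of "set ds" "{..B}" "ds ! (i - 1)"] by (auto simp: tape_of_def)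

lemma tape_of_append [simp]: "tape_of (ds @ e # es) (Suc (length ds)) = e"
  by (simp add: tape_of_def nth_append)

lemma tape_of_end [simp]: "tape_of ds (Suc (length ds)) = 0"
  by (simp add: tape_of_def)

lemma tape_of_upd [simp]: "(tape_of (ds @ e # es))(Suc (length ds) := s) = tape_of (ds @ s # es)"
  by (rule ext) (auto simp: tape_of_def nth_append nth_Cons')

lemma tape_of_upd_end: "(tape_of ds)(Suc (length ds) := s) = tape_of (ds @ (if s = 0 then [] else [s]))"
  by (rule ext) (auto simp: tape_of_def nth_append)

lemma quiet_tapes:
  assumes "frozen f" "h < S" "q \<noteq> Run []"
  shows "quiet (cfg q i (tapes sel (t, h) f) out)"
proof -
  have "snd (f j) < S" for j using assms(1,2) by (metis frozen_def gr_zeroI not_less_zero)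
  then show ?thesis using assms(2,3) by (auto simp: quiet_def cfg_def tapes_def) (metis snd_conv)
qed

lemma drun_acts:
  assumes "q \<in> ctls K p" "frozen f" "t h \<le> B + 1" "i \<le> length w + 1" "h < S" "q \<noteq> Run []"
    and "delta B p q (input_cell w i) (heads (tapes sel (t, h) f)) =
      [(q', Stay, acts sel s d (heads (tapes sel (t, h) f)), None)]"
    and "drun (cfg q' i (tapes sel (t(h := s), move_head d h) f) out) c"
  shows "drun (cfg q i (tapes sel (t, h) f) out) c"
proof (rule drun.step)
  show "quiet (cfg q i (tapes sel (t, h) f) out)" using assms quiet_tapes by blast
  have "good (tapes sel (t, h) f)" using assms good_tapes by blast
  then show "step M w (cfg q i (tapes sel (t, h) f) out) d' \<longleftrightarrow>
      d' = cfg q' i (tapes sel (t(h := s), move_head d h) f) out" for d'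
    using assms(4) by (simp add: step_iff[OF assms(1)] assms(7) act_tapes)
qed (rule assms)

lemma drun_idle:
  assumes "q \<in> ctls K p" "frozen f" "t h \<le> B + 1" "h < S" "q \<noteq> Run []"
    and "delta B p q (input_cell w i) (heads (tapes sel (t, h) f)) =
      [(q', d, idle (heads (tapes sel (t, h) f)), None)]"
    and "drun (cfg q' (min (length w + 1) (move_head d i)) (tapes sel (t, h) f) out) c"
  shows "drun (cfg q i (tapes sel (t, h) f) out) c"
proof (rule drun.step)
  show "quiet (cfg q i (tapes sel (t, h) f) out)" using assms quiet_tapes by blast
  have "good (tapes sel (t, h) f)" using assms good_tapes by blast
  then show "step M w (cfg q i (tapes sel (t, h) f) out) d' \<longleftrightarrow>
      d' = cfg q' (min (length w + 1) (move_head d i)) (tapes sel (t, h) f) out" for d'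
    by (simp add: step_iff[OF assms(1)] assms(6) act_idle)
qed (rule assms)

text \<open>Digits are at most \<open>B\<close>, so only the marker \<open>B + 1\<close> in cell 0
  stops the return.\<close>

lemma back_run:
  assumes "Back sel a \<in> ctls K p" "sel_ok sel" "frozen f" "i \<le> length w + 1" "set ds \<subseteq> {..B}"
  shows "h < S \<Longrightarrow> drun (cfg (Back sel a) i (tapes sel (tape_of ds, h) f) out)
                          (cfg a i (tapes sel (tape_of ds, 0) f) out)"
proof (induction h)
  case 0
  show ?case
    by (rule drun_idle[OF assms(1,3), where q' = a and d = Stay])
      (use 0 assms in \<open>simp_all add: scanned_tapes min_def drun.refl\<close>)
next
  case (Suc h)
  have le: "tape_of ds (Suc h) \<le> B" using assms(5) tape_of_le by blast
  show ?case
    by (rule drun_acts[OF assms(1,3), where q' = "Back sel a" and d = MoveLeft and s = "tape_of ds (Suc h)"])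
      (use Suc le assms in \<open>simp_all add: scanned_tapes\<close>)
qed

text \<open>A sweep never continues past the first blank, which is what bounds the head
  position.\<close>

lemma table_0: "table B op 0 \<noteq> Some (s, None)"
  using B by (cases op) auto

lemma table_le: "table B op s = Some (s', e) \<Longrightarrow> s \<le> B \<Longrightarrow> s' \<le> B"
  using B by (cases op) (auto split: if_splits)

lemma sweep_set: "sweep B op ds = Some (ds', e) \<Longrightarrow> set ds \<subseteq> {..B} \<Longrightarrow> set ds' \<subseteq> {..B}"
proof (induction ds arbitrary: ds' e)
  case Nil
  then obtain s where "table B op 0 = Some (s, Some e)" "ds' = (if s = 0 then [] else [s])"
    by (auto split: option.splits)
  then show ?case using table_le by auto
next
  case (Cons d ds)
  from Cons.prems consider s where "table B op d = Some (s, Some e)" "ds' = s # ds"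
    | s ds'' where "table B op d = Some (s, None)" "sweep B op ds = Some (ds'', e)" "ds' = s # ds''"
    by (auto split: option.splits)
  then show ?case
    using Cons table_le[of op d] by cases auto
qed

text \<open>The list \<open>pre\<close> is the part of the tape that has already been rewritten; it
  grows while the induction consumes \<open>ds\<close>.\<close>

lemma sweep_run:
  assumes q: "Sweep sel op a b \<in> ctls K p" and ok: "sel_ok sel" "frozen f" "i \<le> length w + 1"
  shows "length (pre @ ds) + 1 < S \<Longrightarrow> set (pre @ ds) \<subseteq> {..B} \<Longrightarrow>
    (case sweep B op ds of
       Some (ds', e) \<Rightarrow> \<exists>h < S. drun (cfg (Sweep sel op a b) i (tapes sel (tape_of (pre @ ds), length pre + 1) f) out)
         (cfg (Back sel (if e then a else b)) i (tapes sel (tape_of (pre @ ds'), h) f) out)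
     | None \<Rightarrow> dead (cfg (Sweep sel op a b) i (tapes sel (tape_of (pre @ ds), length pre + 1) f) out))"
    (is "_ \<Longrightarrow> _ \<Longrightarrow> ?P pre ds")
proof (induction ds arbitrary: pre)
  case Nil
  show ?case
  proof (cases "table B op 0")
    case None
    have "good (tapes sel (tape_of pre, length pre + 1) f)"
      by (rule good_tapes) (simp_all add: ok)
    with None ok(1) have "\<not> step M w (cfg (Sweep sel op a b) i (tapes sel (tape_of pre, length pre + 1) f) out) d" for d
      by (simp add: step_iff[OF q] scanned_tapes)
    moreover have "quiet (cfg (Sweep sel op a b) i (tapes sel (tape_of pre, length pre + 1) f) out)"
      by (rule quiet_tapes) (use ok Nil in simp_all)
    ultimately show ?thesis using None by (auto simp: dead_def intro: drun.refl)
  next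
    case (Some r)
    then obtain s e where r: "table B op 0 = Some (s, Some e)" using table_0 by (cases r; cases "snd r") auto
    have "drun (cfg (Sweep sel op a b) i (tapes sel (tape_of pre, length pre + 1) f) out)
         (cfg (Back sel (if e then a else b)) i
           (tapes sel (tape_of (pre @ (if s = 0 then [] else [s])), length pre + 1) f) out)"
      by (rule drun_acts[OF q, where q' = "Back sel (if e then a else b)" and d = Stay and s = s])
        (use Nil ok r in \<open>simp_all add: scanned_tapes tape_of_upd_end drun.refl\<close>)
    then show ?thesis using r Nil by (auto simp del: append.simps)
  qed
next
  case (Cons d ds)
  have dB: "d \<le> B" using Cons.prems by simp
  have le: "tape_of (pre @ d # ds) (length pre + 1) \<le> B + 1" using dB by simp
  show ?case
  proof (cases "table B op d")
    case None
    have "good (tapes sel (tape_of (pre @ d # ds), length pre + 1) f)"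
      by (rule good_tapes) (use le ok in simp_all)
    with None ok(1) have "\<not> step M w (cfg (Sweep sel op a b) i (tapes sel (tape_of (pre @ d # ds), length pre + 1) f) out) d'" for d'
      by (simp add: step_iff[OF q] scanned_tapes)
    moreover have "quiet (cfg (Sweep sel op a b) i (tapes sel (tape_of (pre @ d # ds), length pre + 1) f) out)"
      by (rule quiet_tapes) (use ok Cons.prems in simp_all)
    ultimately show ?thesis using None by (auto simp: dead_def intro: drun.refl)
  next
    case (Some r)
    then obtain s e where r: "table B op d = Some (s, e)" by (cases r) auto
    show ?thesis
    proof (cases e)
      case None
      have s: "s \<le> B" using table_le r dB by blast
      have run: "drun (cfg (Sweep sel op a b) i (tapes sel (tape_of (pre @ d # ds), length pre + 1) f) out)
          (cfg (Sweep sel op a b) i (tapes sel (tape_of ((pre @ [s]) @ ds), length (pre @ [s]) + 1) f) out)"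
        by (rule drun_acts[OF q, where q' = "Sweep sel op a b" and d = MoveRight and s = s])
          (use Cons.prems le ok r None in \<open>simp_all add: scanned_tapes drun.refl\<close>)
      have "?P (pre @ [s]) ds" using Cons.prems s by (intro Cons.IH) auto
      then show ?thesis
        using drun_trans[OF run] drun_dead[OF run] r None by (auto split: option.splits)
    next
      case (Some e')
      have "drun (cfg (Sweep sel op a b) i (tapes sel (tape_of (pre @ d # ds), length pre + 1) f) out)
         (cfg (Back sel (if e' then a else b)) i (tapes sel (tape_of (pre @ s # ds), length pre + 1) f) out)"
        by (rule drun_acts[OF q, where q' = "Back sel (if e' then a else b)" and d = Stay and s = s])
          (use Cons.prems le ok r Some in \<open>simp_all add: scanned_tapes drun.refl\<close>)
      then show ?thesis using r Some Cons.prems by (auto intro!: exI[of _ "length pre + 1"])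
    qed
  qed
qed

lemma full_sweep:
  assumes "Sweep sel op a b \<in> ctls K p" "Back sel a \<in> ctls K p" "Back sel b \<in> ctls K p"
    and "sel_ok sel" "frozen f" "i \<le> length w + 1" "length ds + 1 < S" "set ds \<subseteq> {..B}"
  shows "case sweep B op ds of
       Some (ds', e) \<Rightarrow> drun (cfg (Sweep sel op a b) i (tapes sel (tape_of ds, 0) f) out)
         (cfg (if e then a else b) i (tapes sel (tape_of ds', 0) f) out)
     | None \<Rightarrow> dead (cfg (Sweep sel op a b) i (tapes sel (tape_of ds, 0) f) out)"
proof -
  have upd: "(tape_of ds)(0 := B + 1) = tape_of ds" by (rule ext) simp
  have t: "table B op (B + 1) = Some (B + 1, None)" by (cases op) simp_all
  have run: "drun (cfg (Sweep sel op a b) i (tapes sel (tape_of ds, 0) f) out)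
      (cfg (Sweep sel op a b) i (tapes sel (tape_of ds, 1) f) out)"
    by (rule drun_acts[OF assms(1), where q' = "Sweep sel op a b" and d = MoveRight and s = "B + 1"])
      (use assms t upd in \<open>simp_all add: scanned_tapes drun.refl\<close>)
  note main = sweep_run[OF assms(1,4-6), where pre = "[]" and ds = ds and out = out]
  show ?thesis
  proof (cases "sweep B op ds")
    case None
    then show ?thesis using main assms(7,8) drun_dead[OF run] by simp
  next
    case (Some r)
    then obtain ds' e where r: "sweep B op ds = Some (ds', e)" by (cases r) auto
    then obtain h where "h < S"
      "drun (cfg (Sweep sel op a b) i (tapes sel (tape_of ds, 1) f) out)
         (cfg (Back sel (if e then a else b)) i (tapes sel (tape_of ds', h) f) out)"
      using main assms(7,8) by auto
    moreover have "Back sel (if e then a else b) \<in> ctls K p" using assms(2,3) by simp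
    moreover have "set ds' \<subseteq> {..B}" using sweep_set r assms(8) by blast
    ultimately have "drun (cfg (Sweep sel op a b) i (tapes sel (tape_of ds, 1) f) out)
         (cfg (if e then a else b) i (tapes sel (tape_of ds', 0) f) out)"
      using back_run assms(4-6) drun_trans by blast
    then show ?thesis using r drun_trans[OF run] by simp
  qed
qed

definition tps :: "(nat \<Rightarrow> nat) \<Rightarrow> wtape list" where
  "tps v = map (\<lambda>j. (tape_of (digs B (width n) (v j)), 0)) [0..<K]"

fun conf :: "com list \<Rightarrow> store \<Rightarrow> config" where
  "conf k (i, v, out) = cfg (Run k) i (tps v) out"

fun valid :: "store \<Rightarrow> bool" where
  "valid (i, v, out) \<longleftrightarrow> i \<le> n + 1 \<and> (\<forall>j. v j < N)"

lemma sstep_valid: "sstep w N (k, s) (k', s') \<Longrightarrow> valid s \<Longrightarrow> valid s'"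
  by (cases rule: sstep.cases, assumption) (auto split: if_splits, meson less_imp_diff_less)

lemma sstep_stacks: "sstep w N (k, s) (k', s') \<Longrightarrow> k \<in> stacks p [] \<Longrightarrow> k' \<in> stacks p []"
proof -
  assume *: "sstep w N (k, s) (k', s')" "k \<in> stacks p []"
  have "k' \<in> succs k" "k \<noteq> []" using *(1) by (cases rule: sstep.cases, auto)+
  then show ?thesis using succs_stacks[OF *(2)] by blast
qed

lemma good_tps: "good (tps v)"
  by (auto simp: good_def tps_def)

lemma idle_step:
  assumes "k \<in> stacks p []" "i \<le> n + 1"
    and "\<And>x ss. delta B p (Run k) x ss = map (\<lambda>q. (q, Stay, idle ss, None)) (qs x)"
  shows "step M w (conf k (i, v, out)) d \<longleftrightarrow> (\<exists>q \<in> set (qs (input_cell w i)). d = cfg q i (tps v) out)"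
proof -
  have ctl: "Run k \<in> ctls K p" using assms(1) by (simp add: ctls_def run_ctls_def)
  have "step M w (conf k (i, v, out)) d \<longleftrightarrow> (\<exists>r \<in> set (delta B p (Run k) (input_cell w i) (heads (tps v))).
      case r of (q', d', as, y) \<Rightarrow> d = cfg q' (min (n + 1) (move_head d' i)) (map2 act (tps v) as)
              (out @ (case y of None \<Rightarrow> [] | Some s \<Rightarrow> [s])))"
    unfolding conf.simps step_iff[OF ctl good_tps] by fast
  then show ?thesis using assms(2) by (simp add: assms(3) act_idle)
qed

lemma reg_sweep:
  assumes "Run a \<in> run_ctls p" "Run b \<in> run_ctls p" "op \<in> {Incr, Decr, TestZero, TestMax}"
    and "j < K" "valid (i, v, out)"
  shows "case sweep B op (digs B (width n) (v j)) of
       Some (ds, e) \<Rightarrow> \<forall>x. ds = digs B (width n) x \<longrightarrow>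
          drun (cfg (Sweep (Some j) op (Run a) (Run b)) i (tps v) out) (conf (if e then a else b) (i, v(j := x), out))
     | None \<Rightarrow> dead (cfg (Sweep (Some j) op (Run a) (Run b)) i (tps v) out)"
proof -
  define f where "f = (\<lambda>l. (tape_of (digs B (width n) (v l)), 0 :: nat))"
  have tapes: "tapes (Some j) (tape_of (digs B (width n) x), 0) f = tps (v(j := x))" for x
    using assms(4) by (auto simp: tapes_def tps_def f_def)
  have tapes': "tapes (Some j) (tape_of (digs B (width n) (v j)), 0) f = tps v"
    using tapes[of "v j"] by simp
  have ctl: "Sweep (Some j) op (Run a) (Run b) \<in> ctls K p" "Back (Some j) (Run a) \<in> ctls K p" "Back (Some j) (Run b) \<in> ctls K p"
    using assms(1-4) by (auto simp: ctls_def image_iff)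
  have sel: "sel_ok (Some j)" using assms(4) by (simp add: sel_ok_def)
  have f: "frozen f" by (simp add: frozen_def f_def)
  have ds: "set (digs B (width n) (v j)) \<subseteq> {..B}" using set_digs[of B] B by fastforce
  have "case sweep B op (digs B (width n) (v j)) of
       Some (ds', e) \<Rightarrow> drun (cfg (Sweep (Some j) op (Run a) (Run b)) i (tapes (Some j) (tape_of (digs B (width n) (v j)), 0) f) out)
         (cfg (if e then Run a else Run b) i (tapes (Some j) (tape_of ds', 0) f) out)
     | None \<Rightarrow> dead (cfg (Sweep (Some j) op (Run a) (Run b)) i (tapes (Some j) (tape_of (digs B (width n) (v j)), 0) f) out)"
    by (rule full_sweep[OF ctl sel f _ _ ds]) (use assms in \<open>auto simp: S_def\<close>)
  then show ?thesis unfolding tapes' by (auto simp: tapes split: option.splits if_splits)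
qed

text \<open>The machine enters an operation before it is known whether the operation can succeed;
  the second alternative is the first step of an \<open>Inc\<close> or \<open>Dec\<close> that will
  block.\<close>

definition tracks :: "com list \<Rightarrow> store \<Rightarrow> config \<Rightarrow> bool" where
  "tracks k s d \<longleftrightarrow> (\<exists>k' s'. sstep w N (k, s) (k', s') \<and> drun d (conf k' s')) \<or> dead d"

lemma tracksI: "sstep w N (k, s) (k', s') \<Longrightarrow> drun d (conf k' s') \<Longrightarrow> tracks k s d"
  unfolding tracks_def by blast

text \<open>The first part explains every machine step by the program and yields the invariant of
  reachable configurations; the second turns program runs into machine runs.\<close>

definition simulates :: "com list \<Rightarrow> store \<Rightarrow> bool" where
  "simulates k s \<longleftrightarrow> (\<forall>d. step M w (conf k s) d \<longrightarrow> tracks k s d) \<and>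
     (\<forall>k' s'. sstep w N (k, s) (k', s') \<longrightarrow> (step M w)\<^sup>*\<^sup>* (conf k s) (conf k' s'))"

lemma simulates_idle:
  assumes "\<And>d. step M w (conf k s) d \<longleftrightarrow> (\<exists>k'. sstep w N (k, s) (k', s) \<and> d = conf k' s)"
    and "\<And>k' s'. sstep w N (k, s) (k', s') \<Longrightarrow> s' = s"
  shows "simulates k s"
  unfolding simulates_def
proof (intro conjI allI impI)
  fix d assume "step M w (conf k s) d"
  then obtain k' where "sstep w N (k, s) (k', s)" "d = conf k' s" using assms(1) by blast
  then show "tracks k s d" using tracksI[OF _ drun.refl] by blast
next
  fix k' s' assume "sstep w N (k, s) (k', s')"
  then show "(step M w)\<^sup>*\<^sup>* (conf k s) (conf k' s')" using assms by blast
qed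

lemma simulates_direct:
  assumes "\<And>d. step M w (conf k s) d \<longleftrightarrow> d = conf l s1"
    and "\<And>k' s'. sstep w N (k, s) (k', s') \<longleftrightarrow> k' = l \<and> s' = s1"
  shows "simulates k s"
proof -
  have "tracks k s (conf l s1)" using assms(2) by (blast intro: tracksI drun.refl)
  moreover have "(step M w)\<^sup>*\<^sup>* (conf k s) (conf l s1)" using assms(1) by blast
  ultimately show ?thesis using assms by (simp add: simulates_def del: conf.simps)
qed

inductive_cases sstepE: "sstep w N (c # k, s) (k', s')"

text \<open>One argument for all four register operations. The sweep is computed on digit lists
  beforehand, and the outcome \<open>None\<close> has to match a command without successor.\<close>

lemma simulates_reg:
  assumes "k \<in> stacks p []" "a \<in> stacks p []" "b \<in> stacks p []"
    and "op \<in> {Incr, Decr, TestZero, TestMax}" "j < K" "valid (i, v, out)"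
    and delta: "\<And>x ss. delta B p (Run k) x ss = [(Sweep (Some j) op (Run a) (Run b), Stay, idle ss, None)]"
    and "sweep B op (digs B (width n) (v j)) = r"
    and None: "r = None \<Longrightarrow> \<nexists>k' s'. sstep w N (k, (i, v, out)) (k', s')"
    and Some: "\<And>ds e. r = Some (ds, e) \<Longrightarrow> \<exists>x. ds = digs B (width n) x \<and>
      (\<forall>k' s'. sstep w N (k, (i, v, out)) (k', s') \<longleftrightarrow> k' = (if e then a else b) \<and> s' = (i, v(j := x), out))"
  shows "simulates k (i, v, out)"
proof -
  let ?d = "cfg (Sweep (Some j) op (Run a) (Run b)) i (tps v) out"
  have step: "step M w (conf k (i, v, out)) d \<longleftrightarrow> d = ?d" for d
    using idle_step[OF assms(1), of i "\<lambda>_. [Sweep (Some j) op (Run a) (Run b)]" v out d] delta assms(6)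
    by simp
  have sweep: "case r of
       Some (ds, e) \<Rightarrow> \<forall>x. ds = digs B (width n) x \<longrightarrow> drun ?d (conf (if e then a else b) (i, v(j := x), out))
     | None \<Rightarrow> dead ?d"
    using reg_sweep[of a b op j i v out] assms(2-6,8) by (simp add: run_ctls_def)
  show ?thesis
  proof (cases r)
    case None
    then show ?thesis
      using sweep assms(9) by (simp add: simulates_def step tracks_def del: conf.simps)
  next
    case (Some z)
    then obtain ds e where r: "r = Some (ds, e)" by (cases z) auto
    then obtain x where x: "ds = digs B (width n) x"
      and s: "\<And>k' s'. sstep w N (k, (i, v, out)) (k', s') \<longleftrightarrow> k' = (if e then a else b) \<and> s' = (i, v(j := x), out)"
      using assms(10) by blast
    have run: "drun ?d (conf (if e then a else b) (i, v(j := x), out))" using sweep r x by simp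
    have "(step M w)\<^sup>*\<^sup>* (conf k (i, v, out)) (conf (if e then a else b) (i, v(j := x), out))"
      by (rule converse_rtranclp_into_rtranclp[OF iffD2[OF step HOL.refl] drun_steps[OF run]])
    moreover have "tracks k (i, v, out) ?d" using run s by (blast intro: tracksI)
    ultimately show ?thesis unfolding simulates_def step s by blast
  qed
qed

lemma simulates_branch:
  assumes "k \<in> stacks p []" "a \<in> stacks p []" "b \<in> stacks p []" "valid s"
    and "\<And>j. t = IsZero j \<or> t = IsMax j \<Longrightarrow> j < K"
    and delta: "\<And>x ss. delta B p (Run k) x ss = map (\<lambda>q. (q, Stay, idle ss, None)) (branch t (Run a) (Run b) x)"
    and sstep: "\<And>k' s'. sstep w N (k, s) (k', s') \<longleftrightarrow>
      s' = s \<and> (holds w N t s True \<and> k' = a \<or> holds w N t s False \<and> k' = b)"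
  shows "simulates k s"
proof -
  obtain i v out where s: "s = (i, v, out)" by (cases s)
  have i: "i \<le> n + 1" using assms(4) s by simp
  note st = idle_step[OF assms(1) i delta, unfolded conf.simps]
  show ?thesis
  proof (cases t)
    case (IsZero j)
    show ?thesis unfolding s
      by (rule simulates_reg[OF assms(1-3), where op = TestZero and j = j])
        (use assms IsZero sweep_TestZero[OF B, of "v j" "width n"] in \<open>auto simp: s intro!: exI[of _ "v j"]\<close>)
  next
    case (IsMax j)
    show ?thesis unfolding s
      by (rule simulates_reg[OF assms(1-3), where op = TestMax and j = j])
        (use assms IsMax sweep_TestMax[OF B, of "v j" "width n"] in \<open>auto simp: s intro!: exI[of _ "v j"]\<close>)
  next
    case (Scans xs)
    show ?thesis
      by (rule simulates_idle)
        (use assms(4) Scans in \<open>auto simp: s sstep[unfolded s] st\<close>)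
  next
    case Any
    show ?thesis
      by (rule simulates_idle)
        (use assms(4) Any in \<open>auto simp: s sstep[unfolded s] st\<close>)
  qed
qed

lemma simulates:
  assumes "k \<in> stacks p []" "valid s"
  shows "simulates k s"
proof -
  obtain i v out where s: "s = (i, v, out)" by (cases s)
  have v: "v j < N" for j using assms(2) s by simp
  have i: "i \<le> n + 1" using assms(2) s by simp
  have succs: "x \<in> succs k \<Longrightarrow> x \<in> stacks p []" for x
    using succs_stacks[OF assms(1)] by (cases k) auto
  have bnd: "list_all (bounded K) k" using bounded_stacks[OF p assms(1)] .
  have ctl: "Run k \<in> ctls K p" using assms(1) by (simp add: ctls_def run_ctls_def)
  show ?thesis
  proof (cases k)
    case Nil
    then have "\<not> step M w (conf k s) d" for d by (simp add: s step_iff[OF ctl[unfolded Nil] good_tps])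
    moreover have "\<not> sstep w N (k, s) (k', s')" for k' s' using Nil by (auto elim: sstep.cases)
    ultimately show ?thesis by (simp add: simulates_def)
  next
    case (Cons c l)
    note k = Cons
    show ?thesis
    proof (cases c)
      case Skip
      have "sstep w N (k, s) (k', s') \<longleftrightarrow> k' = l \<and> s' = s" for k' s'
        unfolding k Skip by (auto elim: sstepE intro: sstep.Prim)
      then show ?thesis
        using idle_step[OF assms(1) i, where qs = "\<lambda>_. [Run l]"] k Skip s by (intro simulates_idle) auto
    next
      case (Inc j)
      have "sstep w N (k, s) (k', s') \<longleftrightarrow> v j + 1 < N \<and> k' = l \<and> s' = (i, v(j := v j + 1), out)" for k' s'
        unfolding k Inc s by (auto elim: sstepE intro: sstep.Prim)
      then show ?thesis unfolding s
        by (intro simulates_reg[OF assms(1), where op = Incr and j = j and a = l and b = l])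
          (use assms succs bnd k Inc sweep_Incr[OF B v] in \<open>auto simp: s split: if_splits\<close>)
    next
      case (Dec j)
      have "sstep w N (k, s) (k', s') \<longleftrightarrow> 0 < v j \<and> k' = l \<and> s' = (i, v(j := v j - 1), out)" for k' s'
        unfolding k Dec s by (auto elim: sstepE intro: sstep.Prim)
      then show ?thesis unfolding s
        by (intro simulates_reg[OF assms(1), where op = Decr and j = j and a = l and b = l])
          (use assms succs bnd k Dec sweep_Decr[OF B v] in \<open>auto simp: s split: if_splits\<close>)
    next
      case (Move m)
      have ss: "sstep w N (k, s) (k', s') \<longleftrightarrow> k' = l \<and> s' = (min (n + 1) (move_head m i), v, out)" for k' s'
        unfolding k Move s by (auto elim: sstepE intro: sstep.Prim)
      have "step M w (conf k s) d \<longleftrightarrow> d = conf l (min (n + 1) (move_head m i), v, out)" for d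
        using k Move by (simp add: s step_iff[OF ctl[unfolded k Move] good_tps] act_idle)
      then show ?thesis using ss by (rule simulates_direct)
    next
      case (Out y)
      have ss: "sstep w N (k, s) (k', s') \<longleftrightarrow> k' = l \<and> s' = (i, v, out @ [y])" for k' s'
        unfolding k Out s by (auto elim: sstepE intro: sstep.Prim)
      have "step M w (conf k s) d \<longleftrightarrow> d = conf l (i, v, out @ [y])" for d
        using k Out i by (simp add: s step_iff[OF ctl[unfolded k Out] good_tps] act_idle)
      then show ?thesis using ss by (rule simulates_direct)
    next
      case (Seq a b)
      have "sstep w N (k, s) (k', s') \<longleftrightarrow> k' = a # b # l \<and> s' = s" for k' s'
        unfolding k Seq by (auto elim: sstepE intro: sstep.Seq)
      then show ?thesis
        using idle_step[OF assms(1) i, where qs = "\<lambda>_. [Run (a # b # l)]"] k Seq s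
        by (intro simulates_idle) auto
    next
      case (Cond t a b)
      have "sstep w N (k, s) (k', s') \<longleftrightarrow>
         s' = s \<and> (holds w N t s True \<and> k' = a # l \<or> holds w N t s False \<and> k' = b # l)" for k' s'
        unfolding k Cond by (auto elim: sstepE intro: sstep.CondT sstep.CondF)
      then show ?thesis
        by (intro simulates_branch[OF assms(1), where t = t and a = "a # l" and b = "b # l"])
          (use assms succs bnd k Cond in auto)
    next
      case (Until t a)
      have "sstep w N (k, s) (k', s') \<longleftrightarrow>
         s' = s \<and> (holds w N t s True \<and> k' = l \<or> holds w N t s False \<and> k' = a # Until t a # l)" for k' s'
        unfolding k Until by (auto elim: sstepE intro: sstep.UntilT sstep.UntilF)
      then show ?thesis
        by (intro simulates_branch[OF assms(1), where t = t and a = l and b = "a # Until t a # l"])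
          (use assms succs bnd k Until in auto)
    qed
  qed
qed

lemma digs_bits:
  obtains x where "x < N" "bits (n + 2) = digs B (width n) x"
proof -
  have "set (bits (n + 2)) \<subseteq> {1..B}" using set_bits[of "n + 2"] B by fastforce
  from digs_surj[OF this] show ?thesis using that by (auto simp: width_def)
qed

lemma count_sweep:
  assumes "i \<le> n + 1"
  shows "drun (cfg (Sweep None Count Check Check) i (tapes None (tape_of (bits i), 0) (\<lambda>_. (tape_of [], 0))) [])
              (cfg Check i (tapes None (tape_of (bits (i + 1)), 0) (\<lambda>_. (tape_of [], 0))) [])"
proof -
  have "length (bits i) \<le> width n" unfolding width_def by (rule length_bits_mono) (use assms in simp)
  moreover have "set (bits i) \<subseteq> {..B}" using set_bits[of i] B by fastforce
  ultimately show ?thesis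
    using full_sweep[of None Count Check Check "\<lambda>_. (tape_of [], 0)" i "bits i" "[]"] assms sweep_Count[OF B, of i]
    by (simp add: S_def ctls_def sel_ok_def frozen_def)
qed

text \<open>Induction backwards from the right marker, where the count stops.\<close>

lemma count_run:
  assumes "i \<le> n + 1"
  shows "drun (cfg (Sweep None Count Check Check) i (tapes None (tape_of (bits i), 0) (\<lambda>_. (tape_of [], 0))) [])
              (cfg (Run [p]) (n + 1) (tapes None (tape_of (bits (n + 2)), 0) (\<lambda>_. (tape_of [], 0))) [])"
  using assms
proof (induction i rule: inc_induct)
  case base
  have x: "input_cell w (n + 1) = RightEnd" by (simp add: input_cell_def)
  have "drun (cfg Check (n + 1) (tapes None (tape_of (bits (n + 2)), 0) (\<lambda>_. (tape_of [], 0))) [])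
     (cfg (Run [p]) (n + 1) (tapes None (tape_of (bits (n + 2)), 0) (\<lambda>_. (tape_of [], 0))) [])"
    by (rule drun_idle[where q' = "Run [p]" and d = Stay])
      (use x in \<open>simp_all add: ctls_def frozen_def drun.refl\<close>)
  with count_sweep[of "n + 1"] show ?case using drun_trans by force
next
  case (step i)
  have x: "input_cell w i \<noteq> RightEnd" using step(2) by (simp add: input_cell_def)
  have "drun (cfg Check i (tapes None (tape_of (bits (i + 1)), 0) (\<lambda>_. (tape_of [], 0))) [])
     (cfg (Sweep None Count Check Check) (i + 1) (tapes None (tape_of (bits (i + 1)), 0) (\<lambda>_. (tape_of [], 0))) [])"
    by (rule drun_idle[where q' = "Sweep None Count Check Check" and d = MoveRight])
      (use x step(2) in \<open>simp_all add: ctls_def frozen_def drun.refl\<close>)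
  from drun_trans[OF count_sweep this] have "drun
     (cfg (Sweep None Count Check Check) i (tapes None (tape_of (bits i), 0) (\<lambda>_. (tape_of [], 0))) [])
     (cfg (Sweep None Count Check Check) (i + 1) (tapes None (tape_of (bits (i + 1)), 0) (\<lambda>_. (tape_of [], 0))) [])"
    using step(2) by simp
  from drun_trans[OF this] show ?case using step.IH by simp
qed

lemma init_run:
  assumes "bits (n + 2) = digs B (width n) x"
  shows "drun (initial M) (conf [p] (n + 1, \<lambda>_. x, []))"
proof -
  let ?f = "\<lambda>_. (tape_of [], 0 :: nat)"
  have init: "initial M = cfg Start 0 (tapes None (\<lambda>_. 0, 0) ?f) []"
    by (simp add: initial_def cfg_def tapes_def map_replicate_const)
  \<comment> \<open>The first step only writes the marker; the blanks behind it already represent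
    the count 0.\<close>
  have upd: "(\<lambda>_. 0)(0 := B + 1) = tape_of (bits 0)" by (rule ext) (simp add: tape_of_def)
  have "drun (initial M) (cfg (Sweep None Count Check Check) 0 (tapes None (tape_of (bits 0), 0) ?f) [])"
    unfolding init
    by (rule drun_acts[where q' = "Sweep None Count Check Check" and d = Stay and s = "B + 1"])
      (use upd in \<open>simp_all add: ctls_def frozen_def drun.refl\<close>)
  moreover have "tapes None (tape_of (bits (n + 2)), 0) ?f = tps (\<lambda>_. x)"
    unfolding assms by (simp add: tapes_def tps_def)
  ultimately show ?thesis using count_run[of 0] drun_trans by simp
qed

text \<open>Every reachable configuration lies on an unbranched run towards a program configuration
  that the program itself can reach, or is bound to get stuck.\<close>

definition invariant :: "nat \<Rightarrow> config \<Rightarrow> bool" where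
  "invariant x d \<longleftrightarrow> (\<exists>k s. (sstep w N)\<^sup>*\<^sup>* ([p], (n + 1, \<lambda>_. x, [])) (k, s) \<and> drun d (conf k s)) \<or> dead d"

lemma invariantI:
  assumes "(sstep w N)\<^sup>*\<^sup>* ([p], (n + 1, \<lambda>_. x, [])) (k, s)" "drun d (conf k s)"
  shows "invariant x d"
  unfolding invariant_def by (intro disjI1 exI conjI; rule assms)

lemma invariant_dead: "drun d c \<Longrightarrow> quiet c \<Longrightarrow> \<forall>e. \<not> step M w c e \<Longrightarrow> invariant x d"
  unfolding invariant_def dead_def by blast

lemma reachable_valid:
  assumes "(sstep w N)\<^sup>*\<^sup>* ([p], (n + 1, \<lambda>_. x, [])) (k, s)" "x < N"
  shows "k \<in> stacks p [] \<and> valid s"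
  using assms(1)
proof (induction rule: rtranclp_induct2)
  case refl
  then show ?case using assms(2) by (simp add: stacks_self)
next
  case (step k s k' s')
  then show ?case using sstep_valid sstep_stacks by blast
qed

lemma invariant_step:
  assumes "invariant x d" "step M w d d'" "x < N"
  shows "invariant x d'"
proof -
  consider k s where "(sstep w N)\<^sup>*\<^sup>* ([p], (n + 1, \<lambda>_. x, [])) (k, s)" "drun d (conf k s)" | "dead d"
    using assms(1) unfolding invariant_def by blast
  then show ?thesis
  proof cases
    case 1
    show ?thesis using 1(2)
    proof (cases rule: drun.cases)
      case refl
      have "simulates k s" using reachable_valid[OF 1(1) assms(3)] by (intro simulates) auto
      then have "tracks k s d'" using assms(2) refl unfolding simulates_def by blast
      then show ?thesis
        unfolding tracks_def invariant_def using 1(1) by (meson rtranclp.rtrancl_into_rtrancl)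
    next
      case (step c1)
      then have "drun d' (conf k s)" using assms(2) by simp
      with 1(1) show ?thesis by (rule invariantI)
    qed
  next
    case 2
    then obtain c where c: "drun d c" "quiet c" "\<forall>e. \<not> step M w c e" unfolding dead_def by blast
    show ?thesis using c(1)
    proof (cases rule: drun.cases)
      case refl
      then show ?thesis using c(3) assms(2) by blast
    next
      case (step c1)
      then have "drun d' c" using assms(2) by simp
      then show ?thesis using c(2,3) by (rule invariant_dead)
    qed
  qed
qed

lemma reaches_invariant:
  assumes "reaches M w d" "x < N" "bits (n + 2) = digs B (width n) x"
  shows "invariant x d"
  using assms(1) unfolding reaches_def
proof (induction rule: rtranclp_induct)
  case base
  then show ?case by (rule invariantI[OF rtranclp.rtrancl_refl init_run[OF assms(3)]])
next
  case (step d d')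
  then show ?case using invariant_step assms by blast
qed

text \<open>A configuration with a non-empty run ahead of it is quiet; if the run is empty, the
  configuration is its end point, which is a program configuration or a quiet dead end.\<close>

lemma invariant_cases:
  assumes "invariant x d"
  shows "quiet d \<or> (\<exists>k s. (sstep w N)\<^sup>*\<^sup>* ([p], (n + 1, \<lambda>_. x, [])) (k, s) \<and> d = conf k s)"
  using assms unfolding invariant_def dead_def by (metis drun.cases)

lemma heads_bounded:
  assumes "reaches M w d" "(t, h) \<in> set (work d)"
  shows "h < S"
proof -
  obtain x where "x < N" "bits (n + 2) = digs B (width n) x" by (rule digs_bits)
  then have "invariant x d" using reaches_invariant assms by blast
  then consider "quiet d" | k s where "d = conf k s" using invariant_cases by blast
  then show ?thesis
  proof cases
    case 1
    then show ?thesis using assms(2) by (auto simp: quiet_def)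
  next
    case 2
    then show ?thesis using assms(2) by (cases s) (auto simp: cfg_def tps_def)
  qed
qed

theorem correct:
  obtains x where "x < N"
    "accepts M w \<longleftrightarrow> (\<exists>s. ((n + 1, \<lambda>_. x, []), s) \<in> sem w N p)"
    "\<And>s. ((n + 1, \<lambda>_. x, []), s) \<in> sem w N p \<Longrightarrow>
       \<exists>c. reaches M w c \<and> state c = halt_state M \<and> written c = snd (snd s)"
proof -
  obtain x where x: "x < N" "bits (n + 2) = digs B (width n) x" by (rule digs_bits)
  let ?s0 = "(n + 1, \<lambda>_. x, []) :: store"
  have out: "\<exists>c. reaches M w c \<and> state c = halt_state M \<and> written c = snd (snd s)"
    if "(?s0, s) \<in> sem w N p" for s
  proof -
    have "(step M w)\<^sup>*\<^sup>* (conf [p] ?s0) (conf k s')" if "(sstep w N)\<^sup>*\<^sup>* ([p], ?s0) (k, s')" for k s'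
      using that
    proof (induction rule: rtranclp_induct2)
      case (step k s' k' s'')
      then have "simulates k s'" using reachable_valid[OF step(1) x(1)] by (intro simulates) auto
      then show ?case using step unfolding simulates_def by (meson rtranclp_trans)
    qed simp
    then have "(step M w)\<^sup>*\<^sup>* (conf [p] ?s0) (conf [] s)" using that by (simp only: ssteps_iff_sem)
    then have "reaches M w (conf [] s)"
      using drun_steps[OF init_run[OF x(2)]] unfolding reaches_def by (meson rtranclp_trans)
    then show ?thesis by (cases s) (auto simp: cfg_def)
  qed
  have "\<exists>s. (?s0, s) \<in> sem w N p" if "accepts M w"
  proof -
    obtain c where c: "reaches M w c" "state c = to_nat (Run [])"
      using \<open>accepts M w\<close> by (auto simp: accepts_def)
    then have "invariant x c" using reaches_invariant x by blast
    \<comment> \<open>Quiet configurations do not halt, so this is a program configuration; the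
      halting control belongs to the empty stack only.\<close>
    then obtain k s where ks: "(sstep w N)\<^sup>*\<^sup>* ([p], ?s0) (k, s)" "c = conf k s"
      using invariant_cases c(2) unfolding quiet_def by blast
    then have "k = []" using c(2) by (cases s) (simp add: cfg_def)
    then show ?thesis using ks(1) by (auto simp only: ssteps_iff_sem)
  qed
  moreover have "accepts M w" if "(?s0, s) \<in> sem w N p" for s
    using out[OF that] unfolding accepts_def by blast
  ultimately show ?thesis using that[OF x(1) _ out] by blast
qed

end

text \<open>Combines \<open>2 ^ width n \<le> 2 * (n + 2)\<close> with
  \<open>n + 2 \<le> n * n\<close>. From 3 on, \<open>ln n\<close> is at least 1, because e is at
  most 3; so the additive constant 3 is absorbed into a multiple of the logarithm.\<close>

lemma width_bigo: "(\<lambda>n. real (width n + 2)) \<in> O(\<lambda>n. ln (real n))"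
proof (rule bigoI)
  show "\<forall>\<^sub>F n in at_top. norm (real (width n + 2)) \<le> (3 + 2 / ln 2) * norm (ln (real n))"
  proof (rule eventually_mono[OF eventually_ge_at_top[of 3]])
    fix n :: nat
    assume n: "3 \<le> n"
    have "2 ^ width n \<le> 2 * (n + 2)"
      using power_length_bits_le[of "n + 2"] by (simp add: width_def)
    then have "real (2 ^ width n) \<le> real (2 * (n + 2))" by (simp only: of_nat_le_iff)
    then have "ln (2 ^ width n) \<le> ln (2 * (real n + 2))" by (subst ln_le_cancel_iff) auto
    then have 1: "width n * ln 2 \<le> ln 2 + ln (real n + 2)"
      using ln_mult[of 2 "real n + 2"] by (simp add: ln_realpow del: distrib_left_numeral)
    have "n + 2 \<le> n * n" using mult_le_mono1[OF n, of n] n by linarith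
    then have "real n + 2 \<le> real n * real n" by (metis of_nat_le_iff of_nat_mult of_nat_add of_nat_numeral)
    then have "ln (real n + 2) \<le> ln (real n * real n)" using n by (subst ln_le_cancel_iff) auto
    then have 2: "ln (real n + 2) \<le> 2 * ln (real n)" using n by (simp add: ln_mult)
    have "exp 1 \<le> real n" using exp_le n by linarith
    then have 3: "1 \<le> ln (real n)" using n by (simp add: ln_ge_iff)
    have "real (width n) \<le> 1 + 2 / ln 2 * ln (real n)"
      using 1 2 by (simp add: field_simps)
    then have "real (width n + 2) \<le> 3 * ln (real n) + 2 / ln 2 * ln (real n)" using 3 by simp
    also have "\<dots> = (3 + 2 / ln 2) * ln (real n)" by (simp add: distrib_right)
    finally show "norm (real (width n + 2)) \<le> (3 + 2 / ln 2) * norm (ln (real n))" using 3 by simp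
  qed
qed


text \<open>The interface through which both directions build their machines. The value
  \<open>x\<close> is what the count leaves in all registers, so a program has to cope with an
  unknown start.\<close>

theorem program_to_tm:
  assumes "finite \<Sigma>" "bounded K p" "0 < K" "0 < C"
  obtains M where "is_tm M" "logspace M \<Sigma>" "det p \<longrightarrow> deterministic M"
    "\<And>w. w \<in> lists \<Sigma> \<Longrightarrow> \<exists>x < (2 ^ C) ^ width (length w).
       (accepts M w \<longleftrightarrow> (\<exists>s. ((length w + 1, \<lambda>_. x, []), s) \<in> sem w ((2 ^ C) ^ width (length w)) p)) \<and>
       (\<forall>s. ((length w + 1, \<lambda>_. x, []), s) \<in> sem w ((2 ^ C) ^ width (length w)) p \<longrightarrow>
         (\<exists>c. reaches M w c \<and> state c = halt_state M \<and> written c = snd (snd s)))"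
proof
  let ?M = "compile (2 ^ C) K \<Sigma> p"
  have B: "2 \<le> (2 :: nat) ^ C" using self_le_power[of "2 :: nat" C] assms(4) by simp
  have m: "machine (2 ^ C) K \<Sigma> p w" if "w \<in> lists \<Sigma>" for w
    using B assms that by unfold_locales auto
  show "is_tm ?M" by (rule is_tm_compile) fact
  show "det p \<longrightarrow> deterministic ?M" using deterministic_compile by blast
  have "space_bounded ?M \<Sigma> (\<lambda>n. width n + 2)"
    unfolding space_bounded_def
  proof (intro ballI allI impI)
    fix w c th
    assume w: "w \<in> lists \<Sigma>" and r: "reaches ?M w c" and th: "th \<in> set (work c)"
    interpret machine "2 ^ C" K \<Sigma> p w using m[OF w] .
    show "case th of (t, h) \<Rightarrow> h < width (length w) + 2"
      using heads_bounded[OF r] th by (cases th) (simp add: S_def)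
  qed
  then show "logspace ?M \<Sigma>" unfolding logspace_def by (intro exI[of _ "\<lambda>n. width n + 2"] conjI width_bigo)
  fix w
  assume w: "w \<in> lists \<Sigma>"
  interpret machine "2 ^ C" K \<Sigma> p w using m[OF w] .
  obtain x where "x < N"
    "accepts M w \<longleftrightarrow> (\<exists>s. ((n + 1, \<lambda>_. x, []), s) \<in> sem w N p)"
    "\<And>s. ((n + 1, \<lambda>_. x, []), s) \<in> sem w N p \<Longrightarrow>
       \<exists>c. reaches M w c \<and> state c = halt_state M \<and> written c = snd (snd s)"
    using correct by blast
  then show "\<exists>x < (2 ^ C) ^ width (length w).
       (accepts M w \<longleftrightarrow> (\<exists>s. ((length w + 1, \<lambda>_. x, []), s) \<in> sem w ((2 ^ C) ^ width (length w)) p)) \<and>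
       (\<forall>s. ((length w + 1, \<lambda>_. x, []), s) \<in> sem w ((2 ^ C) ^ width (length w)) p \<longrightarrow>
         (\<exists>c. reaches M w c \<and> state c = halt_state M \<and> written c = snd (snd s)))"
    by blast
qed

section \<open>Programs that move pointers over the input\<close>

lemma sem_Until_det:
  assumes "\<And>s s1 s2. (s, s1) \<in> sem w N a \<Longrightarrow> (s, s2) \<in> sem w N a \<Longrightarrow> s1 = s2" "t \<noteq> Any"
    and "(s, s1) \<in> sem w N (Until t a)" "(s, s2) \<in> sem w N (Until t a)"
  shows "s1 = s2"
proof -
  have T: "\<not> (holds w N t s True \<and> holds w N t s False)" for s
    using assms(2) by (cases t; cases s) auto
  have 1: "(s, s1) \<in> {(s, s'). holds w N t s False \<and> (s, s') \<in> sem w N a}\<^sup>*" "holds w N t s1 True"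
    using assms(3) by auto
  have "(s, s2) \<in> sem w N (Until t a) \<Longrightarrow> s1 = s2" using 1(1)
  proof (induction rule: converse_rtrancl_induct)
    case base
    then show ?case
      using 1(2) T[of s1] iffD1[OF sem_Until_unfold, of s1 s2 w N t a] by blast
  next
    case (step y z)
    then obtain z' where z': "(y, z') \<in> sem w N a" "(z', s2) \<in> sem w N (Until t a)"
      using T[of y] iffD1[OF sem_Until_unfold, of y s2 w N t a] by blast
    have "(y, z) \<in> sem w N a" using step(1) by simp
    from assms(1)[OF z'(1) this] show ?case using step(3) z'(2) by simp
  qed
  then show ?thesis using assms(4) by blast
qed

lemma sem_det: "det c \<Longrightarrow> (s, s1) \<in> sem w N c \<Longrightarrow> (s, s2) \<in> sem w N c \<Longrightarrow> s1 = s2"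
proof (induction c arbitrary: s s1 s2)
  case (Seq a b)
  then show ?case by (simp only: det.simps sem.simps relcomp_unfold mem_Collect_eq) blast
next
  case (Cond t a b)
  have "\<not> (holds w N t s True \<and> holds w N t s False)"
    using Cond.prems(1) by (cases t; cases s) auto
  then consider "(s, s1) \<in> sem w N a" "(s, s2) \<in> sem w N a" | "(s, s1) \<in> sem w N b" "(s, s2) \<in> sem w N b"
    using Cond.prems(2,3) by auto
  then show ?case
  proof cases
    case 1
    then show ?thesis using Cond.prems(1) by (intro Cond.IH(1)) simp_all
  next
    case 2
    then show ?thesis using Cond.prems(1) by (intro Cond.IH(2)) simp_all
  qed
next
  case (Until t a)
  show ?case
    by (rule sem_Until_det[OF _ _ Until.prems(2,3)]) (use Until in auto)
qed auto

text \<open>For a deterministic command one exhibited outcome settles the whole relation, so each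
  macro below is characterised by constructing a single run.\<close>

lemma sem_det_iff: "det c \<Longrightarrow> (s, s1) \<in> sem w N c \<Longrightarrow> (s, s') \<in> sem w N c \<longleftrightarrow> s' = s1"
  using sem_det by blast

text \<open>Loops are verified by naming the state after each round; the induction counts the rounds
  that remain.\<close>

lemma sem_Until_seq:
  assumes "\<And>k. k < m \<Longrightarrow> holds w N t (st k) False \<and> (st k, st (Suc k)) \<in> sem w N a"
    and "holds w N t (st m) True"
  shows "(st 0, st m) \<in> sem w N (Until t a)"
proof -
  have "k \<le> m \<Longrightarrow> (st (m - k), st m) \<in> sem w N (Until t a)" for k
  proof (induction k)
    case 0
    then show ?case using assms(2) sem_Until_unfold by simp
  next
    case (Suc k)
    then have "Suc (m - Suc k) = m - k" "m - Suc k < m" by auto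
    then have "holds w N t (st (m - Suc k)) False" "(st (m - Suc k), st (m - k)) \<in> sem w N a"
      using assms(1)[of "m - Suc k"] by auto
    then show ?case using Suc sem_Until_unfold[of "st (m - Suc k)" "st m" w N t a] by auto
  qed
  from this[of m] show ?thesis by simp
qed

lemma sem_IncI: "v j + 1 < N \<Longrightarrow> v' = v(j := v j + 1) \<Longrightarrow> ((i, v, out), (i, v', out)) \<in> sem w N (Inc j)"
  by auto

lemma sem_DecI: "0 < v j \<Longrightarrow> v' = v(j := v j - 1) \<Longrightarrow> ((i, v, out), (i, v', out)) \<in> sem w N (Dec j)"
  by auto

lemma sem_SeqI: "(s, s1) \<in> sem w N a \<Longrightarrow> (s1, s2) \<in> sem w N b \<Longrightarrow> (s, s2) \<in> sem w N (a ;; b)"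
  by auto

definition clear :: "nat \<Rightarrow> com" where
  "clear j = Until (IsZero j) (Dec j)"

definition rewind :: com where
  "rewind = Until (Scans [LeftEnd]) (Move MoveLeft)"

text \<open>Register 0 is a scratch register that is zero between operations.\<close>

definition seek :: "nat \<Rightarrow> com" where
  "seek j = rewind ;; Until (IsZero j) (Dec j ;; Inc 0 ;; Move MoveRight) ;;
     Until (IsZero 0) (Dec 0 ;; Inc j)"

text \<open>A register can be read only by counting it down, so its value is parked in register 0
  and restored while the copy is made.\<close>

definition copy :: "nat \<Rightarrow> nat \<Rightarrow> com" where
  "copy j k = clear j ;; Until (IsZero k) (Dec k ;; Inc 0) ;;
     Until (IsZero 0) (Dec 0 ;; Inc k ;; Inc j)"

lemma bounded_macros [simp]:
  "bounded K rewind"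
  "bounded K (clear j) \<longleftrightarrow> j < K"
  "bounded K (seek j) \<longleftrightarrow> 0 < K \<and> j < K"
  "bounded K (copy j k) \<longleftrightarrow> 0 < K \<and> j < K \<and> k < K"
  by (auto simp: clear_def rewind_def seek_def copy_def)

lemma det_macros [simp]: "det rewind" "det (clear j)" "det (seek j)" "det (copy j k)"
  by (simp_all add: clear_def rewind_def seek_def copy_def)

lemma sem_clear: "((i, v, out), s') \<in> sem w N (clear j) \<longleftrightarrow> s' = (i, v(j := 0), out)"
proof (rule sem_det_iff)
  show "((i, v, out), (i, v(j := 0), out)) \<in> sem w N (clear j)"
    unfolding clear_def
    using sem_Until_seq[of "v j" w N "IsZero j" "\<lambda>k. (i, v(j := v j - k), out)" "Dec j"] by fastforce
qed simp

lemma sem_rewind: "((i, v, out), s') \<in> sem w N rewind \<longleftrightarrow> s' = (0, v, out)" if "i \<le> length w + 1"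
proof (rule sem_det_iff)
  show "((i, v, out), (0, v, out)) \<in> sem w N rewind"
    unfolding rewind_def
    using sem_Until_seq[of i w N "Scans [LeftEnd]" "\<lambda>k. (i - k, v, out)" "Move MoveLeft"] that
    by (simp add: input_cell_def)
qed simp

text \<open>A pointer may exceed the input. The head then stops at the right marker, which is also
  what \<open>input_cell\<close> reports for such positions.\<close>

lemma sem_seek:
  assumes "i \<le> length w + 1" "v 0 = 0" "v j < N" "j \<noteq> 0"
  shows "((i, v, out), s') \<in> sem w N (seek j) \<longleftrightarrow> s' = (min (length w + 1) (v j), v, out)"
proof (rule sem_det_iff)
  let ?n = "length w + 1"
  have 1: "((i, v, out), (0, v, out)) \<in> sem w N rewind" using sem_rewind assms(1) by blast
  let ?st = "\<lambda>k. (min ?n k, v(j := v j - k, 0 := k), out)"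
  have "(?st 0, ?st (v j)) \<in> sem w N (Until (IsZero j) (Dec j ;; Inc 0 ;; Move MoveRight))"
  proof (rule sem_Until_seq)
    fix k
    assume k: "k < v j"
    have "(?st k, (min ?n k, v(j := v j - Suc k, 0 := k), out)) \<in> sem w N (Dec j)"
      by (rule sem_DecI) (use k assms in \<open>auto simp: fun_eq_iff\<close>)
    moreover have "((min ?n k, v(j := v j - Suc k, 0 := k), out), (min ?n k, v(j := v j - Suc k, 0 := Suc k), out))
        \<in> sem w N (Inc 0)"
      by (rule sem_IncI) (use k assms in \<open>auto simp: fun_eq_iff\<close>)
    moreover have "((min ?n k, v(j := v j - Suc k, 0 := Suc k), out), ?st (Suc k)) \<in> sem w N (Move MoveRight)"
      by (auto simp: min_def)
    ultimately have "(?st k, ?st (Suc k)) \<in> sem w N (Dec j ;; Inc 0 ;; Move MoveRight)"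
      by (meson sem_SeqI)
    then show "holds w N (IsZero j) (?st k) False \<and> (?st k, ?st (Suc k)) \<in> sem w N (Dec j ;; Inc 0 ;; Move MoveRight)"
      using k assms(4) by simp
  qed (use assms in simp)
  moreover have "?st 0 = (0, v, out)" using assms(2) by (auto simp: fun_eq_iff)
  ultimately have 2: "((0, v, out), ?st (v j)) \<in> sem w N (Until (IsZero j) (Dec j ;; Inc 0 ;; Move MoveRight))"
    by simp
  let ?st2 = "\<lambda>k. (min ?n (v j), v(j := k, 0 := v j - k), out)"
  have "(?st2 0, ?st2 (v j)) \<in> sem w N (Until (IsZero 0) (Dec 0 ;; Inc j))"
  proof (rule sem_Until_seq)
    fix k
    assume k: "k < v j"
    have "(?st2 k, (min ?n (v j), v(j := k, 0 := v j - Suc k), out)) \<in> sem w N (Dec 0)"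
      by (rule sem_DecI) (use k assms in \<open>auto simp: fun_eq_iff\<close>)
    moreover have "((min ?n (v j), v(j := k, 0 := v j - Suc k), out), ?st2 (Suc k)) \<in> sem w N (Inc j)"
      by (rule sem_IncI) (use k assms in \<open>auto simp: fun_eq_iff\<close>)
    ultimately have "(?st2 k, ?st2 (Suc k)) \<in> sem w N (Dec 0 ;; Inc j)" by (meson sem_SeqI)
    then show "holds w N (IsZero 0) (?st2 k) False \<and> (?st2 k, ?st2 (Suc k)) \<in> sem w N (Dec 0 ;; Inc j)"
      using k by simp
  qed simp
  moreover have "?st2 0 = ?st (v j)" by simp
  moreover have "?st2 (v j) = (min ?n (v j), v, out)" using assms(2) by (auto simp: fun_eq_iff)
  ultimately have 3: "(?st (v j), (min ?n (v j), v, out)) \<in> sem w N (Until (IsZero 0) (Dec 0 ;; Inc j))"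
    by simp
  show "((i, v, out), (min ?n (v j), v, out)) \<in> sem w N (seek j)"
    unfolding seek_def by (rule sem_SeqI[OF 1 sem_SeqI[OF 2 3]])
qed simp

lemma sem_copy:
  assumes "v 0 = 0" "v k < N" "j \<noteq> 0" "k \<noteq> 0" "j \<noteq> k"
  shows "((i, v, out), s') \<in> sem w N (copy j k) \<longleftrightarrow> s' = (i, v(j := v k), out)"
proof (rule sem_det_iff)
  have 1: "((i, v, out), (i, v(j := 0), out)) \<in> sem w N (clear j)" using sem_clear by blast
  let ?st = "\<lambda>m. (i, v(j := 0, k := v k - m, 0 := m), out)"
  have "(?st 0, ?st (v k)) \<in> sem w N (Until (IsZero k) (Dec k ;; Inc 0))"
  proof (rule sem_Until_seq)
    fix m
    assume m: "m < v k"
    have "(?st m, (i, v(j := 0, k := v k - Suc m, 0 := m), out)) \<in> sem w N (Dec k)"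
      by (rule sem_DecI) (use m assms in \<open>auto simp: fun_eq_iff\<close>)
    moreover have "((i, v(j := 0, k := v k - Suc m, 0 := m), out), ?st (Suc m)) \<in> sem w N (Inc 0)"
      by (rule sem_IncI) (use m assms in \<open>auto simp: fun_eq_iff\<close>)
    ultimately have "(?st m, ?st (Suc m)) \<in> sem w N (Dec k ;; Inc 0)" by (meson sem_SeqI)
    then show "holds w N (IsZero k) (?st m) False \<and> (?st m, ?st (Suc m)) \<in> sem w N (Dec k ;; Inc 0)"
      using m assms by simp
  qed (use assms in simp)
  moreover have "?st 0 = (i, v(j := 0), out)" using assms by (auto simp: fun_eq_iff)
  ultimately have 2: "((i, v(j := 0), out), ?st (v k)) \<in> sem w N (Until (IsZero k) (Dec k ;; Inc 0))"
    by simp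
  let ?st2 = "\<lambda>m. (i, v(j := m, k := m, 0 := v k - m), out)"
  have "(?st2 0, ?st2 (v k)) \<in> sem w N (Until (IsZero 0) (Dec 0 ;; Inc k ;; Inc j))"
  proof (rule sem_Until_seq)
    fix m
    assume m: "m < v k"
    have "(?st2 m, (i, v(j := m, k := m, 0 := v k - Suc m), out)) \<in> sem w N (Dec 0)"
      by (rule sem_DecI) (use m assms in \<open>auto simp: fun_eq_iff\<close>)
    moreover have "((i, v(j := m, k := m, 0 := v k - Suc m), out),
        (i, v(j := m, k := Suc m, 0 := v k - Suc m), out)) \<in> sem w N (Inc k)"
      by (rule sem_IncI) (use m assms in \<open>auto simp: fun_eq_iff\<close>)
    moreover have "((i, v(j := m, k := Suc m, 0 := v k - Suc m), out), ?st2 (Suc m)) \<in> sem w N (Inc j)"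
      by (rule sem_IncI) (use m assms in \<open>auto simp: fun_eq_iff\<close>)
    ultimately have "(?st2 m, ?st2 (Suc m)) \<in> sem w N (Dec 0 ;; Inc k ;; Inc j)" by (meson sem_SeqI)
    then show "holds w N (IsZero 0) (?st2 m) False \<and> (?st2 m, ?st2 (Suc m)) \<in> sem w N (Dec 0 ;; Inc k ;; Inc j)"
      using m by simp
  qed simp
  moreover have "?st2 0 = ?st (v k)" using assms by (auto simp: fun_eq_iff)
  moreover have "?st2 (v k) = (i, v(j := v k), out)" using assms by (auto simp: fun_eq_iff)
  ultimately have 3: "(?st (v k), (i, v(j := v k), out)) \<in> sem w N (Until (IsZero 0) (Dec 0 ;; Inc k ;; Inc j))"
    by simp
  show "((i, v, out), (i, v(j := v k), out)) \<in> sem w N (copy j k)"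
    unfolding copy_def by (rule sem_SeqI[OF 1 sem_SeqI[OF 2 3]])
qed simp

text \<open>\<open>fail\<close> blocks because register 0 is zero.\<close>

definition fail :: com where
  "fail = Dec 0"

text \<open>The head returns to the left marker, so that between commands only the registers carry
  information. This is the situation described by \<open>impl\<close>.\<close>

definition chk :: "nat \<Rightarrow> cell \<Rightarrow> com" where
  "chk j x = seek j ;; Cond (Scans [x]) Skip fail ;; rewind"

definition assert_zero :: "nat \<Rightarrow> com" where
  "assert_zero j = Cond (IsZero j) Skip fail"

definition select :: "com list \<Rightarrow> com" where
  "select cs = foldr (Cond Any) cs fail"

abbreviation star :: "com \<Rightarrow> com" where
  "star c \<equiv> Until Any c"

fun seqs :: "com list \<Rightarrow> com" where
  "seqs [] = Skip"
| "seqs (c # cs) = c ;; seqs cs"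

definition expect :: "symbol \<Rightarrow> nat \<Rightarrow> com" where
  "expect x j = chk j (Letter x) ;; Inc j"

text \<open>All pointers must see the same symbol before they advance; hence
  \<open>name [j, 2]\<close> compares two names while it parses them.\<close>

definition expects :: "nat list \<Rightarrow> symbol \<Rightarrow> com" where
  "expects js x = seqs (map (expect x) js)"

definition name :: "nat list \<Rightarrow> com" where
  "name js = star (Cond Any (expects js 0) (expects js 1)) ;; expects js 2"

definition label :: "nat list \<Rightarrow> symbol list \<Rightarrow> com" where
  "label js xs = select (map (expects js) xs)"

definition transition :: "nat list \<Rightarrow> symbol list \<Rightarrow> com" where
  "transition js xs = name js ;; label js xs ;; name js"

section \<open>Pointer moves as an algebra of languages and relations\<close>

fun reads :: "symbol list \<Rightarrow> nat \<Rightarrow> symbol list \<Rightarrow> bool" where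
  "reads w p [] \<longleftrightarrow> True"
| "reads w p (x # u) \<longleftrightarrow> input_cell w p = Letter x \<and> reads w (p + 1) u"

lemma reads_append [simp]: "reads w p (u @ u') \<longleftrightarrow> reads w p u \<and> reads w (p + length u) u'"
  by (induction u arbitrary: p) auto

definition shift :: "nat set \<Rightarrow> nat \<Rightarrow> (nat \<Rightarrow> nat) \<Rightarrow> nat \<Rightarrow> nat" where
  "shift J m v = (\<lambda>j. if j \<in> J then v j + m else v j)"

lemma shift_simps [simp]:
  "shift J m (shift J k v) = shift J (k + m) v"
  "j \<in> J \<Longrightarrow> shift J m v j = v j + m"
  "j \<notin> J \<Longrightarrow> shift J m v j = v j"
  "shift J 0 v = v"
  by (auto simp: shift_def)

lemma shift_single: "shift {j} m v = v(j := v j + m)"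
  by (auto simp: shift_def)

lemma shift_insert: "j \<notin> J \<Longrightarrow> shift J m (shift {j} m v) = shift (insert j J) m v"
  by (auto simp: shift_def fun_eq_iff)

definition advs :: "symbol list \<Rightarrow> nat set \<Rightarrow> symbol list set \<Rightarrow> (nat \<Rightarrow> nat) rel" where
  "advs w J U = {(v, v'). \<exists>u \<in> U. (\<forall>j \<in> J. reads w (v j) u) \<and> v' = shift J (length u) v}"

lemma advs_iff:
  "(v, v') \<in> advs w J U \<longleftrightarrow> (\<exists>u \<in> U. (\<forall>j \<in> J. reads w (v j) u) \<and> v' = shift J (length u) v)"
  by (simp add: advs_def)

lemma advs_O:
  "(v, v') \<in> advs w J U O r \<longleftrightarrow>
     (\<exists>u \<in> U. (\<forall>j \<in> J. reads w (v j) u) \<and> (shift J (length u) v, v') \<in> r)"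
  unfolding advs_def relcomp_unfold by auto

definition conc :: "symbol list set \<Rightarrow> symbol list set \<Rightarrow> symbol list set" where
  "conc U V = {u @ v | u v. u \<in> U \<and> v \<in> V}"

text \<open>With the next lemmas and \<open>advs_stars\<close>: concatenation, union and star of
  languages become composition, union and closure of relations. Programs built from
  \<open>;;\<close>, \<open>Cond Any\<close> and \<open>star\<close> can thus be read as regular
  expressions.\<close>

lemma advs_conc: "advs w J U O advs w J V = advs w J (conc U V)"
proof -
  have "(v, v') \<in> advs w J U O advs w J V \<longleftrightarrow> (v, v') \<in> advs w J (conc U V)" for v v'
    by (fastforce simp: advs_O advs_iff conc_def)
  then show ?thesis by auto
qed

lemma advs_Un: "advs w J U \<union> advs w J V = advs w J (U \<union> V)"
  unfolding advs_def by blast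

lemma advs_UN: "(\<Union>x \<in> X. advs w J (U x)) = advs w J (\<Union>x \<in> X. U x)"
  unfolding advs_def by blast

lemma advs_Nil: "(v, v') \<in> advs w J {[]} \<longleftrightarrow> v' = v"
  by (auto simp: advs_iff)

definition stars :: "symbol list set \<Rightarrow> symbol list set" where
  "stars U = {concat us | us. us \<in> lists U}"

lemma advs_stars: "(advs w J U)\<^sup>* = advs w J (stars U)"
proof (intro set_eqI iffI; clarify)
  fix v v'
  assume "(v, v') \<in> (advs w J U)\<^sup>*"
  then show "(v, v') \<in> advs w J (stars U)"
  proof (induction rule: converse_rtrancl_induct)
    case base
    have "[] \<in> stars U" unfolding stars_def by (rule CollectI, rule exI[of _ "[]"]) simp
    then show ?case using advs_Nil[of v' v' w J] unfolding advs_def by blast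
  next
    case (step x y)
    then have "(x, v') \<in> advs w J (conc U (stars U))" using advs_conc by blast
    moreover have "conc U (stars U) \<subseteq> stars U"
      unfolding conc_def stars_def by clarify (rule exI[of _ "_ # _"], auto)
    ultimately show ?case unfolding advs_def by blast
  qed
next
  fix v v'
  have "\<And>v. us \<in> lists U \<Longrightarrow> (v, v') \<in> advs w J {concat us} \<Longrightarrow> (v, v') \<in> (advs w J U)\<^sup>*" for us
  proof (induction us)
    case Nil
    then show ?case by (simp add: advs_Nil)
  next
    case (Cons u us)
    have "{concat (u # us)} = conc {u} {concat us}" by (simp add: conc_def)
    then obtain x where x: "(v, x) \<in> advs w J {u}" "(x, v') \<in> advs w J {concat us}"
      using Cons.prems(2) advs_conc by (metis relcompE prod.inject)
    have "(v, x) \<in> advs w J U" using x(1) Cons.prems(1) unfolding advs_def by auto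
    then show ?case using Cons x(2) by (meson converse_rtrancl_into_rtrancl listsE)
  qed
  moreover assume "(v, v') \<in> advs w J (stars U)"
  then obtain us where "us \<in> lists U" "(v, v') \<in> advs w J {concat us}"
    unfolding advs_def stars_def by blast
  ultimately show "(v, v') \<in> (advs w J U)\<^sup>*" by blast
qed

lemma stars_image: "stars (f ` X) = (\<lambda>xs. concat (map f xs)) ` lists X"
proof -
  have "lists (f ` X) = map f ` lists X" by (rule lists_image)
  then show ?thesis unfolding stars_def by auto
qed

locale pointers =
  fixes w :: "symbol list" and N :: nat
  assumes N: "length w + 1 < N"
begin

definition ok :: "(nat \<Rightarrow> nat) \<Rightarrow> bool" where
  "ok v \<longleftrightarrow> v 0 = 0 \<and> (\<forall>j. v j < N)"

definition impl :: "com \<Rightarrow> (nat \<Rightarrow> nat) rel \<Rightarrow> bool" where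
  "impl c r \<longleftrightarrow> (\<forall>v v'. ok v \<longrightarrow> (v, v') \<in> r \<longrightarrow> ok v') \<and>
     (\<forall>v s'. ok v \<longrightarrow> ((0, v, []), s') \<in> sem w N c \<longleftrightarrow> (\<exists>v'. s' = (0, v', []) \<and> (v, v') \<in> r))"

lemma implI:
  assumes "\<And>v v'. ok v \<Longrightarrow> (v, v') \<in> r \<Longrightarrow> ok v'"
    and "\<And>v s'. ok v \<Longrightarrow> ((0, v, []), s') \<in> sem w N c \<longleftrightarrow> (\<exists>v'. s' = (0, v', []) \<and> (v, v') \<in> r)"
  shows "impl c r"
  unfolding impl_def using assms by blast

lemma implD:
  assumes "impl c r" "ok v"
  shows "((0, v, []), s') \<in> sem w N c \<longleftrightarrow> (\<exists>v'. s' = (0, v', []) \<and> (v, v') \<in> r)"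
  using assms unfolding impl_def by blast

lemma impl_ok: "impl c r \<Longrightarrow> ok v \<Longrightarrow> (v, v') \<in> r \<Longrightarrow> ok v'"
  unfolding impl_def by blast

lemma impl_Seq:
  assumes "impl a r" "impl b q"
  shows "impl (a ;; b) (r O q)"
proof (rule implI)
  fix v s'
  assume v: "ok v"
  show "((0, v, []), s') \<in> sem w N (a ;; b) \<longleftrightarrow> (\<exists>v'. s' = (0, v', []) \<and> (v, v') \<in> r O q)"
  proof
    assume "((0, v, []), s') \<in> sem w N (a ;; b)"
    then obtain s1 where s1: "((0, v, []), s1) \<in> sem w N a" "(s1, s') \<in> sem w N b" by auto
    then obtain v1 where v1: "s1 = (0, v1, [])" "(v, v1) \<in> r" using implD[OF assms(1) v] by blast
    then have "ok v1" using impl_ok assms(1) v by blast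
    then show "\<exists>v'. s' = (0, v', []) \<and> (v, v') \<in> r O q" using implD[OF assms(2)] s1(2) v1 by blast
  next
    assume "\<exists>v'. s' = (0, v', []) \<and> (v, v') \<in> r O q"
    then obtain v1 v' where v1: "s' = (0, v', [])" "(v, v1) \<in> r" "(v1, v') \<in> q" by blast
    then have "ok v1" using impl_ok assms(1) v by blast
    then have "((0, v1, []), s') \<in> sem w N b" using implD[OF assms(2)] v1 by blast
    moreover have "((0, v, []), (0, v1, [])) \<in> sem w N a" using implD[OF assms(1) v] v1 by blast
    ultimately show "((0, v, []), s') \<in> sem w N (a ;; b)" by (rule sem_SeqI[rotated])
  qed
qed (use assms impl_ok in blast)

lemma impl_Any:
  assumes "impl a r" "impl b q"
  shows "impl (Cond Any a b) (r \<union> q)"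
proof (rule implI)
  fix v s'
  assume "ok v"
  then show "((0, v, []), s') \<in> sem w N (Cond Any a b) \<longleftrightarrow> (\<exists>v'. s' = (0, v', []) \<and> (v, v') \<in> r \<union> q)"
    using implD[OF assms(1), of v s'] implD[OF assms(2), of v s'] by auto
qed (use assms impl_ok in blast)

lemma impl_star:
  assumes "impl c r"
  shows "impl (star c) (r\<^sup>*)"
proof (rule implI)
  fix v v'
  assume "ok v" "(v, v') \<in> r\<^sup>*"
  from this(2,1) show "ok v'" by (induction rule: rtrancl_induct) (auto intro: impl_ok[OF assms])
next
  fix v s'
  assume v: "ok v"
  show "((0, v, []), s') \<in> sem w N (star c) \<longleftrightarrow> (\<exists>v'. s' = (0, v', []) \<and> (v, v') \<in> r\<^sup>*)"
  proof
    assume "((0, v, []), s') \<in> sem w N (star c)"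
    then have "((0, v, []), s') \<in> (sem w N c)\<^sup>*" by (auto simp: relcomp_unfold)
    then have "\<exists>v'. s' = (0, v', []) \<and> (v, v') \<in> r\<^sup>* \<and> ok v'"
    proof (induction rule: rtrancl_induct)
      case base
      then show ?case using v by blast
    next
      case (step y z)
      then obtain v1 where v1: "y = (0, v1, [])" "(v, v1) \<in> r\<^sup>*" "ok v1" by blast
      then obtain v2 where "z = (0, v2, [])" "(v1, v2) \<in> r" using step(2) implD[OF assms] by blast
      moreover from this have "ok v2" "(v, v2) \<in> r\<^sup>*"
        using v1 impl_ok[OF assms] by (auto intro: rtrancl.rtrancl_into_rtrancl)
      ultimately show ?case by blast
    qed
    then show "\<exists>v'. s' = (0, v', []) \<and> (v, v') \<in> r\<^sup>*" by blast
  next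
    assume "\<exists>v'. s' = (0, v', []) \<and> (v, v') \<in> r\<^sup>*"
    then obtain v' where s': "s' = (0, v', [])" and r: "(v, v') \<in> r\<^sup>*" by blast
    from r have "((0, v, []), (0, v', [])) \<in> (sem w N c)\<^sup>* \<and> ok v'"
    proof (induction rule: rtrancl_induct)
      case base
      then show ?case using v by blast
    next
      case (step y z)
      then have "((0, y, []), (0, z, [])) \<in> sem w N c" using implD[OF assms] by blast
      then show ?case using step impl_ok[OF assms] by (meson rtrancl.rtrancl_into_rtrancl)
    qed
    then show "((0, v, []), s') \<in> sem w N (star c)" using s' by (auto simp: relcomp_unfold)
  qed
qed

lemma impl_Skip: "impl Skip Id"
  by (rule implI) auto

lemma impl_fail: "impl fail {}"
  by (rule implI) (auto simp: fail_def ok_def)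

lemma impl_select: "(\<And>x. x \<in> set xs \<Longrightarrow> impl (c x) (r x)) \<Longrightarrow> impl (select (map c xs)) (\<Union>x \<in> set xs. r x)"
proof (induction xs)
  case Nil
  then show ?case by (simp add: select_def impl_fail)
next
  case (Cons x xs)
  then show ?case using impl_Any[of "c x" "r x" "select (map c xs)"] by (simp add: select_def)
qed

lemma ok_upd: "ok v \<Longrightarrow> j \<noteq> 0 \<Longrightarrow> x < N \<Longrightarrow> ok (v(j := x))"
  by (simp add: ok_def)

lemma impl_Inc: "j \<noteq> 0 \<Longrightarrow> impl (Inc j) {(v, v'). v j + 1 < N \<and> v' = v(j := v j + 1)}"
  by (rule implI) (auto simp: ok_upd)

lemma impl_Dec: "j \<noteq> 0 \<Longrightarrow> impl (Dec j) {(v, v'). 0 < v j \<and> v' = v(j := v j - 1)}"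
  by (rule implI) (auto simp: ok_def intro: less_imp_diff_less)

lemma impl_clear: "j \<noteq> 0 \<Longrightarrow> impl (clear j) {(v, v'). v' = v(j := 0)}"
  by (rule implI) (use N in \<open>auto simp: ok_upd sem_clear\<close>)

lemma impl_copy: "j \<noteq> 0 \<Longrightarrow> k \<noteq> 0 \<Longrightarrow> j \<noteq> k \<Longrightarrow> impl (copy j k) {(v, v'). v' = v(j := v k)}"
  by (rule implI) (auto simp: ok_def sem_copy)

lemma impl_assert_zero: "j \<noteq> 0 \<Longrightarrow> impl (assert_zero j) {(v, v'). v j = 0 \<and> v' = v}"
  by (rule implI) (auto simp: ok_def assert_zero_def fail_def)

lemma input_cell_min: "input_cell w (min (length w + 1) p) = input_cell w p"
  by (auto simp: input_cell_def min_def)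

lemma impl_chk: "j \<noteq> 0 \<Longrightarrow> impl (chk j x) {(v, v'). input_cell w (v j) = x \<and> v' = v}"
proof (rule implI)
  fix v s'
  assume "j \<noteq> 0" and v: "ok v"
  let ?s = "(min (length w + 1) (v j), v, [])"
  have "((0, v, []), s') \<in> sem w N (chk j x) \<longleftrightarrow> (?s, s') \<in> sem w N (Cond (Scans [x]) Skip fail ;; rewind)"
    unfolding chk_def sem.simps(6)[of w N "seek j"] relcomp_unfold
    using sem_seek[of 0 w v j N "[]"] v \<open>j \<noteq> 0\<close> by (simp add: ok_def)
  also have "\<dots> \<longleftrightarrow> input_cell w (v j) = x \<and> (?s, s') \<in> sem w N rewind"
    using v by (auto simp: input_cell_min[simplified] fail_def ok_def)
  also have "\<dots> \<longleftrightarrow> input_cell w (v j) = x \<and> s' = (0, v, [])"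
    by (subst sem_rewind) auto
  finally show "((0, v, []), s') \<in> sem w N (chk j x) \<longleftrightarrow>
      (\<exists>v'. s' = (0, v', []) \<and> (v, v') \<in> {(v, v'). input_cell w (v j) = x \<and> v' = v})" by auto
qed simp

lemma impl_expect: "j \<noteq> 0 \<Longrightarrow> impl (expect x j) (advs w {j} {[x]})"
proof -
  assume "j \<noteq> 0"
  then have "impl (expect x j) ({(v, v'). input_cell w (v j) = Letter x \<and> v' = v} O
      {(v, v'). v j + 1 < N \<and> v' = v(j := v j + 1)})"
    unfolding expect_def by (intro impl_Seq impl_chk impl_Inc)
  also have "{(v, v'). input_cell w (v j) = Letter x \<and> v' = v} O
      {(v, v'). v j + 1 < N \<and> v' = v(j := v j + 1)} = advs w {j} {[x]}"
  proof -
    \<comment> \<open>A pointer on a letter is at most \<open>length w\<close>, so moving it one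
      cell further never blocks.\<close>
    have "v j + 1 < N" if "input_cell w (v j) = Letter x" for v
      using that N by (auto simp: input_cell_def split: if_splits)
    then show ?thesis by (auto simp: advs_iff shift_single)
  qed
  finally show ?thesis .
qed

lemma impl_expects: "distinct js \<Longrightarrow> 0 \<notin> set js \<Longrightarrow> impl (expects js x) (advs w (set js) {[x]})"
proof (induction js)
  case Nil
  have "advs w {} {[x]} = Id" by (auto simp: advs_def)
  then show ?case by (simp add: expects_def impl_Skip)
next
  case (Cons j js)
  then have "impl (expects (j # js) x) (advs w {j} {[x]} O advs w (set js) {[x]})"
    unfolding expects_def list.map seqs.simps by (intro impl_Seq impl_expect) auto
  also have "advs w {j} {[x]} O advs w (set js) {[x]} = advs w (set (j # js)) {[x]}"
  proof -
    have j: "j \<notin> set js" using Cons.prems(1) by simp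
    then have "shift {j} m v i = v i" if "i \<in> set js" for m v i using that by (intro shift_simps) auto
    then have "(v, v') \<in> advs w {j} {[x]} O advs w (set js) {[x]} \<longleftrightarrow> (v, v') \<in> advs w (set (j # js)) {[x]}" for v v'
      using j by (auto simp: advs_O advs_iff shift_insert)
    then show ?thesis by (simp add: set_eq_iff)
  qed
  finally show ?case .
qed

end

lemma reads_iff: "reads w (Suc p) u \<longleftrightarrow> (\<exists>z. drop p w = u @ z)"
proof (induction u arbitrary: p)
  case (Cons x u)
  have "input_cell w (Suc p) = Letter x \<longleftrightarrow> p < length w \<and> w ! p = x"
    by (auto simp: input_cell_def)
  moreover have "drop p w = w ! p # drop (Suc p) w" if "p < length w"
    using that by (rule Cons_nth_drop_Suc[symmetric])
  ultimately show ?case using Cons.IH[of "Suc p"] by (cases "p < length w") auto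
qed auto

lemma reads_1: "reads w (Suc 0) u \<longleftrightarrow> (\<exists>z. w = u @ z)"
  using reads_iff[of w 0 u] by simp

lemma reads_after: "reads (u @ z) (Suc (length u)) x \<longleftrightarrow> (\<exists>z'. z = x @ z')"
  by (simp add: reads_iff)

text \<open>This turns the final test for the right marker into the statement that nothing follows
  the last section.\<close>

lemma reads_whole: "reads w (Suc 0) u \<and> input_cell w (Suc (length u)) = RightEnd \<longleftrightarrow> w = u"
  by (auto simp: reads_1 input_cell_def Suc_le_eq)

section \<open>Unique decodability of the encoding\<close>

abbreviation enc_states :: "bool list list \<Rightarrow> symbol list" where
  "enc_states qs \<equiv> concat (map enc_state qs)"

abbreviation enc_transitions :: "(bool list \<times> symbol option \<times> bool list) list \<Rightarrow> symbol list" where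
  "enc_transitions ts \<equiv> concat (map enc_trans ts)"

lemma enc_state_Nil [simp]: "enc_state [] = [2]"
  and enc_state_Cons [simp]: "enc_state (b # u) = of_bool b # enc_state u"
  by (simp_all add: enc_state_def)

text \<open>The terminator 2 is not a bit, so names form a prefix code and can be stripped off one
  at a time.\<close>

lemma enc_state_inject [simp]: "enc_state u @ x = enc_state u' @ y \<longleftrightarrow> u = u' \<and> x = y"
proof (induction u arbitrary: u')
  case Nil
  then show ?case by (cases u') auto
next
  case (Cons b u)
  then show ?case by (cases u') auto
qed

lemma enc_state_neq_3 [simp]: "enc_state u @ x \<noteq> 3 # y" "3 # y \<noteq> enc_state u @ x"
  by (cases u; auto)+

lemma enc_state_neq_Nil [simp]: "enc_state u \<noteq> []"
  by (simp add: enc_state_def)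

lemma enc_label_inject [simp]: "enc_label x = enc_label y \<longleftrightarrow> x = y"
  by (cases x; cases y) auto

lemma enc_trans_inject: "enc_trans t @ x = enc_trans t' @ y \<longleftrightarrow> t = t' \<and> x = y"
  by (cases t; cases t') auto

text \<open>A guessed parse \<open>qs'\<close> of the beginning cannot get out of step with the true
  list. The section is followed by 3 or by nothing, where no name can start, so the name read next
  is still an entry.\<close>

lemma enc_states_member:
  assumes "enc_states qs @ z = enc_states qs' @ enc_state u @ y" "z = [] \<or> hd z = 3"
  shows "u \<in> set qs"
  using assms(1)
proof (induction qs arbitrary: qs')
  case Nil
  show ?case
  proof (cases qs')
    case Nil
    with \<open>enc_states [] @ z = _\<close> assms(2) show ?thesis by (cases z; cases u) (auto simp: of_bool_def split: if_splits)
  next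
    case (Cons q qs'')
    with \<open>enc_states [] @ z = _\<close> assms(2) show ?thesis by (cases z; cases q) (auto simp: of_bool_def split: if_splits)
  qed
next
  case (Cons q qs)
  then show ?case by (cases qs') auto
qed

lemma enc_states_inject:
  "enc_states qs @ 3 # x = enc_states qs' @ 3 # y \<longleftrightarrow> qs = qs' \<and> x = y"
proof (induction qs arbitrary: qs')
  case Nil
  then show ?case by (cases qs') auto
next
  case (Cons q qs)
  show ?case
  proof (cases qs')
    case Nil
    then show ?thesis by (cases q) auto
  next
    case (Cons q' qs'')
    then show ?thesis using Cons.IH by auto
  qed
qed

lemma enc_transitions_inject:
  "enc_transitions ts @ 3 # x = enc_transitions ts' @ 3 # y \<longleftrightarrow> ts = ts' \<and> x = y"
proof (induction ts arbitrary: ts')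
  case Nil
  show ?case by (cases ts') (auto simp: split: prod.splits)
next
  case (Cons t ts)
  show ?case
  proof (cases ts')
    case Nil
    then show ?thesis by (cases t) auto
  next
    case (Cons t' ts'')
    then show ?thesis using Cons.IH by (simp add: enc_trans_inject)
  qed
qed

text \<open>Here a transition is recognised from its source and label alone; the remainder must then
  begin with its target, which is where \<open>fetch\<close> leaves its pointer.\<close>

lemma enc_transitions_member:
  assumes "enc_transitions ts @ 3 # z = enc_transitions ts' @ enc_state u @ enc_label x # y"
  shows "\<exists>u' y'. (u, x, u') \<in> set ts \<and> y = enc_state u' @ y'"
  using assms
proof (induction ts arbitrary: ts')
  case Nil
  show ?case
  proof (cases ts')
    case Nil
    with \<open>enc_transitions [] @ 3 # z = _\<close> show ?thesis by simp
  next
    case (Cons t ts'')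
    with \<open>enc_transitions [] @ 3 # z = _\<close> show ?thesis by (cases t) simp
  qed
next
  case (Cons t ts)
  obtain p x' q where t: "t = (p, x', q)" by (cases t)
  show ?case
  proof (cases ts')
    case Nil
    with Cons.prems show ?thesis by (auto simp: t)
  next
    case (Cons t' ts'')
    then show ?thesis using Cons.IH[of ts''] Cons.prems by (auto simp: enc_trans_inject)
  qed
qed

lemma range_enc_state: "conc (stars ({[0]} \<union> {[1]})) {[2]} = range enc_state"
proof -
  have "({[0]} \<union> {[1]} :: symbol list set) = (\<lambda>b. [of_bool b]) ` UNIV"
    by (auto simp: UNIV_bool)
  then have "stars ({[0]} \<union> {[1]}) = range (\<lambda>bs :: bool list. map of_bool bs :: symbol list)"
    by (simp only: stars_image lists_UNIV) (simp add: concat_map_singleton)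
  then show ?thesis by (auto simp: conc_def enc_state_def)
qed

lemma conc_transitions:
  "conc (enc_state ` P) (conc ((\<lambda>x. [enc_label x]) ` L) (enc_state ` Q)) = enc_trans ` (P \<times> L \<times> Q)"
proof (intro equalityI subsetI)
  fix x
  assume "x \<in> conc (enc_state ` P) (conc ((\<lambda>x. [enc_label x]) ` L) (enc_state ` Q))"
  then obtain p l q where "p \<in> P" "l \<in> L" "q \<in> Q" "x = enc_trans (p, l, q)"
    unfolding conc_def by auto
  then show "x \<in> enc_trans ` (P \<times> L \<times> Q)" by blast
next
  fix x
  assume "x \<in> enc_trans ` (P \<times> L \<times> Q)"
  then obtain p l q where x: "p \<in> P" "l \<in> L" "q \<in> Q" "x = enc_state p @ [enc_label l] @ enc_state q"
    by auto
  have "[enc_label l] @ enc_state q \<in> conc ((\<lambda>x. [enc_label x]) ` L) (enc_state ` Q)"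
    unfolding conc_def using x(2,3) by blast
  then show "x \<in> conc (enc_state ` P) (conc ((\<lambda>x. [enc_label x]) ` L) (enc_state ` Q))"
    unfolding conc_def[of "enc_state ` P"] x(4) using x(1) by blast
qed

definition tlists :: "symbol option set \<Rightarrow> (bool list \<times> symbol option \<times> bool list) list set" where
  "tlists L = lists (UNIV \<times> L \<times> UNIV)"

text \<open>Register 1 scans the encoding, register 2 is auxiliary, register 3 points to the name of the
  current state of the encoded automaton, and register 4 holds the current state of the automaton
  for \<open>F\<close>.\<close>

definition goto :: "nat \<Rightarrow> com" where
  "goto j = clear j ;; Inc j"

text \<open>The guess is the number of names that \<open>star (name [2])\<close> skips. Clearing
  register 2 afterwards erases the guess from the result.\<close>

definition lookup :: "nat \<Rightarrow> com" where
  "lookup j = goto 2 ;; star (name [2]) ;; name [j, 2] ;; clear 2"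

text \<open>No name is ever copied: the new current state is represented by a pointer to the target
  inside the chosen transition.\<close>

definition fetch :: "symbol list \<Rightarrow> symbol \<Rightarrow> com" where
  "fetch ls x = goto 2 ;; star (name [2]) ;; expect 3 2 ;; star (transition [2] ls) ;;
     name [3, 2] ;; expect x 2 ;; copy 3 2 ;; clear 2"

text \<open>Register 3 is set just before the name of the initial state is looked up, so the walk
  later starts at that name.\<close>

definition validate :: "symbol list \<Rightarrow> com" where
  "validate ls = goto 1 ;; star (name [1]) ;; expect 3 1 ;;
     (clear 2 ;; star (lookup 1 ;; label [1] ls ;; lookup 1)) ;; expect 3 1 ;;
     copy 3 1 ;; lookup 1 ;; expect 3 1 ;; (clear 2 ;; star (lookup 1)) ;; chk 1 RightEnd"

definition finish :: "symbol list \<Rightarrow> com" where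
  "finish ls = goto 2 ;; star (name [2]) ;; expect 3 2 ;; star (transition [2] ls) ;; expect 3 2 ;;
     name [2] ;; expect 3 2 ;; star (name [2]) ;; name [3, 2] ;; clear 2"

definition repeat :: "nat \<Rightarrow> com \<Rightarrow> com" where
  "repeat m c = seqs (replicate m c)"

text \<open>A register is compared with the constant \<open>f\<close> by subtracting
  \<open>f\<close> and testing for zero; a smaller value blocks in \<open>Dec\<close>. With
  \<open>f' = f\<close> this is a pure test.\<close>

definition switch :: "nat \<Rightarrow> nat \<Rightarrow> com" where
  "switch f f' = repeat f (Dec 4) ;; assert_zero 4 ;; repeat f' (Inc 4)"

lemma fun_O: "(v, v') \<in> {(v, v'). v' = g v} O r \<longleftrightarrow> (g v, v') \<in> r"
  by blast

lemma guard_O: "(v, v') \<in> {(v, v'). P v \<and> v' = g v} O r \<longleftrightarrow> P v \<and> (g v, v') \<in> r"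
  by blast

context pointers
begin

lemma impl_cong: "impl c r \<Longrightarrow> (\<And>v v'. (v, v') \<in> r \<longleftrightarrow> (v, v') \<in> r') \<Longrightarrow> impl c r'"
  by (metis subrelI subset_antisym)

lemma impl_name: "distinct js \<Longrightarrow> 0 \<notin> set js \<Longrightarrow> impl (name js) (advs w (set js) (range enc_state))"
  unfolding name_def range_enc_state[symmetric] advs_conc[symmetric] advs_stars[symmetric] advs_Un[symmetric]
  by (intro impl_Seq impl_star impl_Any impl_expects)

lemma impl_label:
  "distinct js \<Longrightarrow> 0 \<notin> set js \<Longrightarrow> impl (label js xs) (advs w (set js) ((\<lambda>x. [x]) ` set xs))"
proof -
  assume "distinct js" "0 \<notin> set js"
  then have "impl (label js xs) (\<Union>x \<in> set xs. advs w (set js) {[x]})"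
    unfolding label_def by (intro impl_select impl_expects)
  then show ?thesis unfolding advs_UN by (rule back_subst) (auto intro!: arg_cong[where f = "advs w (set js)"])
qed

lemma impl_names: "distinct js \<Longrightarrow> 0 \<notin> set js \<Longrightarrow> impl (star (name js)) (advs w (set js) (range enc_states))"
  using impl_star[OF impl_name] by (simp add: advs_stars stars_image)

lemma impl_transitions:
  assumes "distinct js" "0 \<notin> set js" "set ls = enc_label ` L"
  shows "impl (star (transition js ls)) (advs w (set js) (enc_transitions ` tlists L))"
proof -
  have L: "(\<lambda>x. [x]) ` set ls = (\<lambda>x. [enc_label x]) ` L" unfolding assms(3) by auto
  have "impl (transition js ls) (advs w (set js) (enc_trans ` (UNIV \<times> L \<times> UNIV)))"
    unfolding transition_def conc_transitions[symmetric] advs_conc[symmetric] L[symmetric]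
    by (rule impl_Seq[OF impl_name impl_Seq[OF impl_label impl_name]]) (simp_all add: assms(1,2))
  from impl_star[OF this] show ?thesis by (simp only: advs_stars stars_image tlists_def)
qed

lemma impl_goto: "j \<noteq> 0 \<Longrightarrow> impl (goto j) {(v, v'). v' = v(j := 1)}"
  unfolding goto_def
  by (rule impl_cong[OF impl_Seq[OF impl_clear impl_Inc]]) (use N in \<open>auto simp: fun_O\<close>)

text \<open>What \<open>lookup\<close> can find while the rest of the input is still unchecked. On a
  well-formed encoding this is the set of listed states.\<close>

definition members :: "bool list set" where
  "members = {u. \<exists>qs. reads w (Suc 0) (enc_states qs @ enc_state u)}"

lemma impl_lookup:
  assumes "j \<noteq> 0" "j \<noteq> 2"
  shows "impl (lookup j) {(v, v'). \<exists>u \<in> members. reads w (v j) (enc_state u) \<and>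
     v' = v(j := v j + length (enc_state u), 2 := 0)}"
  unfolding lookup_def
  by (rule impl_cong[OF impl_Seq[OF impl_goto impl_Seq[OF impl_names impl_Seq[OF impl_name impl_clear]]]])
    (use assms in \<open>simp_all only: fun_O advs_O mem_Collect_eq prod.case,
      auto simp: members_def shift_def fun_eq_iff\<close>)

lemma impl_fetch:
  assumes "set ls = enc_label ` L"
  shows "impl (fetch ls x) {(v, v'). \<exists>qs ts u. ts \<in> tlists L \<and>
     reads w (Suc 0) (enc_states qs @ [3] @ enc_transitions ts @ enc_state u @ [x]) \<and>
     reads w (v 3) (enc_state u) \<and>
     v' = v(3 := Suc (length (enc_states qs @ [3] @ enc_transitions ts @ enc_state u @ [x])), 2 := 0)}"
  unfolding fetch_def
  by (rule impl_cong[OF impl_Seq[OF impl_goto impl_Seq[OF impl_names impl_Seq[OF impl_expect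
      impl_Seq[OF impl_transitions[OF _ _ assms] impl_Seq[OF impl_name impl_Seq[OF impl_expect
      impl_Seq[OF impl_copy impl_clear]]]]]]]])
    (simp_all only: fun_O advs_O mem_Collect_eq prod.case, auto simp: shift_def fun_eq_iff add.assoc)

lemma impl_finish:
  assumes "set ls = enc_label ` L"
  shows "impl (finish ls) {(v, v'). \<exists>qs ts i fs u. ts \<in> tlists L \<and>
     reads w (Suc 0) (enc_states qs @ [3] @ enc_transitions ts @ [3] @ enc_state i @ [3] @ enc_states fs @ enc_state u) \<and>
     reads w (v 3) (enc_state u) \<and> v' = v(3 := v 3 + length (enc_state u), 2 := 0)}"
  unfolding finish_def
  by (rule impl_cong[OF impl_Seq[OF impl_goto impl_Seq[OF impl_names impl_Seq[OF impl_expect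
      impl_Seq[OF impl_transitions[OF _ _ assms] impl_Seq[OF impl_expect impl_Seq[OF impl_name impl_Seq[OF impl_expect
      impl_Seq[OF impl_names impl_Seq[OF impl_name impl_clear]]]]]]]]]])
    (simp_all only: fun_O advs_O mem_Collect_eq prod.case, auto simp: shift_def fun_eq_iff add.assoc, blast+)

end

section \<open>Membership in NL\<close>

lemma conc_assoc: "conc (conc U V) W = conc U (conc V W)"
proof (intro equalityI subsetI)
  fix x
  assume "x \<in> conc (conc U V) W"
  then obtain a b c where "a \<in> U" "b \<in> V" "c \<in> W" "x = a @ (b @ c)"
    unfolding conc_def by auto
  then show "x \<in> conc U (conc V W)" unfolding conc_def by blast
next
  fix x
  assume "x \<in> conc U (conc V W)"
  then obtain a b c where "a \<in> U" "b \<in> V" "c \<in> W" "x = (a @ b) @ c"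
    unfolding conc_def by auto
  then show "x \<in> conc (conc U V) W" unfolding conc_def by blast
qed

lemma mem_conc_image: "x \<in> conc (f ` A) V \<longleftrightarrow> (\<exists>a \<in> A. \<exists>v \<in> V. x = f a @ v)"
  unfolding conc_def by blast

lemma mem_conc_singleton: "x \<in> conc {u} V \<longleftrightarrow> (\<exists>v \<in> V. x = u @ v)"
  unfolding conc_def by blast

section \<open>The product of two automata with epsilon-transitions\<close>

definition prod_step :: "'p nfa \<Rightarrow> 'q nfa \<Rightarrow> (('p \<times> 'q) \<times> ('p \<times> 'q)) set" where
  "prod_step A B = {((p, f), (p', f')). (p, None, p') \<in> trans A \<and> f' = f \<or>
     (f, None, f') \<in> trans B \<and> p' = p \<or> (\<exists>a. (p, Some a, p') \<in> trans A \<and> (f, Some a, f') \<in> trans B)}"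

lemma prod_step_eps_right: "nfa_path B f [] f' \<Longrightarrow> ((p, f), (p, f')) \<in> (prod_step A B)\<^sup>*"
proof (induction f "[] :: symbol list" f' rule: nfa_path.induct)
  case (epsilon f g f')
  then have "((p, f), (p, g)) \<in> prod_step A B" by (simp add: prod_step_def)
  then show ?case using epsilon by (meson converse_rtrancl_into_rtrancl)
qed simp

text \<open>A path of \<open>B\<close> is cut at its first letter. The epsilon-transitions before it
  are performed while \<open>A\<close> waits.\<close>

lemma prod_step_letter_right:
  assumes "nfa_path B f (a # u) f'"
  shows "\<exists>g g'. ((p, f), (p, g)) \<in> (prod_step A B)\<^sup>* \<and> (g, Some a, g') \<in> trans B \<and> nfa_path B g' u f'"
  using assms
proof (induction f "a # u" f' rule: nfa_path.induct)
  case (epsilon f g f')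
  then have "((p, f), (p, g)) \<in> prod_step A B" by (simp add: prod_step_def)
  then show ?case using epsilon by (meson converse_rtrancl_into_rtrancl)
next
  case (letter f g f')
  then show ?case by blast
qed

text \<open>From right to left the path of \<open>A\<close> sets the pace, and the
  epsilon-transitions of \<open>B\<close> are inserted before each letter and at the end.\<close>

lemma prod_path_iff:
  "((p, f), (p', f')) \<in> (prod_step A B)\<^sup>* \<longleftrightarrow> (\<exists>u. nfa_path A p u p' \<and> nfa_path B f u f')"
proof
  assume "((p, f), (p', f')) \<in> (prod_step A B)\<^sup>*"
  then show "\<exists>u. nfa_path A p u p' \<and> nfa_path B f u f'"
  proof (induction p f rule: converse_rtrancl_induct2)
    case refl
    show ?case by (intro exI conjI; rule nfa_path.empty)
  next
    case (step p f q g)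
    then obtain u where u: "nfa_path A q u p'" "nfa_path B g u f'" by blast
    from step(1) consider "(p, None, q) \<in> trans A" "g = f" | "(f, None, g) \<in> trans B" "q = p"
      | a where "(p, Some a, q) \<in> trans A" "(f, Some a, g) \<in> trans B"
      unfolding prod_step_def by blast
    then show ?case
    proof cases
      case 1
      then show ?thesis using nfa_path.epsilon[OF 1(1) u(1)] u(2) by auto
    next
      case 2
      then show ?thesis using nfa_path.epsilon[OF 2(1) u(2)] u(1) by auto
    next
      case 3
      then show ?thesis using nfa_path.letter[OF 3(1) u(1)] nfa_path.letter[OF 3(2) u(2)] by auto
    qed
  qed
next
  assume "\<exists>u. nfa_path A p u p' \<and> nfa_path B f u f'"
  then obtain u where "nfa_path A p u p'" "nfa_path B f u f'" by blast
  then show "((p, f), (p', f')) \<in> (prod_step A B)\<^sup>*"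
  proof (induction arbitrary: f rule: nfa_path.induct)
    case (empty p)
    then show ?case by (rule prod_step_eps_right)
  next
    case (epsilon p q u r)
    then have "((p, f), (q, f)) \<in> prod_step A B" by (simp add: prod_step_def)
    from converse_rtrancl_into_rtrancl[OF this epsilon.IH[OF epsilon.prems]] show ?case .
  next
    case (letter p a q u r)
    from prod_step_letter_right[OF letter.prems, of p A] obtain g g'
      where g: "((p, f), (p, g)) \<in> (prod_step A B)\<^sup>*" "(g, Some a, g') \<in> trans B" "nfa_path B g' u f'"
      by blast
    have "((p, g), (q, g')) \<in> prod_step A B"
      unfolding prod_step_def using letter.hyps(1) g(2) by (intro CollectI) auto
    from rtrancl_trans[OF g(1) converse_rtrancl_into_rtrancl[OF this letter.IH[OF g(3)]]] show ?case .
  qed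
qed

definition advance :: "symbol list \<Rightarrow> nat \<times> symbol option \<times> nat \<Rightarrow> com" where
  "advance ls = (\<lambda>(f, x, f'). case x of None \<Rightarrow> switch f f' | Some a \<Rightarrow> fetch ls (enc_label x) ;; switch f f')"

definition simulate :: "symbol list \<Rightarrow> (nat \<times> symbol option \<times> nat) list \<Rightarrow> com" where
  "simulate ls us = Cond Any (fetch ls (enc_label None)) (select (map (advance ls) us))"

definition realize :: "symbol list \<Rightarrow> (nat \<times> symbol option \<times> nat) list \<Rightarrow> nat \<Rightarrow> nat list \<Rightarrow> com" where
  "realize ls us f0 fs = validate ls ;; repeat f0 (Inc 4) ;; star (simulate ls us) ;; finish ls ;;
     select (map (\<lambda>f. switch f f) fs)"

text \<open>Bridges the start left by the counting phase, at the right marker with unknown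
  registers, and the start assumed by \<open>impl\<close>, at the left marker with register 0
  empty.\<close>

definition prelude :: com where
  "prelude = rewind ;; clear 0 ;; clear 1 ;; clear 2 ;; clear 3 ;; clear 4"

lemma sem_prelude: "((length w + 1, v, out), s) \<in> sem w N prelude \<longleftrightarrow>
    s = (0, v(0 := 0, 1 := 0, 2 := 0, 3 := 0, 4 := 0), out)"
  unfolding prelude_def sem.simps(6) relcomp_unfold by (simp add: sem_rewind sem_clear)

context pointers
begin

text \<open>Both \<open>lookup\<close> and the repetition around it leave register 2 at zero, so that their relations can
  be composed exactly.\<close>

definition adv0 :: "symbol list set \<Rightarrow> (nat \<Rightarrow> nat) rel" where
  "adv0 U = {(v, v'). \<exists>u \<in> U. reads w (v 1) u \<and> v' = v(1 := v 1 + length u, 2 := 0)}"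

lemma adv0_iff: "(v, v') \<in> adv0 U \<longleftrightarrow> (\<exists>u \<in> U. reads w (v 1) u \<and> v' = v(1 := v 1 + length u, 2 := 0))"
  by (simp add: adv0_def)

lemma adv0_O:
  "(v, v') \<in> adv0 U O r \<longleftrightarrow> (\<exists>u \<in> U. reads w (v 1) u \<and> (v(1 := v 1 + length u, 2 := 0), v') \<in> r)"
  unfolding adv0_def relcomp_unfold by auto

lemma adv0_conc: "adv0 U O adv0 V = adv0 (conc U V)"
proof -
  have "(v, v') \<in> adv0 U O adv0 V \<longleftrightarrow> (v, v') \<in> adv0 (conc U V)" for v v'
    by (fastforce simp: adv0_O adv0_iff conc_def fun_upd_twist add.assoc)
  then show ?thesis by auto
qed

lemma adv0_advs: "adv0 U O advs w {1} V = adv0 (conc U V)"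
proof -
  have "(v, v') \<in> adv0 U O advs w {1} V \<longleftrightarrow> (v, v') \<in> adv0 (conc U V)" for v v'
    by (fastforce simp: adv0_O adv0_iff advs_iff shift_single conc_def fun_upd_twist add.assoc)
  then show ?thesis by auto
qed

lemma advs_adv0: "advs w {1} U O adv0 V = adv0 (conc U V)"
proof -
  have "(v, v') \<in> advs w {1} U O adv0 V \<longleftrightarrow> (v, v') \<in> adv0 (conc U V)" for v v'
    by (fastforce simp: advs_O adv0_iff advs_iff shift_single conc_def fun_upd_twist add.assoc)
  then show ?thesis by auto
qed

text \<open>No iteration at all would leave register 2 alone, whereas \<open>adv0\<close> sets it to
  zero; the initial clearing removes the difference.\<close>

lemma adv0_stars: "{(v, v'). v' = v(2 := 0)} O (adv0 U)\<^sup>* = adv0 (stars U)"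
proof -
  have 1: "v 2 = 0 \<Longrightarrow> (v, v') \<in> adv0 (stars U)" if "(v, v') \<in> (adv0 U)\<^sup>*" for v v'
    using that
  proof (induction rule: converse_rtrancl_induct)
    case base
    have "[] \<in> stars U" unfolding stars_def by (rule CollectI, rule exI[of _ "[]"]) simp
    moreover have "v' = v'(1 := v' 1 + length ([] :: symbol list), 2 := 0)" using base by auto
    ultimately show ?case unfolding adv0_iff using reads.simps(1) by blast
  next
    case (step x y)
    have "y 2 = 0" using step(1) by (auto simp: adv0_iff)
    then have "(x, v') \<in> adv0 (conc U (stars U))" using step adv0_conc by blast
    moreover have "conc U (stars U) \<subseteq> stars U"
      unfolding conc_def stars_def by clarify (rule exI[of _ "_ # _"], auto)
    ultimately show ?case unfolding adv0_def by blast
  qed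
  have 2: "us \<in> lists U \<Longrightarrow> v 2 = 0 \<Longrightarrow> (v, v') \<in> adv0 {concat us} \<Longrightarrow> (v, v') \<in> (adv0 U)\<^sup>*" for us v v'
  proof (induction us arbitrary: v)
    case Nil
    then have "v' = v" by (auto simp: adv0_iff)
    then show ?case by simp
  next
    case (Cons u us)
    have "{concat (u # us)} = conc {u} {concat us}" by (simp add: conc_def)
    then have "(v, v') \<in> adv0 {u} O adv0 {concat us}" using Cons.prems(3) adv0_conc by simp
    then obtain x where x: "(v, x) \<in> adv0 {u}" "(x, v') \<in> adv0 {concat us}" by (rule relcompEpair)
    have "(v, x) \<in> adv0 U" "x 2 = 0" using x(1) Cons.prems(1) unfolding adv0_iff by auto
    then show ?case using Cons x(2) by (meson converse_rtrancl_into_rtrancl listsE)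
  qed
  have "(v, v') \<in> {(v, v'). v' = v(2 := 0)} O (adv0 U)\<^sup>* \<longleftrightarrow> (v, v') \<in> adv0 (stars U)" for v v'
  proof -
    have "(v, v') \<in> adv0 (stars U) \<longleftrightarrow> (v(2 := 0), v') \<in> adv0 (stars U)"
      by (simp add: adv0_iff fun_upd_twist)
    also have "\<dots> \<longleftrightarrow> (v(2 := 0), v') \<in> (adv0 U)\<^sup>*"
    proof
      assume "(v(2 := 0), v') \<in> adv0 (stars U)"
      then obtain us where "us \<in> lists U" "(v(2 := 0), v') \<in> adv0 {concat us}"
        unfolding adv0_def stars_def by blast
      then show "(v(2 := 0), v') \<in> (adv0 U)\<^sup>*" by (intro 2) simp_all
    qed (use 1 in simp)
    finally show ?thesis by (simp add: fun_O)
  qed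
  then show ?thesis by auto
qed

lemma impl_lookup_1: "impl (lookup 1) (adv0 (enc_state ` members))"
  by (rule impl_cong[OF impl_lookup]) (auto simp: adv0_iff)

definition mlists :: "symbol option set \<Rightarrow> (bool list \<times> symbol option \<times> bool list) list set" where
  "mlists L = lists (members \<times> L \<times> members)"

definition slists :: "bool list list set" where
  "slists = lists members"

lemma impl_validate:
  assumes "set ls = enc_label ` L"
  shows "impl (validate ls) {(v, v'). \<exists>qs. \<exists>ts \<in> mlists L. \<exists>i \<in> members. \<exists>fs \<in> slists.
     w = enc_states qs @ [3] @ enc_transitions ts @ [3] @ enc_state i @ [3] @ enc_states fs \<and>
     v' = v(1 := Suc (length w), 2 := 0, 3 := Suc (length (enc_states qs @ [3] @ enc_transitions ts @ [3])))}"
proof -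
  have L: "(\<lambda>x. [x]) ` set ls = (\<lambda>x. [enc_label x]) ` L" unfolding assms by auto
  have "impl (label [1] ls) (advs w {1} ((\<lambda>x. [enc_label x]) ` L))"
    using impl_label[of "[1]" ls] unfolding L by simp
  then have "impl (lookup 1 ;; label [1] ls ;; lookup 1)
      (adv0 (enc_state ` members) O advs w {1} ((\<lambda>x. [enc_label x]) ` L) O adv0 (enc_state ` members))"
    by (intro impl_Seq impl_lookup_1)
  then have "impl (lookup 1 ;; label [1] ls ;; lookup 1) (adv0 (enc_trans ` (members \<times> L \<times> members)))"
    by (simp only: O_assoc[symmetric] adv0_advs adv0_conc conc_assoc conc_transitions)
  then have 1: "impl (clear 2 ;; star (lookup 1 ;; label [1] ls ;; lookup 1)) (adv0 (enc_transitions ` mlists L))"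
    unfolding mlists_def stars_image[symmetric] adv0_stars[symmetric]
    by (intro impl_Seq impl_clear impl_star) simp_all
  have 2: "impl (clear 2 ;; star (lookup 1)) (adv0 (enc_states ` slists))"
    unfolding slists_def stars_image[symmetric] adv0_stars[symmetric]
    by (intro impl_Seq impl_clear impl_star impl_lookup_1) simp_all
  have 3: "impl (star (name [1])) (advs w {1} (range enc_states))" using impl_names[of "[1]"] by simp
  \<comment> \<open>The input is cut where register 3 is saved: \<open>H\<close> is read before that
    moment and \<open>T\<close> after it.\<close>
  define H where "H = conc (range enc_states) (conc {[3]} (conc (enc_transitions ` mlists L) {[3]}))"
  define T where "T = conc (enc_state ` members) (conc {[3]} (enc_states ` slists))"
  have H: "advs w {1} (range enc_states) O advs w {1} {[3]} O adv0 (enc_transitions ` mlists L) O advs w {1} {[3]} = adv0 H"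
    unfolding adv0_advs advs_adv0 H_def ..
  have T: "adv0 (enc_state ` members) O advs w {1} {[3]} O adv0 (enc_states ` slists) = adv0 T"
    unfolding advs_adv0 adv0_conc T_def ..
  have "impl (validate ls) ({(v, v'). v' = v(1 := 1)} O advs w {1} (range enc_states) O advs w {1} {[3]} O
      adv0 (enc_transitions ` mlists L) O advs w {1} {[3]} O {(v, v'). v' = v(3 := v 1)} O
      adv0 (enc_state ` members) O advs w {1} {[3]} O adv0 (enc_states ` slists) O
      {(v, v'). input_cell w (v 1) = RightEnd \<and> v' = v})"
    unfolding validate_def
    by (rule impl_Seq[OF impl_goto impl_Seq[OF 3 impl_Seq[OF impl_expect impl_Seq[OF 1 impl_Seq[OF impl_expect
        impl_Seq[OF impl_copy impl_Seq[OF impl_lookup_1 impl_Seq[OF impl_expect impl_Seq[OF 2 impl_chk]]]]]]]]])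
      simp_all
  then have "impl (validate ls) ({(v, v'). v' = v(1 := 1)} O
      (advs w {1} (range enc_states) O advs w {1} {[3]} O adv0 (enc_transitions ` mlists L) O advs w {1} {[3]}) O
      {(v, v'). v' = v(3 := v 1)} O
      (adv0 (enc_state ` members) O advs w {1} {[3]} O adv0 (enc_states ` slists)) O
      {(v, v'). input_cell w (v 1) = RightEnd \<and> v' = v})"
    by (simp only: O_assoc)
  then have main: "impl (validate ls) ({(v, v'). v' = v(1 := 1)} O adv0 H O {(v, v'). v' = v(3 := v 1)} O adv0 T O
      {(v, v'). input_cell w (v 1) = RightEnd \<and> v' = v})"
    unfolding H T .
  have "impl (validate ls) {(v, v'). \<exists>h \<in> H. \<exists>t \<in> T.
      (reads w (Suc 0) (h @ t) \<and> input_cell w (Suc (length (h @ t))) = RightEnd) \<and>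
      v' = v(1 := Suc (length (h @ t)), 2 := 0, 3 := Suc (length h))}"
  proof -
    have upd: "(((v(1 := 1))(1 := (v(1 := 1)) 1 + k, 2 := 0))(3 := ((v(1 := 1))(1 := (v(1 := 1)) 1 + k, 2 := 0)) 1))
        (1 := (((v(1 := 1))(1 := (v(1 := 1)) 1 + k, 2 := 0))(3 := ((v(1 := 1))(1 := (v(1 := 1)) 1 + k, 2 := 0)) 1)) 1 + l,
         2 := 0) = v(1 := Suc (k + l), 2 := 0, 3 := Suc k)" for v :: "nat \<Rightarrow> nat" and k l
      by (auto simp: fun_eq_iff)
    show ?thesis
      by (rule impl_cong[OF main])
        (unfold fun_O adv0_O mem_Collect_eq prod.case upd, intro bex_cong HOL.refl, auto)
  qed
  then have "impl (validate ls) {(v, v'). \<exists>h \<in> H. \<exists>t \<in> T. w = h @ t \<and>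
      v' = v(1 := Suc (length w), 2 := 0, 3 := Suc (length h))}"
    unfolding reads_whole
    by (rule impl_cong) (unfold mem_Collect_eq prod.case, intro bex_cong refl, auto)
  moreover have "h \<in> H \<longleftrightarrow> (\<exists>qs. \<exists>ts \<in> mlists L. h = enc_states qs @ [3] @ enc_transitions ts @ [3])" for h
    unfolding H_def mem_conc_image mem_conc_singleton by (simp add: Bex_def mem_conc_image mem_conc_singleton) blast
  moreover have "t \<in> T \<longleftrightarrow> (\<exists>i \<in> members. \<exists>fs \<in> slists. t = enc_state i @ [3] @ enc_states fs)" for t
    unfolding T_def mem_conc_image mem_conc_singleton by (simp add: Bex_def mem_conc_image mem_conc_singleton) blast
  ultimately show ?thesis
    by (elim impl_cong) (simp only: mem_Collect_eq prod.case Bex_def, fastforce)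
qed

lemma impl_repeat_Dec: "impl (repeat m (Dec 4)) {(v, v'). m \<le> v 4 \<and> v' = v(4 := v 4 - m)}"
proof (induction m)
  case 0
  show ?case by (rule impl_cong[where r = Id]) (auto simp: repeat_def impl_Skip)
next
  case (Suc m)
  have "impl (repeat (Suc m) (Dec 4)) ({(v, v'). 0 < v 4 \<and> v' = v(4 := v 4 - 1)} O {(v, v'). m \<le> v 4 \<and> v' = v(4 := v 4 - m)})"
    unfolding repeat_def replicate.simps seqs.simps
    by (rule impl_Seq[OF impl_Dec Suc[unfolded repeat_def]]) simp
  then show ?case by (rule impl_cong) (auto simp: guard_O)
qed

lemma impl_repeat_Inc: "impl (repeat m (Inc 4)) {(v, v'). (m = 0 \<or> v 4 + m < N) \<and> v' = v(4 := v 4 + m)}"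
proof (induction m)
  case 0
  show ?case by (rule impl_cong[where r = Id]) (auto simp: repeat_def impl_Skip)
next
  case (Suc m)
  have "impl (repeat (Suc m) (Inc 4)) ({(v, v'). v 4 + 1 < N \<and> v' = v(4 := v 4 + 1)} O
      {(v, v'). (m = 0 \<or> v 4 + m < N) \<and> v' = v(4 := v 4 + m)})"
    unfolding repeat_def replicate.simps seqs.simps
    by (rule impl_Seq[OF impl_Inc Suc[unfolded repeat_def]]) simp
  then show ?case by (rule impl_cong) (auto simp: guard_O)
qed

lemma impl_switch:
  assumes "f' < N"
  shows "impl (switch f f') {(v, v'). v 4 = f \<and> v' = v(4 := f')}"
  unfolding switch_def
  by (rule impl_cong[OF impl_Seq[OF impl_repeat_Dec impl_Seq[OF impl_assert_zero impl_repeat_Inc]]])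
    (use assms in \<open>simp_all only: guard_O mem_Collect_eq prod.case, auto\<close>)

definition fetch_rel :: "symbol option set \<Rightarrow> symbol option \<Rightarrow> (nat \<Rightarrow> nat) rel" where
  "fetch_rel L x = {(v, v'). \<exists>qs ts u. ts \<in> tlists L \<and>
     reads w (Suc 0) (enc_states qs @ [3] @ enc_transitions ts @ enc_state u @ [enc_label x]) \<and>
     reads w (v 3) (enc_state u) \<and>
     v' = v(3 := Suc (length (enc_states qs @ [3] @ enc_transitions ts @ enc_state u @ [enc_label x])), 2 := 0)}"

definition switch_rel :: "nat \<Rightarrow> nat \<Rightarrow> (nat \<Rightarrow> nat) rel" where
  "switch_rel f f' = {(v, v'). v 4 = f \<and> v' = v(4 := f')}"

definition advance_rel :: "symbol option set \<Rightarrow> nat \<times> symbol option \<times> nat \<Rightarrow> (nat \<Rightarrow> nat) rel" where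
  "advance_rel L = (\<lambda>(f, x, f'). case x of None \<Rightarrow> switch_rel f f' | Some a \<Rightarrow> fetch_rel L x O switch_rel f f')"

definition finish_rel :: "symbol option set \<Rightarrow> (nat \<Rightarrow> nat) rel" where
  "finish_rel L = {(v, v'). \<exists>qs ts i fs u. ts \<in> tlists L \<and>
     reads w (Suc 0) (enc_states qs @ [3] @ enc_transitions ts @ [3] @ enc_state i @ [3] @ enc_states fs @ enc_state u) \<and>
     reads w (v 3) (enc_state u) \<and> v' = v(3 := v 3 + length (enc_state u), 2 := 0)}"

lemma impl_advance:
  assumes "set ls = enc_label ` L" "snd (snd t) < N"
  shows "impl (advance ls t) (advance_rel L t)"
proof -
  obtain f x f' where t: "t = (f, x, f')" by (cases t)
  have s: "impl (switch f f') (switch_rel f f')"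
    unfolding switch_rel_def using assms(2) t by (intro impl_switch) simp
  have "impl (fetch ls (enc_label x)) (fetch_rel L x)"
    unfolding fetch_rel_def by (rule impl_fetch[OF assms(1)])
  then show ?thesis using s impl_Seq by (auto simp: t advance_def advance_rel_def split: option.split)
qed

lemma impl_simulate:
  assumes "set ls = enc_label ` L" "\<And>t. t \<in> set us \<Longrightarrow> snd (snd t) < N"
  shows "impl (simulate ls us) (fetch_rel L None \<union> (\<Union>t \<in> set us. advance_rel L t))"
proof -
  have "impl (fetch ls (enc_label None)) (fetch_rel L None)"
    unfolding fetch_rel_def by (rule impl_fetch[OF assms(1)])
  then show ?thesis
    unfolding simulate_def using assms by (intro impl_Any impl_select impl_advance)
qed

end

section \<open>The walk through the product on a well-formed encoding\<close>

locale encoded = pointers +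
  fixes L :: "symbol option set" and qs ts i fs
  assumes w: "w = enc_states qs @ [3] @ enc_transitions ts @ [3] @ enc_state i @ [3] @ enc_states fs"
    and ts: "ts \<in> lists (UNIV \<times> L \<times> UNIV)"
begin

lemma members: "members = set qs"
proof (intro equalityI subsetI)
  fix u
  assume "u \<in> members"
  then obtain qs' where "reads w (Suc 0) (enc_states qs' @ enc_state u)" unfolding members_def by blast
  then obtain z where "w = enc_states qs' @ enc_state u @ z" unfolding reads_1 by auto
  then have "enc_states qs @ (3 # enc_transitions ts @ [3] @ enc_state i @ [3] @ enc_states fs) =
      enc_states qs' @ enc_state u @ z" by (simp add: w)
  then show "u \<in> set qs" by (rule enc_states_member) simp
next
  fix u
  assume "u \<in> set qs"
  then obtain qs1 qs2 where "qs = qs1 @ u # qs2" by (meson split_list)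
  then have "reads w (Suc 0) (enc_states qs1 @ enc_state u)" unfolding reads_1 w by auto
  then show "u \<in> members" unfolding members_def by blast
qed

text \<open>Any occurrence of a name represents the state, in whichever section it stands; a state
  therefore has many representations.\<close>

definition rep :: "(nat \<Rightarrow> nat) \<Rightarrow> bool list \<times> nat \<Rightarrow> bool" where
  "rep v = (\<lambda>(p, f). reads w (v 3) (enc_state p) \<and> v 4 = f \<and> v 3 \<noteq> 0)"

lemma reads_state_inj:
  assumes "reads w k (enc_state p)" "reads w k (enc_state p')" "k \<noteq> 0"
  shows "p = p'"
proof -
  obtain k' where "k = Suc k'" using assms(3) by (cases k) auto
  then obtain z z' where "enc_state p @ z = enc_state p' @ z'" using assms(1,2) by (auto simp: reads_iff)
  then show ?thesis by simp
qed

text \<open>The parse guessed by the program agrees with the true one as far as it goes, so the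
  transition at which it stops is an entry of \<open>ts\<close>.\<close>

lemma fetch_sound:
  assumes "(v, v') \<in> fetch_rel L x" "rep v (p, f)"
  shows "\<exists>p'. (p, x, p') \<in> set ts \<and> rep v' (p', f)"
proof -
  obtain qs' ts' u where *: "reads w (Suc 0) (enc_states qs' @ [3] @ enc_transitions ts' @ enc_state u @ [enc_label x])"
     "reads w (v 3) (enc_state u)"
     "v' = v(3 := Suc (length (enc_states qs' @ [3] @ enc_transitions ts' @ enc_state u @ [enc_label x])), 2 := 0)"
    using assms(1) unfolding fetch_rel_def by blast
  have u: "u = p" using *(2) assms(2) reads_state_inj by (auto simp: rep_def)
  obtain z where z: "w = (enc_states qs' @ [3] @ enc_transitions ts' @ enc_state p @ [enc_label x]) @ z"
    using *(1) unfolding reads_1 u by blast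
  then have "qs = qs' \<and> enc_transitions ts @ 3 # enc_state i @ [3] @ enc_states fs =
      enc_transitions ts' @ enc_state p @ enc_label x # z"
    using enc_states_inject[of qs _ qs'] by (simp add: w)
  then obtain p' y where p': "(p, x, p') \<in> set ts" "z = enc_state p' @ y"
    using enc_transitions_member by blast
  have "reads w (v' 3) (enc_state p')"
    unfolding *(3) u by (subst z) (simp add: reads_after[simplified] p'(2) del: append_assoc, simp add: reads_iff)
  then show ?thesis using p'(1) assms(2) *(3) by (auto simp: rep_def)
qed

lemma fetch_complete:
  assumes "(p, x, p') \<in> set ts" "rep v (p, f)"
  shows "\<exists>v'. (v, v') \<in> fetch_rel L x \<and> rep v' (p', f)"
proof -
  obtain ts1 ts2 where ts12: "ts = ts1 @ (p, x, p') # ts2" using assms(1) by (meson split_list)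
  let ?u = "enc_states qs @ [3] @ enc_transitions ts1 @ enc_state p @ [enc_label x]"
  let ?v = "v(3 := Suc (length ?u), 2 := 0)"
  have z: "w = ?u @ enc_state p' @ enc_transitions ts2 @ [3] @ enc_state i @ [3] @ enc_states fs"
    by (simp add: w ts12)
  then have "reads w (Suc 0) ?u" unfolding reads_1 by blast
  moreover have "ts1 \<in> tlists L" using ts ts12 by (simp add: tlists_def)
  ultimately have "(v, ?v) \<in> fetch_rel L x" unfolding fetch_rel_def using assms(2) by (auto simp: rep_def)
  moreover have "reads w (Suc (length ?u)) (enc_state p')"
    using z reads_after[of ?u "enc_state p' @ enc_transitions ts2 @ [3] @ enc_state i @ [3] @ enc_states fs"] by blast
  then have "rep ?v (p', f)" using assms(2) by (simp add: rep_def del: length_append)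
  ultimately show ?thesis by blast
qed

lemma finish_iff:
  assumes "rep v (p, f)"
  shows "(\<exists>v'. (v, v') \<in> finish_rel L) \<longleftrightarrow> p \<in> set fs"
proof
  assume "\<exists>v'. (v, v') \<in> finish_rel L"
  then obtain qs' ts' i' fs' u where *: "reads w (v 3) (enc_state u)"
     "reads w (Suc 0) (enc_states qs' @ [3] @ enc_transitions ts' @ [3] @ enc_state i' @ [3] @ enc_states fs' @ enc_state u)"
    unfolding finish_rel_def by blast
  have u: "u = p" using *(1) assms reads_state_inj by (auto simp: rep_def)
  obtain z where "w = (enc_states qs' @ [3] @ enc_transitions ts' @ [3] @ enc_state i' @ [3] @ enc_states fs' @ enc_state p) @ z"
    using *(2) unfolding reads_1 u by blast
  then have "enc_states fs = enc_states fs' @ enc_state p @ z"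
    using enc_states_inject[of qs _ qs'] enc_transitions_inject[of ts _ ts'] by (simp add: w)
  then show "p \<in> set fs" using enc_states_member[of fs "[]" fs' p z] by simp
next
  assume "p \<in> set fs"
  then obtain fs1 fs2 where "fs = fs1 @ p # fs2" by (meson split_list)
  then have "reads w (Suc 0) (enc_states qs @ [3] @ enc_transitions ts @ [3] @ enc_state i @ [3] @ enc_states fs1 @ enc_state p)"
    unfolding reads_1 w by auto
  moreover have "ts \<in> tlists L" using ts by (simp add: tlists_def)
  moreover have "reads w (v 3) (enc_state p)" using assms by (simp add: rep_def)
  ultimately have "(v, v(3 := v 3 + length (enc_state p), 2 := 0)) \<in> finish_rel L"
    unfolding finish_rel_def by blast
  then show "\<exists>v'. (v, v') \<in> finish_rel L" by blast
qed

lemma finish_4: "(v, v') \<in> finish_rel L \<Longrightarrow> v' 4 = v 4"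
  by (auto simp: finish_rel_def)

definition sim_rel :: "nat nfa \<Rightarrow> (nat \<Rightarrow> nat) rel" where
  "sim_rel B = fetch_rel L None \<union> (\<Union>t \<in> trans B. advance_rel L t)"

text \<open>Together with \<open>sim_complete\<close>, \<open>rep\<close> is a bisimulation between
  the rounds of the program and the steps of the product.\<close>

lemma sim_sound:
  assumes "(v, v') \<in> (sim_rel B)\<^sup>*" "rep v s" "trans A = set ts"
  shows "\<exists>s'. (s, s') \<in> (prod_step A B)\<^sup>* \<and> rep v' s'"
  using assms(1)
proof (induction rule: rtrancl_induct)
  case base
  then show ?case using assms(2) by blast
next
  case (step y z)
  then obtain p f where s': "(s, (p, f)) \<in> (prod_step A B)\<^sup>*" "rep y (p, f)" by auto
  from step(2) consider "(y, z) \<in> fetch_rel L None" | g x g' where "(g, x, g') \<in> trans B" "(y, z) \<in> advance_rel L (g, x, g')"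
    unfolding sim_rel_def by auto
  then have "\<exists>s'. ((p, f), s') \<in> prod_step A B \<and> rep z s'"
  proof cases
    case 1
    then show ?thesis using fetch_sound s'(2) assms(3) by (fastforce simp: prod_step_def)
  next
    case (2 g x g')
    show ?thesis
    proof (cases x)
      case None
      then have "g = f" "rep z (p, g')" using 2(2) s'(2) by (auto simp: advance_rel_def switch_rel_def rep_def)
      moreover have "((p, f), (p, g')) \<in> prod_step A B" using 2(1) None \<open>g = f\<close> by (simp add: prod_step_def)
      ultimately show ?thesis by blast
    next
      case (Some a)
      then obtain v1 where v1: "(y, v1) \<in> fetch_rel L x" "(v1, z) \<in> switch_rel g g'"
        using 2(2) by (auto simp: advance_rel_def)
      obtain p' where p': "(p, x, p') \<in> set ts" "rep v1 (p', f)" using fetch_sound v1(1) s'(2) by blast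
      then have "g = f" "rep z (p', g')" using v1(2) by (auto simp: switch_rel_def rep_def)
      moreover have "((p, f), (p', g')) \<in> prod_step A B"
        using 2(1) p'(1) Some \<open>g = f\<close> assms(3) by (auto simp: prod_step_def)
      ultimately show ?thesis by blast
    qed
  qed
  then show ?case using s'(1) by (meson rtrancl.rtrancl_into_rtrancl)
qed

lemma sim_complete:
  assumes "(s, s') \<in> (prod_step A B)\<^sup>*" "rep v s" "trans A = set ts"
  shows "\<exists>v'. (v, v') \<in> (sim_rel B)\<^sup>* \<and> rep v' s'"
  using assms(1)
proof (induction rule: rtrancl_induct)
  case base
  then show ?case using assms(2) by blast
next
  case (step y z)
  then obtain v1 where v1: "(v, v1) \<in> (sim_rel B)\<^sup>*" "rep v1 y" by blast
  obtain p f p' f' where yz: "y = (p, f)" "z = (p', f')" by (cases y; cases z)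
  from step(2) consider "(p, None, p') \<in> set ts" "f' = f" | "(f, None, f') \<in> trans B" "p' = p"
    | a where "(p, Some a, p') \<in> set ts" "(f, Some a, f') \<in> trans B"
    unfolding prod_step_def yz assms(3) by auto
  then have "\<exists>v'. (v1, v') \<in> sim_rel B \<and> rep v' z"
  proof cases
    case 1
    then show ?thesis using fetch_complete v1(2) unfolding sim_rel_def yz by blast
  next
    case 2
    have "(v1, v1(4 := f')) \<in> advance_rel L (f, None, f')" "rep (v1(4 := f')) (p, f')"
      using v1(2) by (auto simp: advance_rel_def switch_rel_def rep_def yz)
    then show ?thesis using 2 unfolding sim_rel_def yz by blast
  next
    case (3 a)
    obtain v2 where v2: "(v1, v2) \<in> fetch_rel L (Some a)" "rep v2 (p', f)"
      using fetch_complete 3(1) v1(2) unfolding yz by blast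
    then have "(v2, v2(4 := f')) \<in> switch_rel f f'" "rep (v2(4 := f')) (p', f')"
      by (auto simp: switch_rel_def rep_def)
    moreover from this have "(v1, v2(4 := f')) \<in> advance_rel L (f, Some a, f')"
      using v2(1) by (auto simp: advance_rel_def)
    ultimately show ?thesis using 3(2) unfolding sim_rel_def yz by blast
  qed
  then show ?case using v1(1) by (meson rtrancl.rtrancl_into_rtrancl)
qed

end

context pointers
begin

definition valid_rel :: "symbol option set \<Rightarrow> (nat \<Rightarrow> nat) rel" where
  "valid_rel L = {(v, v'). \<exists>qs. \<exists>ts \<in> mlists L. \<exists>i \<in> members. \<exists>fs \<in> slists.
     w = enc_states qs @ [3] @ enc_transitions ts @ [3] @ enc_state i @ [3] @ enc_states fs \<and>
     v' = v(1 := Suc (length w), 2 := 0, 3 := Suc (length (enc_states qs @ [3] @ enc_transitions ts @ [3])))}"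

lemma sem_realize:
  assumes "is_nfa \<Delta> B" "states B \<subseteq> {..<N}" "set us = trans B" "set fl = final B"
    and L: "L = insert None (Some ` \<Delta>)" "set ls = enc_label ` L"
    and v: "ok v" "v 4 = 0"
  shows "(\<exists>s. ((0, v, []), s) \<in> sem w N (realize ls us (init B) fl)) \<longleftrightarrow> w \<in> RRn \<Delta> (lang B)"
proof -
  let ?S = "fetch_rel L None \<union> (\<Union>t \<in> trans B. advance_rel L t)"
  let ?F = "\<Union>f \<in> final B. switch_rel f f"
  have bound: "init B < N" "\<And>f. f \<in> final B \<Longrightarrow> f < N" "\<And>t. t \<in> trans B \<Longrightarrow> snd (snd t) < N"
    using assms(1,2) unfolding is_nfa_def by auto
  have "impl (simulate ls us) ?S" using impl_simulate[OF L(2), of us] assms(3) bound(3) by simp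
  moreover have "impl (select (map (\<lambda>f. switch f f) fl)) ?F"
    unfolding assms(4)[symmetric] switch_rel_def
    by (intro impl_select impl_switch bound(2)) (simp add: assms(4))
  moreover have "impl (validate ls) (valid_rel L)"
    unfolding valid_rel_def by (rule impl_validate[OF L(2)])
  moreover have "impl (finish ls) (finish_rel L)"
    unfolding finish_rel_def by (rule impl_finish[OF L(2)])
  ultimately have "impl (realize ls us (init B) fl) (valid_rel L O
      {(v, v'). (init B = 0 \<or> v 4 + init B < N) \<and> v' = v(4 := v 4 + init B)} O ?S\<^sup>* O finish_rel L O ?F)"
    unfolding realize_def by (intro impl_Seq impl_star impl_repeat_Inc)
  then have sem: "(\<exists>s. ((0, v, []), s) \<in> sem w N (realize ls us (init B) fl)) \<longleftrightarrow>
      (\<exists>v1 v2 v3 v4. (v, v1) \<in> valid_rel L \<and> v2 = v1(4 := v1 4 + init B) \<and> (init B = 0 \<or> v1 4 + init B < N) \<and>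
         (v2, v3) \<in> ?S\<^sup>* \<and> (v3, v4) \<in> finish_rel L \<and> v4 4 \<in> final B)"
    using implD v(1) by (fastforce simp: switch_rel_def)
  \<comment> \<open>After validation register 3 stands behind two sections and two separators, hence
    at the name of the initial state.\<close>
  have start: "encoded.rep w v2 (i, init B) \<and> v2 4 = init B"
    if "encoded w N L qs ts i fs" "v2 = v(1 := Suc (length w), 2 := 0,
        3 := Suc (length (enc_states qs @ [3] @ enc_transitions ts @ [3])), 4 := init B)" for v2 qs ts i fs
  proof -
    interpret encoded w N L qs ts i fs by (rule that(1))
    have "reads w (Suc (length (enc_states qs @ [3] @ enc_transitions ts @ [3]))) (enc_state i)"
      using reads_after[of "enc_states qs @ [3] @ enc_transitions ts @ [3]" "enc_state i @ [3] @ enc_states fs" "enc_state i"]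
      unfolding w by simp
    then show ?thesis using that(2) by (simp add: rep_def)
  qed
  show ?thesis
  proof
    assume "\<exists>s. ((0, v, []), s) \<in> sem w N (realize ls us (init B) fl)"
    then obtain v1 v2 v3 v4 where *: "(v, v1) \<in> valid_rel L" "v2 = v1(4 := v1 4 + init B)"
        "(v2, v3) \<in> ?S\<^sup>*" "(v3, v4) \<in> finish_rel L" "v4 4 \<in> final B"
      unfolding sem by blast
    then obtain qs ts i fs where mem: "ts \<in> mlists L" "i \<in> members" "fs \<in> slists"
      and enc: "w = enc_states qs @ [3] @ enc_transitions ts @ [3] @ enc_state i @ [3] @ enc_states fs"
      and v1: "v1 = v(1 := Suc (length w), 2 := 0, 3 := Suc (length (enc_states qs @ [3] @ enc_transitions ts @ [3])))"
      unfolding valid_rel_def by blast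
    have e: "encoded w N L qs ts i fs"
    proof unfold_locales
      show "w = enc_states qs @ [3] @ enc_transitions ts @ [3] @ enc_state i @ [3] @ enc_states fs" by (rule enc)
      show "ts \<in> lists (UNIV \<times> L \<times> UNIV)" using mem(1) unfolding mlists_def by auto
    qed
    interpret encoded w N L qs ts i fs by (rule e)
    \<comment> \<open>The automaton is read off the validated parse; that all states mentioned are
      also listed is the statement \<open>members = set qs\<close>.\<close>
    let ?A = "\<lparr>states = set qs, trans = set ts, init = i, final = set fs\<rparr>"
    have rep: "rep v2 (i, init B)" using start[OF e] *(2) v1 v(2) by simp
    have sim: "(v2, v3) \<in> (sim_rel B)\<^sup>*" unfolding sim_rel_def by (rule *(3))
    obtain s where s: "((i, init B), s) \<in> (prod_step ?A B)\<^sup>*" "rep v3 s"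
      using sim_sound[OF sim rep, of ?A] by (simp only: nfa.simps) blast
    obtain p f where pf: "s = (p, f)" by (cases s)
    have "p \<in> final ?A" using finish_iff s(2) *(4) unfolding pf by auto
    moreover have "f \<in> final B" using s(2) finish_4[OF *(4)] *(5) by (simp add: pf rep_def)
    moreover obtain u where "nfa_path ?A i u p" "nfa_path B (init B) u f"
      using s(1) unfolding pf prod_path_iff by blast
    ultimately have "u \<in> lang ?A \<inter> lang B" by (auto simp: lang_def)
    moreover have "is_nfa \<Delta> ?A"
      using mem unfolding mlists_def slists_def members L(1) by (auto simp: is_nfa_def)
    moreover have "encodes w ?A" unfolding encodes_def
      by (intro exI[of _ qs] exI[of _ ts] exI[of _ fs]) (simp add: enc)
    ultimately show "w \<in> RRn \<Delta> (lang B)" unfolding RRn_def by blast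
  next
    assume "w \<in> RRn \<Delta> (lang B)"
    then obtain A u where A: "is_nfa \<Delta> A" "encodes w A" "u \<in> lang A" "u \<in> lang B"
      unfolding RRn_def by blast
    then obtain qs ts fs where st: "set qs = states A" "set ts = trans A" "set fs = final A"
      and enc: "w = enc_states qs @ [3] @ enc_transitions ts @ [3] @ enc_state (init A) @ [3] @ enc_states fs"
      unfolding encodes_def by auto
    have ts: "ts \<in> lists (set qs \<times> L \<times> set qs)"
      using A(1) st unfolding is_nfa_def L(1) by (auto simp: in_lists_conv_set)
    have e: "encoded w N L qs ts (init A) fs"
    proof unfold_locales
      show "w = enc_states qs @ [3] @ enc_transitions ts @ [3] @ enc_state (init A) @ [3] @ enc_states fs" by (rule enc)
      show "ts \<in> lists (UNIV \<times> L \<times> UNIV)" using ts by auto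
    qed
    interpret encoded w N L qs ts "init A" fs by (rule e)
    obtain p f where pf: "p \<in> final A" "f \<in> final B" "nfa_path A (init A) u p" "nfa_path B (init B) u f"
      using A(3,4) by (auto simp: lang_def)
    let ?v1 = "v(1 := Suc (length w), 2 := 0, 3 := Suc (length (enc_states qs @ [3] @ enc_transitions ts @ [3])))"
    let ?v2 = "?v1(4 := init B)"
    have "ts \<in> mlists L" "init A \<in> members" "fs \<in> slists"
      unfolding mlists_def slists_def members using ts A(1) st by (auto simp: is_nfa_def)
    then have 1: "(v, ?v1) \<in> valid_rel L" unfolding valid_rel_def using enc by blast
    have "rep ?v2 (init A, init B)" using start[OF e, of ?v2] by simp
    moreover have "((init A, init B), (p, f)) \<in> (prod_step A B)\<^sup>*"
      unfolding prod_path_iff using pf(3,4) by blast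
    ultimately obtain v3 where v3: "(?v2, v3) \<in> ?S\<^sup>*" "rep v3 (p, f)"
      using sim_complete[of "(init A, init B)" "(p, f)" A B ?v2, OF _ _ st(2)[symmetric]]
      unfolding sim_rel_def by blast
    then obtain v4 where v4: "(v3, v4) \<in> finish_rel L" using finish_iff pf(1) st by blast
    have "v4 4 \<in> final B" using finish_4[OF v4] v3(2) pf(2) by (simp add: rep_def)
    moreover have "?v2 = ?v1(4 := ?v1 4 + init B)" "init B = 0 \<or> ?v1 4 + init B < N" using v(2) bound(1) by simp_all
    ultimately show "\<exists>s. ((0, v, []), s) \<in> sem w N (realize ls us (init B) fl)"
      unfolding sem using 1 v3(1) v4 by blast
  qed
qed

end

lemma bounded_seqs: "(\<And>c. c \<in> set cs \<Longrightarrow> bounded K c) \<Longrightarrow> bounded K (seqs cs)"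
  by (induction cs) auto

lemma bounded_select: "0 < K \<Longrightarrow> (\<And>c. c \<in> set cs \<Longrightarrow> bounded K c) \<Longrightarrow> bounded K (select cs)"
  unfolding select_def by (induction cs) (auto simp: fail_def)

lemma bounded_expects: "0 < K \<Longrightarrow> (\<And>j. j \<in> set js \<Longrightarrow> j < K) \<Longrightarrow> bounded K (expects js x)"
  unfolding expects_def by (rule bounded_seqs) (auto simp: expect_def chk_def fail_def)

lemma bounded_pointer_programs:
  "bounded 5 (name [1])" "bounded 5 (name [2])" "bounded 5 (name [1, 2])" "bounded 5 (name [3, 2])"
  "bounded 5 (label [1] ls)" "bounded 5 (label [2] ls)" "bounded 5 (expect x 1)" "bounded 5 (expect x 2)"
  by (auto simp: name_def label_def expect_def chk_def fail_def intro!: bounded_expects bounded_select)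

lemma bounded_switch [simp]: "bounded 5 (switch f f')"
  by (auto simp: switch_def repeat_def assert_zero_def fail_def intro!: bounded_seqs)

lemma bounded_fetch [simp]: "bounded 5 (fetch ls x)"
  using bounded_pointer_programs by (simp add: fetch_def goto_def transition_def)

lemma bounded_advance [simp]: "bounded 5 (advance ls t)"
  by (cases t) (auto simp: advance_def split: option.split)

lemma bounded_realize: "bounded 5 (realize ls us f0 fs)"
  using bounded_pointer_programs
  by (auto simp: realize_def validate_def lookup_def goto_def simulate_def finish_def transition_def repeat_def
      chk_def fail_def intro!: bounded_seqs bounded_select)

lemma finite_trans:
  assumes "is_nfa \<Delta> A" "finite \<Delta>"
  shows "finite (trans A)"
proof (rule finite_subset)
  show "trans A \<subseteq> states A \<times> insert None (Some ` \<Delta>) \<times> states A" using assms(1) by (simp add: is_nfa_def)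
  show "finite (states A \<times> insert None (Some ` \<Delta>) \<times> states A)" using assms by (simp add: is_nfa_def)
qed

lemma encodes_lists:
  assumes "is_nfa \<Delta> A" "encodes w A"
  shows "w \<in> lists (nfa_alphabet \<Delta>)"
proof -
  have st: "set (enc_state u) \<subseteq> nfa_alphabet \<Delta>" for u
    by (auto simp: enc_state_def nfa_alphabet_def)
  have "set (enc_trans t) \<subseteq> nfa_alphabet \<Delta>" if "t \<in> trans A" for t
  proof -
    obtain p x q where t: "t = (p, x, q)" by (cases t)
    have "x \<in> insert None (Some ` \<Delta>)" using assms(1) that by (auto simp: is_nfa_def t)
    then have "enc_label x \<in> nfa_alphabet \<Delta>" by (auto simp: nfa_alphabet_def)
    then show ?thesis using st by (simp add: t)
  qed
  moreover have "3 \<in> nfa_alphabet \<Delta>" by (simp add: nfa_alphabet_def)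
  moreover obtain qs ts fs where "set ts = trans A"
      "w = enc_states qs @ [3] @ enc_transitions ts @ [3] @ enc_state (init A) @ [3] @ enc_states fs"
    using assms(2) unfolding encodes_def by blast
  ultimately have "set w \<subseteq> nfa_alphabet \<Delta>" using st by (simp add: UN_subset_iff)
  then show ?thesis by auto
qed

lemma RRn_subset: "RRn \<Delta> F \<subseteq> lists (nfa_alphabet \<Delta>)"
  unfolding RRn_def using encodes_lists by blast

lemma width_pos: "n + 2 < 2 ^ width n"
  unfolding width_def by (rule less_power_length_bits)

theorem RRn_in_NL:
  assumes "finite \<Delta>" "regular \<Delta> F"
  shows "RRn \<Delta> F \<in> NL (nfa_alphabet \<Delta>)"
proof -
  obtain B :: "nat nfa" where B: "is_nfa \<Delta> B" "lang B = F" using assms(2) unfolding regular_def by blast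
  obtain us where us: "set us = trans B" using finite_list[OF finite_trans[OF B(1) assms(1)]] by blast
  have fin: "finite (states B)" "final B \<subseteq> states B" using B(1) by (auto simp: is_nfa_def)
  obtain fl where fl: "set fl = final B" using finite_list[OF finite_subset[OF fin(2,1)]] by blast
  define L where "L = insert None (Some ` \<Delta>)"
  obtain ls where ls: "set ls = enc_label ` L" using finite_list[of "enc_label ` L"] assms(1) unfolding L_def by auto
  obtain m where m: "states B \<subseteq> {..<m}" using fin(1) unfolding finite_nat_set_iff_bounded by blast
  \<comment> \<open>The states of the fixed automaton must fit into a register for every input.
    There is always at least one digit, so \<open>2 ^ C \<le> N\<close> holds even for the empty
    word.\<close>
  define C where "C = Suc m"
  have C: "states B \<subseteq> {..<2 ^ C}"
    using m less_exp[of C] unfolding C_def by force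
  let ?p = "prelude ;; realize ls us (init B) fl"
  have "finite (nfa_alphabet \<Delta>)" using assms(1) by (simp add: nfa_alphabet_def)
  moreover have "bounded 5 ?p" using bounded_realize by (simp add: prelude_def)
  ultimately obtain M where M: "is_tm M" "logspace M (nfa_alphabet \<Delta>)"
    "\<And>w. w \<in> lists (nfa_alphabet \<Delta>) \<Longrightarrow> \<exists>x < (2 ^ C) ^ width (length w).
       (accepts M w \<longleftrightarrow> (\<exists>s. ((length w + 1, \<lambda>_. x, []), s) \<in> sem w ((2 ^ C) ^ width (length w)) ?p))"
    using program_to_tm[of "nfa_alphabet \<Delta>" 5 ?p C] unfolding C_def by (metis zero_less_Suc zero_less_numeral)
  have "w \<in> RRn \<Delta> F \<longleftrightarrow> accepts M w" if in_lists: "w \<in> lists (nfa_alphabet \<Delta>)" for w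
  proof -
    define N where "N = (2 ^ C :: nat) ^ width (length w)"
    obtain x where x: "x < N" "accepts M w \<longleftrightarrow> (\<exists>s. ((length w + 1, \<lambda>_. x, []), s) \<in> sem w N ?p)"
      using M(3)[OF in_lists] unfolding N_def by blast
    have w: "0 < width (length w)" using width_pos[of "length w"] by (cases "width (length w)") auto
    have "(2 :: nat) ^ width (length w) \<le> N"
      unfolding N_def by (rule power_mono) (use self_le_power[of "2 :: nat" C] in \<open>auto simp: C_def\<close>)
    then have len: "length w + 1 < N" using width_pos[of "length w"] by linarith
    interpret pointers w N by unfold_locales (rule len)
    have "2 ^ C \<le> N" unfolding N_def using self_le_power[of "2 ^ C :: nat" "width (length w)"] w by simp
    then have "states B \<subseteq> {..<N}" using C by auto
    moreover have "ok ((\<lambda>_. x)(0 := 0, 1 := 0, 2 := 0, 3 := 0, 4 := 0))" using x(1) by (simp add: ok_def)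
    ultimately have "w \<in> RRn \<Delta> F \<longleftrightarrow> (\<exists>s. ((0, (\<lambda>_. x)(0 := 0, 1 := 0, 2 := 0, 3 := 0, 4 := 0), []), s)
        \<in> sem w N (realize ls us (init B) fl))"
      using sem_realize[OF B(1) _ us fl L_def ls] unfolding B(2) by simp
    also have "\<dots> \<longleftrightarrow> (\<exists>s. ((length w + 1, \<lambda>_. x, []), s) \<in> sem w N ?p)"
      unfolding sem.simps(6) relcomp_unfold by (simp add: sem_prelude[simplified])
    finally show ?thesis using x(2) by simp
  qed
  then show ?thesis unfolding NL_def using M(1,2) RRn_subset by blast
qed

section \<open>Configurations as vectors of numbers\<close>

text \<open>The leading digit 1 distinguishes a head on cell 0 from a head with only blanks to its left.\<close>

fun left_num :: "nat \<Rightarrow> (nat \<Rightarrow> nat) \<Rightarrow> nat \<Rightarrow> nat" where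
  "left_num b t 0 = 1"
| "left_num b t (Suc h) = b * left_num b t h + t h"

text \<open>The least significant digit is the scanned one, so both numbers of a tape change only at
  their low ends when the head moves. The argument \<open>m\<close> is the number of cells taken
  into account.\<close>

fun right_num :: "nat \<Rightarrow> (nat \<Rightarrow> nat) \<Rightarrow> nat \<Rightarrow> nat \<Rightarrow> nat" where
  "right_num b t 0 h = 0"
| "right_num b t (Suc m) h = b * right_num b t m (Suc h) + t h"

lemma left_num_cong: "(\<And>k. k < h \<Longrightarrow> t k = t' k) \<Longrightarrow> left_num b t h = left_num b t' h"
  by (induction h) auto

lemma right_num_cong: "(\<And>k. h \<le> k \<Longrightarrow> t k = t' k) \<Longrightarrow> right_num b t m h = right_num b t' m h"
proof (induction m arbitrary: h)
  case (Suc m)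
  have "right_num b t m (Suc h) = right_num b t' m (Suc h)" using Suc.prems by (intro Suc.IH) simp
  then show ?case using Suc.prems[of h] by simp
qed simp

lemma left_num_pos: "0 < b \<Longrightarrow> 0 < left_num b t h"
  by (induction h) auto

text \<open>The leading digit 1 costs the factor 2 that reappears in the requirement
  \<open>2 * b ^ S \<le> N\<close>.\<close>

lemma left_num_less: "(\<And>k. t k < b) \<Longrightarrow> left_num b t h < 2 * b ^ h"
proof (induction h)
  case (Suc h)
  have "left_num b t h + 1 \<le> 2 * b ^ h" using Suc by simp
  then have "b * (left_num b t h + 1) \<le> b * (2 * b ^ h)" by (rule mult_le_mono2)
  then show ?case using Suc.prems[of h] by simp
qed simp

lemma right_num_less: "(\<And>k. t k < b) \<Longrightarrow> right_num b t m h < b ^ m"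
proof (induction m arbitrary: h)
  case (Suc m)
  have "right_num b t m (Suc h) + 1 \<le> b ^ m" using Suc by (simp add: Suc_le_eq)
  then have "b * (right_num b t m (Suc h) + 1) \<le> b * b ^ m" by (rule mult_le_mono2)
  then show ?case using Suc.prems[of h] by simp
qed simp

lemma digit_eq:
  fixes b x y r s :: nat
  assumes "b * x + r = b * y + s" "r < b" "s < b"
  shows "x = y \<and> r = s"
proof -
  have "(b * x + r) div b = x" "(b * y + s) div b = y" using assms(2,3) by simp_all
  then have "x = y" using assms(1) by simp
  then show ?thesis using assms(1) by simp
qed

type_synonym linear = "nat \<times> nat \<times> nat \<times> nat"

fun src :: "linear \<Rightarrow> nat \<Rightarrow> nat" where
  "src (\<alpha>, \<beta>, \<gamma>, \<delta>) x = \<alpha> * x + \<beta>"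

fun dst :: "linear \<Rightarrow> nat \<Rightarrow> nat" where
  "dst (\<alpha>, \<beta>, \<gamma>, \<delta>) x = \<gamma> * x + \<delta>"

text \<open>A template \<open>(\<alpha>, \<beta>, \<gamma>, \<delta>)\<close> sends \<open>\<alpha> x + \<beta>\<close> to \<open>\<gamma> x + \<delta>\<close>. For a left move the digit \<open>a\<close> popped
  from the left number \<open>b (x + 1) + a\<close> is guessed; writing \<open>x + 1\<close> instead of \<open>x\<close> excludes the left
  number 1, for which the head does not move.\<close>

fun tape_templates :: "nat \<Rightarrow> symbol \<Rightarrow> symbol \<times> move \<Rightarrow> (linear \<times> linear) list" where
  "tape_templates b s (s', MoveRight) = [((1, 0, b, s'), (b, s, 1, 0))]"
| "tape_templates b s (s', Stay) = [((1, 0, 1, 0), (b, s, b, s'))]"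
| "tape_templates b s (s', MoveLeft) = ((0, 1, 0, 1), (b, s, b, s')) #
     map (\<lambda>a. ((b, b + a, 1, 1), (b, s, b * b, b * s' + a))) [0..<b]"

text \<open>A move beyond a marker leaves the head in place, so it becomes the identity. In all
  cases the source is \<open>z\<close> or \<open>z + 1\<close>, which lets a program find the
  scanned cell from \<open>z\<close>.\<close>

fun input_template :: "cell \<Rightarrow> move \<Rightarrow> linear" where
  "input_template x MoveRight = (if x = RightEnd then (1, 0, 1, 0) else (1, 0, 1, 1))"
| "input_template x Stay = (1, 0, 1, 0)"
| "input_template x MoveLeft = (if x = LeftEnd then (1, 0, 1, 0) else (1, 1, 1, 0))"

locale tape_bounds =
  fixes b S :: nat
  assumes b: "2 \<le> b"
begin

text \<open>From cell \<open>S\<close> on the tape is blank, so the \<open>S - h\<close> digits of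
  the right number describe everything from the head on.\<close>

definition fits :: "wtape \<Rightarrow> bool" where
  "fits = (\<lambda>(t, h). h < S \<and> (\<forall>k. t k < b) \<and> (\<forall>k \<ge> S. t k = 0))"

definition num :: "wtape \<Rightarrow> nat \<times> nat" where
  "num = (\<lambda>(t, h). (left_num b t h, right_num b t (S - h) h))"

lemma right_num_head:
  assumes "h < S"
  shows "right_num b t (S - h) h = b * right_num b t (S - Suc h) (Suc h) + t h"
proof -
  have "S - h = Suc (S - Suc h)" using assms by simp
  then show ?thesis by simp
qed

text \<open>Positional notation is unique: matching the source fixes the scanned symbol and, for a
  left move, also the digit that was guessed.\<close>

lemma tape_sound:
  assumes "fits (t, h)" "(l, r) \<in> set (tape_templates b s (s', d))" "s < b"
    and "(src l x, src r y) = num (t, h)"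
  shows "s = t h" "(dst l x, dst r y) = num (act (t, h) (s', d))"
proof -
  have h: "h < S" and t: "\<And>k. t k < b" using assms(1) by (auto simp: fits_def)
  have R: "b * y + s = b * right_num b t (S - Suc h) (Suc h) + t h"
    using assms(2,4) right_num_head[OF h] by (cases d) (auto simp: num_def)
  then have ys: "y = right_num b t (S - Suc h) (Suc h)" "s = t h"
    using digit_eq assms(3) t by blast+
  show "s = t h" by (rule ys(2))
  let ?t = "t(h := s')"
  have L: "left_num b ?t h = left_num b t h" by (rule left_num_cong) simp
  have R': "right_num b ?t m (Suc h) = right_num b t m (Suc h)" for m by (rule right_num_cong) simp
  have Rh: "right_num b ?t (S - h) h = b * y + s'" using right_num_head[OF h, of ?t] R' ys(1) by simp
  show "(dst l x, dst r y) = num (act (t, h) (s', d))"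
  proof (cases d)
    case MoveRight
    then show ?thesis using assms(2,4) L R' ys(1) by (auto simp: num_def act_def)
  next
    case Stay
    then show ?thesis using assms(2,4) L Rh by (auto simp: num_def act_def)
  next
    case MoveLeft
    show ?thesis
    proof (cases h)
      case 0
      \<comment> \<open>On cell 0 the left number is 1, while every other template requires at least
        \<open>b\<close>.\<close>
      have "(l, r) = ((0, 1, 0, 1), (b, s, b, s'))"
        using assms(2,4) MoveLeft 0 b by (auto simp: num_def)
      then show ?thesis using MoveLeft 0 Rh by (simp add: num_def act_def)
    next
      case (Suc g)
      \<comment> \<open>Off cell 0 the left number has digits below its leading 1, which excludes
        the template for the number 1.\<close>
      have "2 \<le> left_num b t h" using left_num_pos[of b t g] b unfolding Suc
        by (simp) (metis One_nat_def Suc_leI add_leE le_trans mult_le_mono2 nat_mult_1_right order_less_le_trans trans_le_add1 zero_less_numeral)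
      then obtain a where a: "a < b" "(l, r) = ((b, b + a, 1, 1), (b, s, b * b, b * s' + a))"
        using assms(2,4) MoveLeft by (auto simp: num_def)
      then have "b * (x + 1) + a = b * left_num b t g + t g"
        using assms(4) unfolding Suc by (simp add: num_def)
      then have xa: "x + 1 = left_num b t g" "a = t g" using digit_eq a(1) t by blast+
      have g: "g < S" using h Suc by simp
      have "left_num b ?t g = left_num b t g" by (rule left_num_cong) (simp add: Suc)
      moreover have "right_num b ?t (S - g) g = b * (b * y + s') + a"
        using right_num_head[OF g, of ?t] Rh xa(2) by (simp add: Suc)
      ultimately show ?thesis using MoveLeft a(2) xa(1) Suc
        by (simp add: num_def act_def algebra_simps)
    qed
  qed
qed

text \<open>The bounds on \<open>x\<close> and \<open>y\<close> guarantee that loops over all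
  numbers below \<open>N\<close> meet this instance.\<close>

lemma tape_complete:
  assumes "fits (t, h)"
  shows "\<exists>l r x y. (l, r) \<in> set (tape_templates b (t h) (s', d)) \<and>
    (src l x, src r y) = num (t, h) \<and> x \<le> fst (num (t, h)) \<and> y \<le> snd (num (t, h))"
proof -
  have h: "h < S" and t: "\<And>k. t k < b" using assms by (auto simp: fits_def)
  define y where "y = right_num b t (S - Suc h) (Suc h)"
  have R: "b * y + t h = right_num b t (S - h) h" using right_num_head[OF h] unfolding y_def by simp
  have "1 * y \<le> b * y" by (rule mult_le_mono1) (use b in simp)
  then have y: "y \<le> right_num b t (S - h) h" unfolding R[symmetric] by linarith
  show ?thesis
  proof (cases d)
    case MoveRight
    then show ?thesis using R y by (intro exI[of _ "(1, 0, b, s')"] exI[of _ "(b, t h, 1, 0)"]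
      exI[of _ "left_num b t h"] exI[of _ y]) (simp add: num_def)
  next
    case Stay
    then show ?thesis using R y by (intro exI[of _ "(1, 0, 1, 0)"] exI[of _ "(b, t h, b, s')"]
      exI[of _ "left_num b t h"] exI[of _ y]) (simp add: num_def)
  next
    case MoveLeft
    show ?thesis
    proof (cases h)
      case 0
      then show ?thesis using R y MoveLeft by (intro exI[of _ "(0, 1, 0, 1)"] exI[of _ "(b, t h, b, s')"]
        exI[of _ "0"] exI[of _ y]) (simp add: num_def)
    next
      case (Suc g)
      obtain x where x: "left_num b t g = x + 1" using left_num_pos[of b t g] b
        by (metis Suc_eq_plus1 gr0_implies_Suc order_less_le_trans zero_less_numeral)
      have "1 * x \<le> b * x" by (rule mult_le_mono1) (use b in simp)
      moreover have "left_num b t h = b * x + b + t g" using x unfolding Suc by simp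
      ultimately have "x \<le> left_num b t h" by linarith
      moreover have "b * x + (b + t g) = left_num b t h" using x unfolding Suc by simp
      ultimately show ?thesis using R y MoveLeft t
        by (intro exI[of _ "(b, b + t g, 1, 1)"] exI[of _ "(b, t h, b * b, b * s' + t g)"]
          exI[of _ x] exI[of _ y]) (simp add: num_def)
    qed
  qed
qed

lemma fits_act:
  assumes "fits (t, h)" "s' < b" "snd (act (t, h) (s', d)) < S"
  shows "fits (act (t, h) (s', d))"
  using assms by (auto simp: fits_def act_def)

definition nums :: "wtape list \<Rightarrow> nat list" where
  "nums ts = concat (map (\<lambda>t. [fst (num t), snd (num t)]) ts)"

lemma nums_simps [simp]: "nums [] = []" "nums (t # ts) = fst (num t) # snd (num t) # nums ts"
  by (simp_all add: nums_def)

lemma length_nums [simp]: "length (nums ts) = 2 * length ts"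
  by (induction ts) auto

end

definition pairs :: "('a \<times> 'a) list \<Rightarrow> 'a list" where
  "pairs ps = concat (map (\<lambda>(l, r). [l, r]) ps)"

lemma pairs_simps [simp]: "pairs [] = []" "pairs ((l, r) # ps) = l # r # pairs ps"
  by (simp_all add: pairs_def)

text \<open>The coefficients 0 make the first component constant: it demands the state
  \<open>q\<close> and produces \<open>q'\<close>. For each tape one of its templates is chosen
  independently.\<close>

fun templates :: "nat \<Rightarrow> lhs \<times> rhs \<Rightarrow> (cell \<times> linear list) list" where
  "templates b ((q, x, ss), (q', d, as, y)) =
     map (\<lambda>ps. (x, (0, q, 0, q') # input_template x d # pairs ps)) (product_lists (map2 (tape_templates b) ss as))"

context tape_bounds
begin

lemma tapes_sound:
  assumes "length ts = length ss" "length ts = length as"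
    and "\<forall>t \<in> set ts. fits t" "\<forall>s \<in> set ss. s < b"
    and "ps \<in> set (product_lists (map2 (tape_templates b) ss as))"
    and "length v = 2 * length ts" "map2 src (pairs ps) v = nums ts"
  shows "ss = map (\<lambda>(t, h). t h) ts \<and> map2 dst (pairs ps) v = nums (map2 act ts as)"
  using assms
proof (induction ts arbitrary: ss as ps v)
  case Nil
  then show ?case by simp
next
  case (Cons t ts)
  obtain s ss' where ss: "ss = s # ss'" using Cons.prems(1) by (cases ss) auto
  obtain s' d as' where as: "as = (s', d) # as'" using Cons.prems(2) by (cases as) auto
  obtain l r ps' where ps: "ps = (l, r) # ps'" "(l, r) \<in> set (tape_templates b s (s', d))"
      "ps' \<in> set (product_lists (map2 (tape_templates b) ss' as'))"
    using Cons.prems(5) unfolding ss as by auto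
  obtain x y v' where v: "v = x # y # v'" using Cons.prems(6) by (cases v; cases "tl v") auto
  obtain u h where t: "t = (u, h)" by (cases t)
  have "(src l x, src r y) = num (u, h)" using Cons.prems(7) unfolding ps(1) v t by simp
  then have "s = u h" "(dst l x, dst r y) = num (act (u, h) (s', d))"
    using tape_sound ps(2) Cons.prems(3,4) unfolding t ss by auto
  moreover have "ss' = map (\<lambda>(t, h). t h) ts \<and> map2 dst (pairs ps') v' = nums (map2 act ts as')"
    by (rule Cons.IH[OF _ _ _ _ ps(3)]) (use Cons.prems in \<open>auto simp: ss as ps(1) v\<close>)
  ultimately show ?case by (metis (no_types, lifting) ss as ps(1) v t fst_conv snd_conv case_prod_conv
    list.simps(9) nums_simps(2) pairs_simps(2) zip_Cons_Cons)
qed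

lemma tapes_complete:
  assumes "length ts = length as" "\<forall>t \<in> set ts. fits t"
  shows "\<exists>ps v. ps \<in> set (product_lists (map2 (tape_templates b) (map (\<lambda>(t, h). t h) ts) as)) \<and>
    length v = 2 * length ts \<and> length (pairs ps) = 2 * length ts \<and> map2 src (pairs ps) v = nums ts \<and>
    list_all2 (\<le>) v (nums ts)"
  using assms
proof (induction ts arbitrary: as)
  case Nil
  show ?case by (intro exI[of _ "[]"]) simp
next
  case (Cons t ts)
  obtain s' d as' where as: "as = (s', d) # as'" using Cons.prems(1) by (cases as) auto
  obtain u h where t: "t = (u, h)" by (cases t)
  obtain ps v where IH: "ps \<in> set (product_lists (map2 (tape_templates b) (map (\<lambda>(t, h). t h) ts) as'))"
    "length v = 2 * length ts" "length (pairs ps) = 2 * length ts" "map2 src (pairs ps) v = nums ts"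
    "list_all2 (\<le>) v (nums ts)"
    using Cons.IH[of as'] Cons.prems unfolding as by auto
  obtain l r x y where lr: "(l, r) \<in> set (tape_templates b (u h) (s', d))"
    "(src l x, src r y) = num (u, h)" "x \<le> fst (num (u, h))" "y \<le> snd (num (u, h))"
    using tape_complete[of u h s' d] Cons.prems(2) unfolding t by auto
  have "(l, r) # ps \<in> set (product_lists (map2 (tape_templates b) (map (\<lambda>(t, h). t h) (t # ts)) as))"
    unfolding as t using lr(1) IH(1) by auto
  moreover have "map2 src (pairs ((l, r) # ps)) (x # y # v) = nums (t # ts)"
    using lr(2) IH(4) unfolding t by (metis fst_conv snd_conv list.simps(9) nums_simps(2) pairs_simps(2) zip_Cons_Cons case_prod_conv)
  moreover have "list_all2 (\<le>) (x # y # v) (nums (t # ts))" using lr(3,4) IH(5) unfolding t by simp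
  ultimately show ?case using IH(2,3) by (intro exI[of _ "(l, r) # ps"] exI[of _ "x # y # v"]) simp
qed

end

section \<open>Templates and machine steps\<close>

locale space_tm = tape_bounds +
  fixes M :: tm and w :: "symbol list"
  assumes tm: "is_tm M"
    and symbols: "\<And>q x ss q' d as y. ((q, x, ss), (q', d, as, y)) \<in> rules M \<Longrightarrow>
      (\<forall>s \<in> set ss. s < b) \<and> (\<forall>(s, m) \<in> set as. s < b)"
    and heads: "\<And>c t h. reaches M w c \<Longrightarrow> (t, h) \<in> set (work c) \<Longrightarrow> h < S"
begin

definition proper :: "config \<Rightarrow> bool" where
  "proper c \<longleftrightarrow> reaches M w c \<and> length (work c) = ntapes M \<and> (\<forall>t \<in> set (work c). fits t) \<and> input_pos c \<le> length w + 1"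

lemma proper_initial: "proper (initial M)"
proof -
  have "reaches M w (initial M)" by (simp add: reaches_def)
  moreover from this have "h < S" if "(t, h) \<in> set (replicate (ntapes M) (\<lambda>_. 0, 0))" for t :: "nat \<Rightarrow> nat" and h
    using heads[of "initial M" t h] that calculation by (simp add: initial_def)
  ultimately show ?thesis using b by (auto simp: proper_def initial_def fits_def)
qed

lemma proper_step:
  assumes "proper c" "step M w c c'"
  shows "proper c'"
  using assms(2)
proof (cases rule: step.cases)
  case (1 q i ts q' d as y out)
  have r: "reaches M w c'" using assms unfolding proper_def reaches_def by (meson rtranclp.rtrancl_into_rtrancl)
  have len: "length as = ntapes M" using tm 1(3) unfolding is_tm_def by fastforce
  have "fits t'" if t': "t' \<in> set (map2 act ts as)" for t'
  proof -
    obtain t h s e where a: "(t, h) \<in> set ts" "(s, e) \<in> set as" "t' = act (t, h) (s, e)"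
    proof -
      obtain p a where "(p, a) \<in> set (zip ts as)" "t' = act p a" using t' by auto
      then show thesis
        using that[of "fst p" "snd p" "fst a" "snd a"] by (auto dest: set_zip_leftD set_zip_rightD)
    qed
    have "fits (t, h)" using assms(1) a(1) 1(1) by (auto simp: proper_def)
    moreover have "s < b" using symbols[OF 1(3)] a(2) by auto
    moreover have "snd t' < S" using heads[OF r, of "fst t'" "snd t'"] t' 1(2) by simp
    ultimately show ?thesis using fits_act a(3) by blast
  qed
  then show ?thesis using r len assms(1) 1 by (simp add: proper_def)
qed

lemma reaches_proper: "reaches M w c \<Longrightarrow> proper c"
  unfolding reaches_def
proof (induction rule: rtranclp_induct)
  case base
  show ?case by (rule proper_initial)
next
  case (step y z)
  then show ?case using proper_step by blast
qed

definition vec :: "config \<Rightarrow> nat list" where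
  "vec c = state c # input_pos c # nums (work c)"

lemma length_vec: "proper c \<Longrightarrow> length (vec c) = 2 * ntapes M + 2"
  by (simp add: vec_def proper_def)

lemma input_sound:
  "input_cell w (src (input_template x d) z) = x \<Longrightarrow> src (input_template x d) z \<le> length w + 1 \<Longrightarrow>
   dst (input_template x d) z = min (length w + 1) (move_head d (src (input_template x d) z))"
  by (cases d) (auto simp: input_cell_def split: if_splits)

lemma input_complete:
  "i \<le> length w + 1 \<Longrightarrow> \<exists>z \<le> i. src (input_template (input_cell w i) d) z = i"
  by (cases d; cases i) (auto simp: input_cell_def)

text \<open>The vector forgets the output, which no rule inspects. Its other components determine
  the scanned symbols, so the rule behind the template applies to \<open>c\<close> itself.\<close>

lemma vec_sound:
  assumes "proper c" "rule \<in> rules M" "(x, \<tau>) \<in> set (templates b rule)" "length v = 2 * ntapes M + 2"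
    and "map2 src \<tau> v = vec c" "input_cell w (src (\<tau> ! 1) (v ! 1)) = x"
  shows "\<exists>c'. step M w c c' \<and> map2 dst \<tau> v = vec c'"
proof -
  obtain q x' ss q' d as y where rule: "rule = ((q, x', ss), (q', d, as, y))" by (metis prod.exhaust)
  obtain ps where ps: "ps \<in> set (product_lists (map2 (tape_templates b) ss as))"
    "\<tau> = (0, q, 0, q') # input_template x d # pairs ps" "x' = x"
    using assms(3) unfolding rule by auto
  obtain z0 z v' where v: "v = z0 # z # v'" "length v' = 2 * ntapes M"
    using assms(4) by (cases v; cases "tl v") auto
  obtain i ts out where c: "c = Config q i ts out"
    using assms(5) by (cases c) (simp add: vec_def v ps(2))
  have in_rules: "((q, x, ss), (q', d, as, y)) \<in> rules M" using assms(2) ps(3) rule by simp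
  have len: "length as = ntapes M" "length ss = ntapes M" "length ts = ntapes M"
    using tm in_rules assms(1) c unfolding is_tm_def by (fastforce simp: proper_def)+
  have i: "src (input_template x d) z = i" "input_cell w i = x"
    using assms(5,6) by (simp_all add: vec_def v ps(2) c)
  have ss: "ss = map (\<lambda>(t, h). t h) ts \<and> map2 dst (pairs ps) v' = nums (map2 act ts as)"
    by (rule tapes_sound[OF _ _ _ _ ps(1)])
      (use len v(2) assms(1,5) symbols[OF in_rules] in \<open>auto simp: proper_def c vec_def v ps(2)\<close>)
  define c' where "c' = Config q' (min (length w + 1) (move_head d i)) (map2 act ts as)
        (out @ (case y of None \<Rightarrow> [] | Some s \<Rightarrow> [s]))"
  have "q = state c" using assms(5) by (simp add: vec_def v ps(2))
  then have "step M w c c'"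
    unfolding c c'_def using in_rules i(2) ss by (intro step.intros) simp
  moreover have "dst (input_template x d) z = min (length w + 1) (move_head d i)"
    using input_sound[of x d z] i assms(1) by (simp add: proper_def c)
  then have "map2 dst \<tau> v = vec c'" using ss by (simp add: vec_def v ps(2) c'_def)
  ultimately show ?thesis by blast
qed

text \<open>The first argument is taken to be 0 because the machine's state may be a number above
  \<open>N\<close>; the other arguments are bounded by the components of the vector.\<close>

lemma vec_complete:
  assumes "proper c" "step M w c c'"
  shows "\<exists>rule \<in> rules M. \<exists>x \<tau> v. (x, \<tau>) \<in> set (templates b rule) \<and> length v = 2 * ntapes M + 2 \<and>
    map2 src \<tau> v = vec c \<and> map2 dst \<tau> v = vec c' \<and> input_cell w (src (\<tau> ! 1) (v ! 1)) = x \<and> list_all2 (\<le>) v (0 # tl (vec c))"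
  using assms(2)
proof (cases rule: step.cases)
  case (1 q i ts q' d as y out)
  have len: "length as = ntapes M" "length ts = ntapes M"
    using tm 1(1,3) assms(1) unfolding is_tm_def by (fastforce simp: proper_def)+
  have fits: "\<forall>t \<in> set ts. fits t" using assms(1) 1(1) by (simp add: proper_def)
  obtain ps v where ps: "ps \<in> set (product_lists (map2 (tape_templates b) (map (\<lambda>(t, h). t h) ts) as))"
    "length v = 2 * length ts" "map2 src (pairs ps) v = nums ts" "list_all2 (\<le>) v (nums ts)"
    using tapes_complete[of ts as] len fits by auto
  have "map2 dst (pairs ps) v = nums (map2 act ts as)"
    using tapes_sound[OF _ _ fits _ ps(1,2,3)] len symbols[OF 1(3)] by simp
  moreover have ii: "i \<le> length w + 1" using assms(1) 1(1) by (simp add: proper_def)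
  moreover obtain z where z: "z \<le> i" "src (input_template (input_cell w i) d) z = i"
    using input_complete[OF ii] by blast
  moreover have "dst (input_template (input_cell w i) d) z = min (length w + 1) (move_head d i)"
    using input_sound[of "input_cell w i" d z] z(2) ii by simp
  moreover have "(input_cell w i, (0, q, 0, q') # input_template (input_cell w i) d # pairs ps)
      \<in> set (templates b ((q, input_cell w i, map (\<lambda>(t, h). t h) ts), (q', d, as, y)))"
    using ps(1) by auto
  ultimately show ?thesis using 1 ps len
    by (intro bexI[OF _ 1(3)] exI[of _ "input_cell w i"]
        exI[of _ "(0, q, 0, q') # input_template (input_cell w i) d # pairs ps"] exI[of _ "0 # z # v"])
      (simp add: vec_def)
qed

lemma vec_bound:
  assumes "proper c" "length w + 1 < N" "2 * b ^ S \<le> N"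
  shows "set (tl (vec c)) \<subseteq> {..<N}"
proof -
  have "fst (num t) < N \<and> snd (num t) < N" if "fits t" for t
  proof -
    obtain f h where t: "t = (f, h)" by (cases t)
    have h: "h < S" "\<And>k. f k < b" using that by (auto simp: fits_def t)
    have "left_num b f h < 2 * b ^ h" "right_num b f (S - h) h < b ^ (S - h)"
      using left_num_less right_num_less h(2) by blast+
    moreover have "b ^ h \<le> b ^ S" "b ^ (S - h) \<le> b ^ S" using h(1) b by (auto intro: power_increasing)
    ultimately show ?thesis using assms(3) by (simp add: t num_def)
  qed
  then have "set (nums ts) \<subseteq> {..<N}" if "\<forall>t \<in> set ts. fits t" for ts
    using that by (induction ts) auto
  then show ?thesis using assms(1,2) by (auto simp: vec_def proper_def)
qed

end

section \<open>Programs that write words\<close>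

definition out_word :: "symbol list \<Rightarrow> com" where
  "out_word us = seqs (map Out us)"

text \<open>The value \<open>\<alpha> * x + \<beta>\<close> is printed in unary while the register
  is counted down, but never stored; hence it may exceed \<open>N\<close> without blocking.\<close>

definition out_num :: "nat \<times> nat \<Rightarrow> nat \<Rightarrow> com" where
  "out_num = (\<lambda>(\<alpha>, \<beta>) j. Until (IsZero j) (Dec j ;; Inc 0 ;; out_word (replicate \<alpha> 1)) ;;
     Until (IsZero 0) (Dec 0 ;; Inc j) ;; out_word (replicate \<beta> 1 @ [0]))"

definition when_cell :: "nat \<Rightarrow> nat \<Rightarrow> cell \<Rightarrow> com \<Rightarrow> com" where
  "when_cell j k x c = seek j ;; seqs (replicate k (Move MoveRight)) ;; Cond (Scans [x]) c Skip"

text \<open>Incrementing the largest value \<open>N - 1\<close> would block, so the body runs once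
  before the first test and the loop is left at \<open>IsMax\<close>.\<close>

definition for_all :: "nat \<Rightarrow> com \<Rightarrow> com" where
  "for_all j c = c ;; Until (IsMax j) (Inc j ;; c) ;; clear j"

fun nest :: "nat list \<Rightarrow> com \<Rightarrow> com" where
  "nest [] c = c"
| "nest (j # js) c = for_all j (nest js c)"

text \<open>Polymorphic in the elements: the same loops describe the words that are printed and the
  lists of states and transitions that these words encode. The two are linked by
  \<open>items_concat\<close>.\<close>

fun items :: "nat \<Rightarrow> nat list \<Rightarrow> ((nat \<Rightarrow> nat) \<Rightarrow> 'a list) \<Rightarrow> (nat \<Rightarrow> nat) \<Rightarrow> 'a list" where
  "items N [] g v = g v"
| "items N (j # js) g v = concat (map (\<lambda>x. items N js g (v(j := x))) [0..<N])"

lemma items_concat: "concat (map e (items N js g v)) = items N js (\<lambda>v. concat (map e (g v))) v"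
proof (induction js arbitrary: v)
  case (Cons j js)
  have "concat (map e (concat (map (\<lambda>x. items N js g (v(j := x))) xs))) =
      concat (map (\<lambda>x. items N js (\<lambda>v. concat (map e (g v))) (v(j := x))) xs)" for xs
    by (induction xs) (use Cons in auto)
  then show ?case by simp
qed simp

lemma set_items: "set (items N js g v) = (\<Union>v' \<in> {v'. (\<forall>j \<in> set js. v' j < N) \<and> (\<forall>j. j \<notin> set js \<longrightarrow> v' j = v j)}. set (g v'))"
proof (induction js arbitrary: v)
  case Nil
  have "{v'. (\<forall>j. v' j = v j)} = {v}" by auto
  then show ?case by simp
next
  case (Cons j js)
  have "(\<Union>x < N. {v'. (\<forall>i \<in> set js. v' i < N) \<and> (\<forall>i. i \<notin> set js \<longrightarrow> v' i = (v(j := x)) i)}) =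
      {v'. (\<forall>i \<in> set (j # js). v' i < N) \<and> (\<forall>i. i \<notin> set (j # js) \<longrightarrow> v' i = v i)}" (is "?l = ?r")
  proof (intro equalityI subsetI)
    fix v'
    assume "v' \<in> ?r"
    then have "v' j < N" "v' \<in> {v'. (\<forall>i \<in> set js. v' i < N) \<and> (\<forall>i. i \<notin> set js \<longrightarrow> v' i = (v(j := v' j)) i)}"
      by auto
    then show "v' \<in> ?l" by blast
  next
    fix v'
    assume "v' \<in> ?l"
    then obtain x where x: "x < N" "\<forall>i \<in> set js. v' i < N" "\<forall>i. i \<notin> set js \<longrightarrow> v' i = (v(j := x)) i" by blast
    then have "v' j < N" by (cases "j \<in> set js") auto
    then show "v' \<in> ?r" using x by auto
  qed
  moreover have "set (items N (j # js) g v) = (\<Union>v' \<in> (\<Union>x < N. {v'. (\<forall>i \<in> set js. v' i < N) \<and>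
      (\<forall>i. i \<notin> set js \<longrightarrow> v' i = (v(j := x)) i)}). set (g v'))"
    by (simp add: Cons.IH lessThan_atLeast0)
  ultimately show ?case by simp
qed

lemma sem_Until_more:
  "holds w N t s False \<Longrightarrow> (s, s1) \<in> sem w N a \<Longrightarrow> (s1, s') \<in> sem w N (Until t a) \<Longrightarrow>
   (s, s') \<in> sem w N (Until t a)"
  using sem_Until_unfold by blast

context pointers
begin

text \<open>The registers in \<open>J\<close> are loop variables: they are zero before and after the loops.\<close>

definition emits :: "nat set \<Rightarrow> com \<Rightarrow> ((nat \<Rightarrow> nat) \<Rightarrow> symbol list) \<Rightarrow> bool" where
  "emits J c g \<longleftrightarrow> (\<forall>i v out. i \<le> length w + 1 \<and> ok v \<and> (\<forall>j \<in> J. v j = 0) \<longrightarrow>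
     (\<exists>i' \<le> length w + 1. ((i, v, out), (i', v, out @ g v)) \<in> sem w N c))"

lemma emitsI:
  assumes "\<And>i v out. i \<le> length w + 1 \<Longrightarrow> ok v \<Longrightarrow> (\<And>j. j \<in> J \<Longrightarrow> v j = 0) \<Longrightarrow>
     \<exists>i' \<le> length w + 1. ((i, v, out), (i', v, out @ g v)) \<in> sem w N c"
  shows "emits J c g"
  unfolding emits_def using assms by blast

lemma emitsD:
  assumes "emits J c g" "i \<le> length w + 1" "ok v" "\<And>j. j \<in> J \<Longrightarrow> v j = 0"
  obtains i' where "i' \<le> length w + 1" "((i, v, out), (i', v, out @ g v)) \<in> sem w N c"
  using assms unfolding emits_def by blast

lemma emits_Skip: "emits J Skip (\<lambda>_. [])"
  by (rule emitsI) auto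

lemma emits_Out: "emits J (Out y) (\<lambda>_. [y])"
  by (rule emitsI) auto

lemma emits_Seq: "emits J a f \<Longrightarrow> emits J b g \<Longrightarrow> emits J (a ;; b) (\<lambda>v. f v @ g v)"
proof (rule emitsI)
  fix i v out
  assume ab: "emits J a f" "emits J b g" and i: "i \<le> length w + 1" and v: "ok v" "\<And>j. j \<in> J \<Longrightarrow> v j = 0"
  obtain i1 where i1: "i1 \<le> length w + 1" "((i, v, out), (i1, v, out @ f v)) \<in> sem w N a"
    using emitsD[OF ab(1) i v] by blast
  obtain i2 where "i2 \<le> length w + 1" "((i1, v, out @ f v), (i2, v, (out @ f v) @ g v)) \<in> sem w N b"
    using emitsD[OF ab(2) i1(1) v] by blast
  then show "\<exists>i' \<le> length w + 1. ((i, v, out), (i', v, out @ f v @ g v)) \<in> sem w N (a ;; b)"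
    using sem_SeqI[OF i1(2)] by (metis append_assoc)
qed

lemma emits_seqs:
  "(\<And>x. x \<in> set xs \<Longrightarrow> emits J (c x) (g x)) \<Longrightarrow> emits J (seqs (map c xs)) (\<lambda>v. concat (map (\<lambda>x. g x v) xs))"
proof (induction xs)
  case Nil
  then show ?case using emits_Skip by simp
next
  case (Cons x xs)
  then show ?case using emits_Seq[of J "c x" "g x"] by simp
qed

lemma emits_word: "emits J (out_word us) (\<lambda>_. us)"
  using emits_seqs[of us J Out "\<lambda>y _. [y]"] emits_Out by (simp add: out_word_def)

lemma sem_word: "((i, v, out), (i, v, out @ us)) \<in> sem w N (out_word us)"
proof -
  have "((i, v, out), (i, v, out @ us)) \<in> sem w N (seqs (map Out us))"
  proof (induction us arbitrary: out)
    case (Cons u us)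
    have "((i, v, out), (i, v, out @ [u])) \<in> sem w N (Out u)" by auto
    then show ?case using Cons[of "out @ [u]"] sem_SeqI by fastforce
  qed simp
  then show ?thesis by (simp add: out_word_def)
qed

lemma emits_num:
  assumes "j \<noteq> 0"
  shows "emits J (out_num (\<alpha>, \<beta>) j) (\<lambda>v. replicate (\<alpha> * v j + \<beta>) 1 @ [0])"
proof (rule emitsI)
  fix i v and out :: "symbol list"
  assume i: "i \<le> length w + 1" and v: "ok v"
  have v0: "v 0 = 0" "v j < N" using v by (auto simp: ok_def)
  let ?a = "Dec j ;; Inc 0 ;; out_word (replicate \<alpha> 1)"
  let ?st = "\<lambda>k. (i, v(j := v j - k, 0 := k), out @ replicate (\<alpha> * k) 1)"
  have "(?st 0, ?st (v j)) \<in> sem w N (Until (IsZero j) ?a)"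
  proof (rule sem_Until_seq)
    fix k
    assume k: "k < v j"
    have "(?st k, (i, v(j := v j - Suc k, 0 := k), out @ replicate (\<alpha> * k) 1)) \<in> sem w N (Dec j)"
      by (rule sem_DecI) (use k assms in \<open>auto simp: fun_eq_iff\<close>)
    moreover have "((i, v(j := v j - Suc k, 0 := k), out @ replicate (\<alpha> * k) 1),
        (i, v(j := v j - Suc k, 0 := Suc k), out @ replicate (\<alpha> * k) 1)) \<in> sem w N (Inc 0)"
      by (rule sem_IncI) (use k v0 in \<open>auto simp: fun_eq_iff\<close>)
    moreover have "((i, v(j := v j - Suc k, 0 := Suc k), out @ replicate (\<alpha> * k) 1), ?st (Suc k))
        \<in> sem w N (out_word (replicate \<alpha> 1))"
      using sem_word[of i "v(j := v j - Suc k, 0 := Suc k)" "out @ replicate (\<alpha> * k) 1" "replicate \<alpha> 1"]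
      by (simp add: replicate_add[symmetric] add.commute)
    ultimately have "(?st k, ?st (Suc k)) \<in> sem w N ?a" by (meson sem_SeqI)
    then show "holds w N (IsZero j) (?st k) False \<and> (?st k, ?st (Suc k)) \<in> sem w N ?a"
      using k assms by simp
  qed (use assms in simp)
  moreover have "?st 0 = (i, v, out)" using v0 by (auto simp: fun_eq_iff)
  ultimately have 1: "((i, v, out), ?st (v j)) \<in> sem w N (Until (IsZero j) ?a)" by simp
  let ?out = "out @ replicate (\<alpha> * v j) 1"
  let ?st2 = "\<lambda>k. (i, v(j := k, 0 := v j - k), ?out)"
  have "(?st2 0, ?st2 (v j)) \<in> sem w N (Until (IsZero 0) (Dec 0 ;; Inc j))"
  proof (rule sem_Until_seq)
    fix k
    assume k: "k < v j"
    have "(?st2 k, (i, v(j := k, 0 := v j - Suc k), ?out)) \<in> sem w N (Dec 0)"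
      by (rule sem_DecI) (use k assms in \<open>auto simp: fun_eq_iff\<close>)
    moreover have "((i, v(j := k, 0 := v j - Suc k), ?out), ?st2 (Suc k)) \<in> sem w N (Inc j)"
      by (rule sem_IncI) (use k assms v0 in \<open>auto simp: fun_eq_iff\<close>)
    ultimately have "(?st2 k, ?st2 (Suc k)) \<in> sem w N (Dec 0 ;; Inc j)" by (meson sem_SeqI)
    then show "holds w N (IsZero 0) (?st2 k) False \<and> (?st2 k, ?st2 (Suc k)) \<in> sem w N (Dec 0 ;; Inc j)"
      using k by simp
  qed simp
  moreover have "?st2 0 = ?st (v j)" by simp
  moreover have "?st2 (v j) = (i, v, ?out)" using v0 by (auto simp: fun_eq_iff)
  ultimately have 2: "(?st (v j), (i, v, ?out)) \<in> sem w N (Until (IsZero 0) (Dec 0 ;; Inc j))" by simp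
  have 3: "((i, v, ?out), (i, v, out @ replicate (\<alpha> * v j + \<beta>) 1 @ [0])) \<in> sem w N (out_word (replicate \<beta> 1 @ [0]))"
    using sem_word[of i v ?out "replicate \<beta> 1 @ [0]"] by (simp add: replicate_add)
  show "\<exists>i' \<le> length w + 1. ((i, v, out), (i', v, out @ replicate (\<alpha> * v j + \<beta>) 1 @ [0])) \<in> sem w N (out_num (\<alpha>, \<beta>) j)"
    unfolding out_num_def prod.case using i sem_SeqI[OF 1 sem_SeqI[OF 2 3]] by blast
qed

lemma sem_right:
  "((min (length w + 1) i, v, out), (min (length w + 1) (i + k), v, out)) \<in> sem w N (seqs (replicate k (Move MoveRight)))"
proof (induction k arbitrary: i)
  case (Suc k)
  have "((min (length w + 1) i, v, out), (min (length w + 1) (Suc i), v, out)) \<in> sem w N (Move MoveRight)"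
    by (auto simp: min_def)
  from sem_SeqI[OF this Suc[of "Suc i"]] show ?case by (simp del: sem.simps)
qed simp

lemma emits_when_cell:
  assumes "emits J c g" "j \<noteq> 0"
  shows "emits J (when_cell j k x c) (\<lambda>v. if input_cell w (v j + k) = x then g v else [])"
proof (rule emitsI)
  fix i v out
  assume i: "i \<le> length w + 1" and v: "ok v" "\<And>j. j \<in> J \<Longrightarrow> v j = 0"
  have 1: "((i, v, out), (min (length w + 1) (v j), v, out)) \<in> sem w N (seek j)"
    using sem_seek[OF i, of v j N out] v(1) assms(2) by (simp add: ok_def)
  let ?i = "min (length w + 1) (v j + k)"
  have x: "input_cell w ?i = input_cell w (v j + k)" by (rule input_cell_min)
  have "\<exists>i' \<le> length w + 1. ((?i, v, out), (i', v, out @ (if input_cell w (v j + k) = x then g v else [])))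
      \<in> sem w N (Cond (Scans [x]) c Skip)"
  proof (cases "input_cell w (v j + k) = x")
    case True
    obtain i' where "i' \<le> length w + 1" "((?i, v, out), (i', v, out @ g v)) \<in> sem w N c"
      using emitsD[OF assms(1) _ v, of ?i out] by auto
    then show ?thesis using True x by (intro exI[of _ i']) simp
  next
    case False
    then show ?thesis using x by (intro exI[of _ ?i]) simp
  qed
  then show "\<exists>i' \<le> length w + 1. ((i, v, out), (i', v, out @ (if input_cell w (v j + k) = x then g v else [])))
      \<in> sem w N (when_cell j k x c)"
    unfolding when_cell_def using sem_SeqI[OF 1 sem_SeqI[OF sem_right]] by blast
qed

lemma emits_for_all:
  assumes "emits J c g" "j \<noteq> 0" "j \<notin> J"
  shows "emits (insert j J) (for_all j c) (\<lambda>v. concat (map (\<lambda>x. g (v(j := x))) [0..<N]))"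
proof (rule emitsI)
  fix i v out
  assume i: "i \<le> length w + 1" and v: "ok v" "\<And>l. l \<in> insert j J \<Longrightarrow> v l = 0"
  have N0: "0 < N" using N by simp
  let ?g = "\<lambda>xs. concat (map (\<lambda>x. g (v(j := x))) xs)"
  have body: "\<exists>i' \<le> length w + 1. ((i, v(j := x), out), (i', v(j := x), out @ g (v(j := x)))) \<in> sem w N c"
    if "i \<le> length w + 1" "x < N" for i x out
  proof -
    have "ok (v(j := x))" using ok_upd v(1) assms(2) that(2) by blast
    moreover have "\<And>l. l \<in> J \<Longrightarrow> (v(j := x)) l = 0" using v(2) assms(3) by auto
    ultimately show ?thesis using emitsD[OF assms(1) that(1)] by blast
  qed
  \<comment> \<open>Here \<open>k\<close> counts the rounds still to come, so the induction starts
    at the last value \<open>N - 1\<close>.\<close>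
  have loop: "k < N \<Longrightarrow> i \<le> length w + 1 \<Longrightarrow> \<exists>i' \<le> length w + 1.
      ((i, v(j := N - 1 - k), out), (i', v(j := N - 1), out @ ?g [N - k..<N])) \<in> sem w N (Until (IsMax j) (Inc j ;; c))"
    for k i out
  proof (induction k arbitrary: i out)
    case 0
    have "holds w N (IsMax j) (i, v(j := N - 1), out) True" using N0 by simp
    then have "((i, v(j := N - 1), out), (i, v(j := N - 1), out)) \<in> sem w N (Until (IsMax j) (Inc j ;; c))"
      using sem_Until_unfold by blast
    then have "((i, v(j := N - 1 - 0), out), (i, v(j := N - 1), out @ ?g [N - 0..<N])) \<in> sem w N (Until (IsMax j) (Inc j ;; c))"
      by (simp only: diff_zero upt_conv_Nil[OF order_refl] list.map concat.simps append_Nil2)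
    then show ?case using 0(2) by blast
  next
    case (Suc k)
    have eq: "N - 1 - Suc k + 1 = N - 1 - k" "N - 1 - k = N - Suc k" using Suc.prems(1) by auto
    have inc: "((i, v(j := N - 1 - Suc k), out), (i, v(j := N - 1 - k), out)) \<in> sem w N (Inc j)"
      by (rule sem_IncI) (use Suc.prems(1) eq(1) in auto)
    obtain i1 where i1: "i1 \<le> length w + 1"
      "((i, v(j := N - 1 - k), out), (i1, v(j := N - 1 - k), out @ g (v(j := N - 1 - k)))) \<in> sem w N c"
      using body[OF Suc.prems(2), of "N - 1 - k"] N0 by auto
    have a: "((i, v(j := N - 1 - Suc k), out), (i1, v(j := N - 1 - k), out @ g (v(j := N - 1 - k)))) \<in> sem w N (Inc j ;; c)"
      by (rule sem_SeqI[OF inc i1(2)])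
    have "k < N" using Suc.prems(1) by simp
    from Suc.IH[OF this i1(1), of "out @ g (v(j := N - 1 - k))"] obtain i2 where i2: "i2 \<le> length w + 1"
      "((i1, v(j := N - 1 - k), out @ g (v(j := N - 1 - k))), (i2, v(j := N - 1), (out @ g (v(j := N - 1 - k))) @ ?g [N - k..<N]))
        \<in> sem w N (Until (IsMax j) (Inc j ;; c))"
      by blast
    have "[N - Suc k..<N] = (N - 1 - k) # [N - k..<N]"
      using Suc.prems(1) eq(2) upt_conv_Cons[of "N - Suc k" N] by (simp add: Suc_diff_Suc)
    then have out: "out @ ?g [N - Suc k..<N] = (out @ g (v(j := N - 1 - k))) @ ?g [N - k..<N]" by simp
    have "holds w N (IsMax j) (i, v(j := N - 1 - Suc k), out) False" using Suc.prems(1) by simp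
    then have "((i, v(j := N - 1 - Suc k), out), (i2, v(j := N - 1), out @ ?g [N - Suc k..<N]))
        \<in> sem w N (Until (IsMax j) (Inc j ;; c))"
      unfolding out by (rule sem_Until_more[OF _ a i2(2)])
    then show ?case using i2(1) by blast
  qed
  have v0: "v(j := 0) = v" using v(2)[of j] by auto
  obtain i1 where i1: "i1 \<le> length w + 1" "((i, v, out), (i1, v, out @ g v)) \<in> sem w N c"
    using body[OF i N0, of out] v0 by auto
  obtain i2 where i2: "i2 \<le> length w + 1"
    "((i1, v, out @ g v), (i2, v(j := N - 1), (out @ g v) @ ?g [1..<N])) \<in> sem w N (Until (IsMax j) (Inc j ;; c))"
    using loop[of "N - 1" i1 "out @ g v"] i1(1) N0 v0 by auto
  have "((i2, v(j := N - 1), (out @ g v) @ ?g [1..<N]), (i2, v, (out @ g v) @ ?g [1..<N])) \<in> sem w N (clear j)"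
    using v0 by (simp add: sem_clear)
  moreover have "?g [0..<N] = g v @ ?g [1..<N]" using N0 v0 by (simp add: upt_conv_Cons)
  ultimately have "((i, v, out), (i2, v, out @ ?g [0..<N])) \<in> sem w N (for_all j c)"
    unfolding for_all_def using sem_SeqI[OF i1(2) sem_SeqI[OF i2(2)]] by simp
  then show "\<exists>i' \<le> length w + 1. ((i, v, out), (i', v, out @ ?g [0..<N])) \<in> sem w N (for_all j c)"
    using i2(1) by blast
qed

lemma emits_nest:
  "emits {} c g \<Longrightarrow> distinct js \<Longrightarrow> 0 \<notin> set js \<Longrightarrow> emits (set js) (nest js c) (items N js g)"
proof (induction js)
  case Nil
  have "items N [] g = g" by (rule ext) simp
  with Nil show ?case by simp
next
  case (Cons j js)
  have "items N (j # js) g = (\<lambda>v. concat (map (\<lambda>x. items N js g (v(j := x))) [0..<N]))" by (rule ext) simp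
  with Cons show ?case using emits_for_all[of "set js" "nest js c" "items N js g" j] by simp
qed

end

section \<open>The configuration graph as an automaton\<close>

text \<open>The first bit separates the configurations from the states that read the word \<open>u\<close>.\<close>

definition state_name :: "nat list \<Rightarrow> bool list" where
  "state_name xs = True # concat (map (\<lambda>x. replicate x True @ [False]) xs)"

definition chain :: "nat \<Rightarrow> bool list" where
  "chain k = False # replicate k True"

text \<open>A unary number followed by \<open>False\<close> is self-delimiting, so a name determines
  its vector, including the length.\<close>

lemma replicate_True_inject:
  "replicate x True @ False # r = replicate y True @ False # r' \<longleftrightarrow> x = y \<and> r = r'"
proof (induction x arbitrary: y)
  case 0
  then show ?case by (cases y) auto
next
  case (Suc x)
  then show ?case by (cases y) auto
qed

lemma state_name_inject [simp]: "state_name xs = state_name ys \<longleftrightarrow> xs = ys"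
proof -
  have "concat (map (\<lambda>x. replicate x True @ [False]) xs) = concat (map (\<lambda>x. replicate x True @ [False]) ys) \<longleftrightarrow> xs = ys"
  proof (induction xs arbitrary: ys)
    case Nil
    then show ?case by (cases ys) auto
  next
    case (Cons x xs)
    then show ?case by (cases ys) (auto simp: replicate_True_inject)
  qed
  then show ?thesis by (simp add: state_name_def)
qed

lemma chain_inject [simp]: "chain k = chain l \<longleftrightarrow> k = l"
  by (simp add: chain_def)

lemma chain_neq_state_name [simp]: "chain k \<noteq> state_name xs" "state_name xs \<noteq> chain k"
  by (simp_all add: chain_def state_name_def)

lemma enc_state_name:
  "enc_state (state_name xs) = 1 # concat (map (\<lambda>x. replicate x 1 @ [0]) xs) @ [2]"
proof -
  have "map of_bool (concat (map (\<lambda>x. replicate x True @ [False]) xs)) = (concat (map (\<lambda>x. replicate x 1 @ [0]) xs) :: symbol list)"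
    by (induction xs) auto
  then show ?thesis by (simp add: enc_state_def state_name_def)
qed

definition out_name :: "(nat \<times> nat) list \<Rightarrow> com" where
  "out_name ls = Out 1 ;; seqs (map (\<lambda>(p, j). out_num p j) (zip ls [1..<Suc (length ls)])) ;; Out 2"

definition regs :: "nat \<Rightarrow> nat list" where
  "regs m = [1..<Suc m]"

text \<open>Register 2 carries the argument of the input position. Its source map adds the second
  entry of the template, which is the distance from that argument to the scanned cell.\<close>

definition out_edge :: "nat \<Rightarrow> symbol list \<Rightarrow> cell \<times> linear list \<Rightarrow> com" where
  "out_edge m sep = (\<lambda>(x, \<tau>). nest (regs m) (when_cell 2 (fst (snd (\<tau> ! 1))) x
     (out_name (map (\<lambda>(\<alpha>, \<beta>, \<gamma>, \<delta>). (\<alpha>, \<beta>)) \<tau>) ;; out_word sep ;; out_name (map (\<lambda>(\<alpha>, \<beta>, \<gamma>, \<delta>). (\<gamma>, \<delta>)) \<tau>))))"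

text \<open>The state \<open>q\<close> is printed as a constant, since it need not be below
  \<open>N\<close>. Vectors that code no reachable configuration are listed as well, but no path
  from the initial state of the automaton leads to them.\<close>

definition out_final :: "nat \<Rightarrow> nat \<Rightarrow> com" where
  "out_final m q = nest (regs m) (out_name ((0, q) # replicate (m - 1) (1, 0)))"

definition chain_states :: "symbol list \<Rightarrow> nat list \<Rightarrow> bool list list" where
  "chain_states u c0 = map chain [0..<Suc (length u)] @ [state_name c0]"

definition chain_edges :: "symbol list \<Rightarrow> nat list \<Rightarrow> (bool list \<times> symbol option \<times> bool list) list" where
  "chain_edges u c0 = map (\<lambda>k. (chain k, Some (u ! k), chain (Suc k))) [0..<length u] @ [(chain (length u), None, state_name c0)]"

text \<open>The edge loops run twice: with the empty separator they list both endpoints as states,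
  and with the separator 4, the code of an epsilon-label, they list the transitions.\<close>

definition generator :: "nat \<Rightarrow> nat \<Rightarrow> (cell \<times> linear list) list \<Rightarrow> symbol list \<Rightarrow> nat list \<Rightarrow> com" where
  "generator m q \<tau>s u c0 = seqs (map clear [0..<Suc m]) ;;
     seqs (map (out_edge m []) \<tau>s) ;; out_final m q ;; out_word (enc_states (chain_states u c0)) ;; Out 3 ;;
     seqs (map (out_edge m [4]) \<tau>s) ;; out_word (enc_transitions (chain_edges u c0)) ;; Out 3 ;;
     out_word (enc_state (chain 0)) ;; Out 3 ;; out_final m q"

definition edge_items :: "symbol list \<Rightarrow> nat \<Rightarrow> nat \<Rightarrow> (nat \<Rightarrow> nat) \<Rightarrow> cell \<times> linear list \<Rightarrow> (bool list \<times> symbol option \<times> bool list) list" where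
  "edge_items w N m v = (\<lambda>(x, \<tau>). items N (regs m) (\<lambda>v. if input_cell w (v 2 + fst (snd (\<tau> ! 1))) = x
     then [(state_name (map2 src \<tau> (map v (regs m))), None, state_name (map2 dst \<tau> (map v (regs m))))] else []) v)"

definition final_items :: "nat \<Rightarrow> nat \<Rightarrow> nat \<Rightarrow> (nat \<Rightarrow> nat) \<Rightarrow> bool list list" where
  "final_items N m q v = items N (regs m) (\<lambda>v. [state_name (q # tl (map v (regs m)))]) v"

definition endpoints :: "(bool list \<times> symbol option \<times> bool list) list \<Rightarrow> bool list list" where
  "endpoints ts = concat (map (\<lambda>(p, x, q). [p, q]) ts)"

lemma regs_simps: "length (regs m) = m" "distinct (regs m)" "0 \<notin> set (regs m)"
  by (simp_all add: regs_def)

lemma set_regs_items: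
  assumes "\<And>v v'. map v (regs m) = map v' (regs m) \<Longrightarrow> g v = g v'"
  shows "set (items N (regs m) g v) = {y. \<exists>v. set (map v (regs m)) \<subseteq> {..<N} \<and> y \<in> set (g v)}"
proof (intro equalityI subsetI)
  fix y
  assume "y \<in> set (items N (regs m) g v)"
  then show "y \<in> {y. \<exists>v. set (map v (regs m)) \<subseteq> {..<N} \<and> y \<in> set (g v)}"
    by (auto simp: set_items)
next
  fix y
  assume "y \<in> {y. \<exists>v. set (map v (regs m)) \<subseteq> {..<N} \<and> y \<in> set (g v)}"
  then obtain v1 where v1: "set (map v1 (regs m)) \<subseteq> {..<N}" "y \<in> set (g v1)" by blast
  let ?v = "\<lambda>j. if j \<in> set (regs m) then v1 j else v j"
  have "g ?v = g v1" by (rule assms) simp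
  then show "y \<in> set (items N (regs m) g v)"
    unfolding set_items using v1 by (intro UN_I[of ?v]) auto
qed

lemma ex_regs:
  assumes "length xs = m"
  obtains v where "map v (regs m) = xs"
proof
  show "map (\<lambda>j. xs ! (j - 1)) (regs m) = xs"
    by (rule nth_equalityI) (simp_all add: regs_def assms del: upt_Suc)
qed

lemma set_edge_items:
  assumes "2 \<le> m"
  shows "set (edge_items w N m v (x, \<tau>)) = {(state_name (map2 src \<tau> xs), None, state_name (map2 dst \<tau> xs)) | xs.
     length xs = m \<and> set xs \<subseteq> {..<N} \<and> input_cell w (xs ! 1 + fst (snd (\<tau> ! 1))) = x}"
proof -
  \<comment> \<open>Loop registers start at 1, so register 2 is component 1 of the vector, the input
    position.\<close>
  have 2: "v 2 = map v (regs m) ! 1" for v :: "nat \<Rightarrow> nat"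
    using assms by (simp add: regs_def numeral_2_eq_2 del: upt_Suc)
  have "set (edge_items w N m v (x, \<tau>)) = {y. \<exists>v. set (map v (regs m)) \<subseteq> {..<N} \<and>
      y \<in> set (if input_cell w (v 2 + fst (snd (\<tau> ! 1))) = x
     then [(state_name (map2 src \<tau> (map v (regs m))), None, state_name (map2 dst \<tau> (map v (regs m))))] else [])}"
    unfolding edge_items_def prod.case by (rule set_regs_items) (use 2 in metis)
  also have "\<dots> = {(state_name (map2 src \<tau> xs), None, state_name (map2 dst \<tau> xs)) | xs.
     length xs = m \<and> set xs \<subseteq> {..<N} \<and> input_cell w (xs ! 1 + fst (snd (\<tau> ! 1))) = x}" (is "?l = ?r")
  proof (intro equalityI subsetI)
    fix y
    assume "y \<in> ?l"
    then obtain v where v: "set (map v (regs m)) \<subseteq> {..<N}" "input_cell w (v 2 + fst (snd (\<tau> ! 1))) = x"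
      "y = (state_name (map2 src \<tau> (map v (regs m))), None, state_name (map2 dst \<tau> (map v (regs m))))"
      by (auto split: if_splits)
    then show "y \<in> ?r" unfolding 2 mem_Collect_eq
      by (intro exI[of _ "map v (regs m)"]) (simp add: regs_simps(1))
  next
    fix y
    assume "y \<in> ?r"
    then obtain xs where xs: "length xs = m" "set xs \<subseteq> {..<N}" "input_cell w (xs ! 1 + fst (snd (\<tau> ! 1))) = x"
      "y = (state_name (map2 src \<tau> xs), None, state_name (map2 dst \<tau> xs))" by blast
    obtain v where "map v (regs m) = xs" using ex_regs[OF xs(1)] .
    then show "y \<in> ?l" unfolding 2 mem_Collect_eq using xs by (intro exI[of _ v]) simp
  qed
  finally show ?thesis .
qed

lemma set_final_items:
  "set (final_items N m q v) = {state_name (q # tl xs) | xs. length xs = m \<and> set xs \<subseteq> {..<N}}"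
proof -
  have "set (final_items N m q v) = {y. \<exists>v. set (map v (regs m)) \<subseteq> {..<N} \<and>
      y \<in> set [state_name (q # tl (map v (regs m)))]}"
    unfolding final_items_def by (rule set_regs_items) (simp only:)
  also have "\<dots> = {state_name (q # tl xs) | xs. length xs = m \<and> set xs \<subseteq> {..<N}}" (is "?l = ?r")
  proof (intro equalityI subsetI)
    fix y
    assume "y \<in> ?l"
    then obtain v where "set (map v (regs m)) \<subseteq> {..<N}" "y = state_name (q # tl (map v (regs m)))" by auto
    then show "y \<in> ?r" using regs_simps(1) by (metis (mono_tags, lifting) length_map mem_Collect_eq)
  next
    fix y
    assume "y \<in> ?r"
    then obtain xs where xs: "length xs = m" "set xs \<subseteq> {..<N}" "y = state_name (q # tl xs)" by blast
    obtain v where "map v (regs m) = xs" using ex_regs[OF xs(1)] .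
    then show "y \<in> ?l" using xs by (intro CollectI exI[of _ v]) simp
  qed
  finally show ?thesis .
qed

lemma concat_map_concat: "concat (map (\<lambda>x. concat (map e (h x))) xs) = concat (map e (concat (map h xs)))"
  by (induction xs) auto

lemma enc_endpoints: "enc_states (endpoints ts) = concat (map (\<lambda>(p, x, q). enc_state p @ enc_state q) ts)"
  by (induction ts) (auto simp: endpoints_def)

context pointers
begin

lemma emits_cong: "emits J c g \<Longrightarrow> (\<And>v. g v = g' v) \<Longrightarrow> emits J c g'"
  by (metis ext)

lemma emits_name:
  "emits J (out_name ls) (\<lambda>v. enc_state (state_name (map2 (\<lambda>(\<alpha>, \<beta>) x. \<alpha> * x + \<beta>) ls (map v (regs (length ls))))))"
proof -
  let ?g = "\<lambda>(p, j) v. replicate (fst p * v j + snd p) 1 @ [0 :: symbol]"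
  let ?zs = "zip ls (regs (length ls))"
  have "emits J (case z of (p, j) \<Rightarrow> out_num p j) (?g z)" if "z \<in> set ?zs" for z
  proof -
    obtain \<alpha> \<beta> j where z: "z = ((\<alpha>, \<beta>), j)" by (metis prod.exhaust)
    have "j \<in> set (regs (length ls))" using that by (auto simp: z dest: set_zip_rightD)
    then have "j \<noteq> 0" using regs_simps(3) by metis
    then show ?thesis using emits_num[of j J \<alpha> \<beta>] by (simp add: z)
  qed
  then have "emits J (out_name ls) (\<lambda>v. [1] @ concat (map (\<lambda>z. ?g z v) ?zs) @ [2])"
    unfolding out_name_def regs_def[symmetric]
    by (intro emits_Seq emits_Out emits_seqs)
  moreover have "map2 (\<lambda>(\<alpha>, \<beta>) x. \<alpha> * x + \<beta>) ls (map v (regs (length ls))) = map (\<lambda>(p, j). fst p * v j + snd p) ?zs" for v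
    by (rule nth_equalityI) (auto simp: regs_simps split: prod.split)
  then have "[1] @ concat (map (\<lambda>z. ?g z v) ?zs) @ [2] = enc_state (state_name (map2 (\<lambda>(\<alpha>, \<beta>) x. \<alpha> * x + \<beta>) ls (map v (regs (length ls)))))" for v
    by (simp add: enc_state_name comp_def case_prod_unfold)
  ultimately show ?thesis by (rule emits_cong)
qed

lemma emits_edge:
  assumes "length \<tau> = m"
  shows "emits (set (regs m)) (out_edge m sep (x, \<tau>))
    (\<lambda>v. concat (map (\<lambda>(p, y, q). enc_state p @ sep @ enc_state q) (edge_items w N m v (x, \<tau>))))"
proof -
  let ?s = "map (\<lambda>(\<alpha>, \<beta>, \<gamma>, \<delta>). (\<alpha>, \<beta>)) \<tau>" and ?d = "map (\<lambda>(\<alpha>, \<beta>, \<gamma>, \<delta>). (\<gamma>, \<delta>)) \<tau>"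
  have s: "map2 (\<lambda>(\<alpha>, \<beta>) x. \<alpha> * x + \<beta>) ?s xs = map2 src \<tau> xs" for xs
    by (rule nth_equalityI) (auto split: prod.split)
  have d: "map2 (\<lambda>(\<alpha>, \<beta>) x. \<alpha> * x + \<beta>) ?d xs = map2 dst \<tau> xs" for xs
    by (rule nth_equalityI) (auto split: prod.split)
  let ?g = "\<lambda>v. if input_cell w (v 2 + fst (snd (\<tau> ! 1))) = x then
      enc_state (state_name (map2 src \<tau> (map v (regs m)))) @ sep @ enc_state (state_name (map2 dst \<tau> (map v (regs m)))) else []"
  have "emits {} (out_name ?s) (\<lambda>v. enc_state (state_name (map2 src \<tau> (map v (regs m)))))"
    using emits_name[of "{}" ?s] unfolding s length_map assms .
  moreover have "emits {} (out_name ?d) (\<lambda>v. enc_state (state_name (map2 dst \<tau> (map v (regs m)))))"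
    using emits_name[of "{}" ?d] unfolding d length_map assms .
  ultimately have "emits {} (when_cell 2 (fst (snd (\<tau> ! 1))) x (out_name ?s ;; out_word sep ;; out_name ?d)) ?g"
    by (intro emits_when_cell emits_Seq emits_word) simp_all
  then have "emits (set (regs m)) (out_edge m sep (x, \<tau>)) (items N (regs m) ?g)"
    unfolding out_edge_def prod.case by (rule emits_nest) (rule regs_simps)+
  moreover have "(\<lambda>v. concat (map (\<lambda>(p, y, q). enc_state p @ sep @ enc_state q)
      (if input_cell w (v 2 + fst (snd (\<tau> ! 1))) = x
     then [(state_name (map2 src \<tau> (map v (regs m))), None :: symbol option, state_name (map2 dst \<tau> (map v (regs m))))] else []))) = ?g"
    by (rule ext) simp
  ultimately show ?thesis unfolding edge_items_def prod.case items_concat by simp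
qed

lemma emits_final:
  assumes "0 < m"
  shows "emits (set (regs m)) (out_final m q) (\<lambda>v. enc_states (final_items N m q v))"
proof -
  have l: "length ((0, q) # replicate (m - 1) (1, 0)) = m" using assms by simp
  have "regs m = 1 # tl (regs m)" using assms by (simp add: regs_def upt_conv_Cons del: upt_Suc)
  then have "map2 (\<lambda>(\<alpha>, \<beta>) x. \<alpha> * x + \<beta>) ((0, q) # replicate (m - 1) (1, 0)) (map v (regs m)) = q # tl (map v (regs m))" for v
  proof -
    have z: "map2 (\<lambda>(\<alpha>, \<beta>) x. \<alpha> * x + \<beta>) (replicate k (1, 0)) ys = ys" if "length ys = k" for k and ys :: "nat list"
      by (rule nth_equalityI) (use that in auto)
    have "map v (regs m) = v 1 # map v (tl (regs m))"
      using \<open>regs m = 1 # tl (regs m)\<close> by (metis list.simps(9))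
    moreover have "length (map v (tl (regs m))) = m - 1" by (simp add: regs_simps)
    ultimately show ?thesis using z[of "map v (tl (regs m))" "m - 1"] by simp
  qed
  then have "emits {} (out_name ((0, q) # replicate (m - 1) (1, 0))) (\<lambda>v. enc_state (state_name (q # tl (map v (regs m)))))"
    using emits_name[of "{}" "(0, q) # replicate (m - 1) (1, 0)"] unfolding l by simp
  then have "emits (set (regs m)) (out_final m q) (items N (regs m) (\<lambda>v. enc_state (state_name (q # tl (map v (regs m))))))"
    unfolding out_final_def by (rule emits_nest) (rule regs_simps)+
  then show ?thesis unfolding final_items_def items_concat by simp
qed

lemma sem_clears: "((i, v, out), (i, \<lambda>j. if j < k then 0 else v j, out)) \<in> sem w N (seqs (map clear [l..<k]))"
  if "l \<le> k" "\<forall>j < l. v j = 0"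
  using that
proof (induction "k - l" arbitrary: l v)
  case 0
  then have "(\<lambda>j. if j < k then 0 else v j) = v" by auto
  then show ?case using 0 by simp
next
  case (Suc d)
  have l: "[l..<k] = l # [Suc l..<k]" using Suc.hyps(2) by (intro upt_conv_Cons) simp
  have "((i, v(l := 0), out), (i, \<lambda>j. if j < k then 0 else (v(l := 0)) j, out)) \<in> sem w N (seqs (map clear [Suc l..<k]))"
    by (rule Suc.hyps(1)) (use Suc.hyps(2) Suc.prems in \<open>auto simp: less_Suc_eq\<close>)
  moreover have "(\<lambda>j. if j < k then 0 else (v(l := 0)) j) = (\<lambda>j. if j < k then 0 else v j)"
  proof -
    have "l < k" using Suc.hyps(2) by simp
    then show ?thesis by auto
  qed
  moreover have "((i, v, out), (i, v(l := 0), out)) \<in> sem w N (clear l)" by (simp add: sem_clear)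
  ultimately show ?case unfolding l using sem_SeqI by simp
qed

lemma sem_generator:
  assumes "2 \<le> m" "\<And>x \<tau>. (x, \<tau>) \<in> set \<tau>s \<Longrightarrow> length \<tau> = m" "x < N"
  shows "\<exists>s. ((length w + 1, \<lambda>_. x, []), s) \<in> sem w N (generator m q \<tau>s u c0) \<and>
    (let v = (\<lambda>j. if j < Suc m then 0 else x); es = concat (map (edge_items w N m v) \<tau>s); fs = final_items N m q v in
     snd (snd s) = enc_states (endpoints es @ fs @ chain_states u c0) @ [3] @
       enc_transitions (es @ chain_edges u c0) @ [3] @ enc_state (chain 0) @ [3] @ enc_states fs)"
proof -
  define v where "v = (\<lambda>j. if j < Suc m then 0 else x)"
  define es where "es = concat (map (edge_items w N m v) \<tau>s)"
  have ed: "emits (set (regs m)) (seqs (map (out_edge m sep) \<tau>s))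
      (\<lambda>v. concat (map (\<lambda>(p, y, q). enc_state p @ sep @ enc_state q) (concat (map (edge_items w N m v) \<tau>s))))" for sep
  proof -
    have "emits (set (regs m)) (out_edge m sep z) (\<lambda>v. concat (map (\<lambda>(p, y, q). enc_state p @ sep @ enc_state q) (edge_items w N m v z)))"
      if "z \<in> set \<tau>s" for z
      using emits_edge assms(2) that by (cases z) blast
    from emits_seqs[where xs = \<tau>s and c = "out_edge m sep", OF this] show ?thesis
      by (rule emits_cong) (assumption | rule concat_map_concat)+
  qed
  have m: "0 < m" using assms(1) by simp
  let ?tail = "seqs (map (out_edge m []) \<tau>s) ;; out_final m q ;; out_word (enc_states (chain_states u c0)) ;; Out 3 ;;
     seqs (map (out_edge m [4]) \<tau>s) ;; out_word (enc_transitions (chain_edges u c0)) ;; Out 3 ;;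
     out_word (enc_state (chain 0)) ;; Out 3 ;; out_final m q"
  let ?out = "\<lambda>v. concat (map (\<lambda>(p, y, q). enc_state p @ [] @ enc_state q) (concat (map (edge_items w N m v) \<tau>s))) @
      enc_states (final_items N m q v) @ enc_states (chain_states u c0) @ [3] @
      concat (map (\<lambda>(p, y, q). enc_state p @ [4] @ enc_state q) (concat (map (edge_items w N m v) \<tau>s))) @
      enc_transitions (chain_edges u c0) @ [3] @ enc_state (chain 0) @ [3] @ enc_states (final_items N m q v)"
  have em: "emits (set (regs m)) ?tail ?out"
    by (intro emits_Seq ed emits_final[OF m] emits_word emits_Out)
  have ok: "ok v" using assms(3) N by (auto simp: ok_def v_def)
  have zero: "v j = 0" if "j \<in> set (regs m)" for j using that by (auto simp: v_def regs_def)
  obtain i where "((length w + 1, v, []), (i, v, [] @ ?out v)) \<in> sem w N ?tail"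
    by (rule emitsD[OF em order_refl ok zero])
  moreover have "((length w + 1, \<lambda>_. x, []), (length w + 1, v, [])) \<in> sem w N (seqs (map clear [0..<Suc m]))"
    unfolding v_def using sem_clears[of 0 "Suc m" "\<lambda>_. x" "length w + 1" "[]"] by simp
  ultimately have sem: "((length w + 1, \<lambda>_. x, []), (i, v, [] @ ?out v)) \<in> sem w N (generator m q \<tau>s u c0)"
    unfolding generator_def using sem_SeqI by blast
  \<comment> \<open>The separator 4 is the encoded label only because all edges between
    configurations are epsilon-transitions.\<close>
  have None: "y = None" if "(p, y, q) \<in> set es" for p y q
    using that unfolding es_def by (auto simp: set_edge_items[OF assms(1)])
  have "concat (map (\<lambda>(p, y, q). enc_state p @ [4] @ enc_state q) es) = enc_transitions es"
    by (rule arg_cong[where f = concat], rule map_cong) (auto dest: None)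
  then have out: "[] @ ?out v = enc_states (endpoints es @ final_items N m q v @ chain_states u c0) @ [3] @
       enc_transitions (es @ chain_edges u c0) @ [3] @ enc_state (chain 0) @ [3] @ enc_states (final_items N m q v)"
    unfolding es_def[symmetric] by (simp add: enc_endpoints)
  show ?thesis unfolding Let_def v_def[symmetric] es_def[symmetric] out[symmetric]
    by (intro exI conjI, rule sem) (simp add: es_def)
qed

end

lemma bounded_nest: "bounded K c \<Longrightarrow> (\<And>j. j \<in> set js \<Longrightarrow> j < K) \<Longrightarrow> bounded K (nest js c)"
  by (induction js) (auto simp: for_all_def)

lemma det_nest: "det c \<Longrightarrow> det (nest js c)"
  by (induction js) (auto simp: for_all_def)

lemma det_seqs: "(\<And>c. c \<in> set cs \<Longrightarrow> det c) \<Longrightarrow> det (seqs cs)"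
  by (induction cs) auto

lemma bounded_word [simp]: "bounded K (out_word us)"
  unfolding out_word_def by (rule bounded_seqs) auto

lemma det_word [simp]: "det (out_word us)"
  unfolding out_word_def by (rule det_seqs) auto

lemma bounded_name: "length ls < K \<Longrightarrow> bounded K (out_name ls)"
  by (auto simp: out_name_def out_num_def intro!: bounded_seqs dest!: set_zip_rightD simp del: upt_Suc)

lemma det_name: "det (out_name ls)"
  by (auto simp: out_name_def out_num_def intro!: det_seqs)

lemma bounded_generator:
  assumes "2 \<le> m" "\<And>x \<tau>. (x, \<tau>) \<in> set \<tau>s \<Longrightarrow> length \<tau> = m"
  shows "bounded (Suc m) (generator m q \<tau>s u c0)"
proof -
  have regs: "j < Suc m" if "j \<in> set (regs m)" for j using that by (auto simp: regs_def)
  have edge: "bounded (Suc m) (out_edge m sep z)" if "z \<in> set \<tau>s" for sep z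
  proof -
    obtain x \<tau> where z: "z = (x, \<tau>)" by (cases z)
    then have "length \<tau> = m" using that assms(2) by blast
    then have "bounded (Suc m) (when_cell 2 k x (out_name (map (\<lambda>(\<alpha>, \<beta>, \<gamma>, \<delta>). (\<alpha>, \<beta>)) \<tau>) ;; out_word sep ;;
        out_name (map (\<lambda>(\<alpha>, \<beta>, \<gamma>, \<delta>). (\<gamma>, \<delta>)) \<tau>)))" for k
      using assms(1) by (auto simp: when_cell_def intro!: bounded_seqs bounded_name)
    then show ?thesis unfolding out_edge_def z prod.case by (intro bounded_nest regs)
  qed
  have "bounded (Suc m) (seqs (map (out_edge m sep) \<tau>s))" for sep
    by (rule bounded_seqs) (use edge in auto)
  moreover have "bounded (Suc m) (seqs (map clear [0..<Suc m]))"
    by (rule bounded_seqs) (auto simp del: upt_Suc)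
  moreover have "bounded (Suc m) (out_final m q)"
    unfolding out_final_def by (rule bounded_nest[OF bounded_name regs]) (use assms(1) in simp_all)
  ultimately show ?thesis unfolding generator_def by (simp del: upt_Suc)
qed

lemma det_generator: "det (generator m q \<tau>s u c0)"
  by (auto simp: generator_def out_edge_def out_final_def when_cell_def intro!: det_seqs det_nest det_name)

lemma nfa_path_append: "nfa_path A p u q \<Longrightarrow> nfa_path A q v r \<Longrightarrow> nfa_path A p (u @ v) r"
  by (induction rule: nfa_path.induct) (auto intro: nfa_path.epsilon nfa_path.letter)

text \<open>Membership in \<open>RRn\<close> asks for some automaton encoded by the word; by this
  lemma it can only be the intended one.\<close>

lemma encodes_unique:
  assumes "encodes w A" "encodes w A'"
  shows "A = A'"
proof -
  obtain qs ts fs where 1: "set qs = states A" "set ts = trans A" "set fs = final A"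
    "w = enc_states qs @ [3] @ enc_transitions ts @ [3] @ enc_state (init A) @ [3] @ enc_states fs"
    using assms(1) unfolding encodes_def by blast
  obtain qs' ts' fs' where 2: "set qs' = states A'" "set ts' = trans A'" "set fs' = final A'"
    "w = enc_states qs' @ [3] @ enc_transitions ts' @ [3] @ enc_state (init A') @ [3] @ enc_states fs'"
    using assms(2) unfolding encodes_def by blast
  have "qs = qs' \<and> ts = ts' \<and> init A = init A' \<and> enc_states fs = enc_states fs'"
    using 1(4) 2(4) by (simp add: enc_states_inject enc_transitions_inject)
  \<comment> \<open>The last section has no terminator, so a 3 is appended to both sides before
    decoding.\<close>
  moreover from this have "fs = fs'" using enc_states_inject[of fs "[]" fs' "[]"] by simp
  ultimately show ?thesis using 1 2 by (cases A; cases A') simp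
qed

lemma templates_length:
  assumes "is_tm M" "rule \<in> rules M" "(x, \<tau>) \<in> set (templates b rule)"
  shows "length \<tau> = 2 * ntapes M + 2" "src (\<tau> ! 1) z = z + fst (snd (\<tau> ! 1))"
proof -
  obtain q x' ss q' d as y where rule: "rule = ((q, x', ss), (q', d, as, y))" by (metis prod.exhaust)
  obtain ps where ps: "ps \<in> set (product_lists (map2 (tape_templates b) ss as))"
    "\<tau> = (0, q, 0, q') # input_template x d # pairs ps"
    using assms(3) unfolding rule by auto
  have len: "length ss = ntapes M" "length as = ntapes M"
    using assms(1,2) unfolding is_tm_def rule by fastforce+
  have "length ps = ntapes M" using ps(1) len by (simp add: in_set_product_lists_length)
  moreover have "length (pairs ps) = 2 * length ps" for ps :: "(linear \<times> linear) list"
    by (induction ps) auto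
  ultimately show "length \<tau> = 2 * ntapes M + 2" using ps(2) by simp
  show "src (\<tau> ! 1) z = z + fst (snd (\<tau> ! 1))" unfolding ps(2) by (cases d) auto
qed

lemma width_ge_1: "1 \<le> width n"
  using width_pos[of n] by (cases "width n") auto

text \<open>For large \<open>n\<close> the bound comes from \<open>ln n \<le> width n * ln 2\<close>
  and \<open>ln 2 < 1\<close>; small lengths are covered because \<open>width n\<close> is at least
  1.\<close>

lemma log_width_bound:
  assumes "(\<lambda>n. real (s n)) \<in> O(\<lambda>n. ln (real n))"
  shows "\<exists>c. \<forall>n. s n \<le> c * width n"
proof -
  obtain k where "eventually (\<lambda>n. norm (real (s n)) \<le> k * norm (ln (real n))) at_top" "k > 0"
    using assms by (elim landau_o.bigE)
  then obtain n0 where n0: "\<And>n. n \<ge> n0 \<Longrightarrow> real (s n) \<le> k * \<bar>ln (real n)\<bar>"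
    by (auto simp: eventually_at_top_linorder)
  \<comment> \<open>The sum absorbs the finitely many lengths below the threshold of the asymptotic
    bound, and the length 0.\<close>
  define c where "c = nat \<lceil>k\<rceil> + (\<Sum>n \<in> {0} \<union> {..<n0}. s n)"
  have "s n \<le> c * width n" for n
  proof (cases "n < n0 \<or> n = 0")
    case True
    then have "s n \<le> (\<Sum>n \<in> {0} \<union> {..<n0}. s n)" by (intro member_le_sum) auto
    then have "s n \<le> c * 1" by (simp add: c_def)
    also have "\<dots> \<le> c * width n" using width_ge_1 by (rule mult_le_mono2)
    finally show ?thesis .
  next
    case False
    have "real n \<le> real (2 ^ width n)" using width_pos[of n] by (intro of_nat_mono) simp
    then have "ln (real n) \<le> ln (2 ^ width n)" using False by (subst ln_le_cancel_iff) auto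
    also have "\<dots> = real (width n) * ln 2" by (simp add: ln_realpow)
    also have "\<dots> \<le> real (width n) * 1" using ln_2_less_1 by (intro mult_left_mono) auto
    finally have "\<bar>ln (real n)\<bar> \<le> real (width n)" using False by simp
    then have "k * \<bar>ln (real n)\<bar> \<le> real (nat \<lceil>k\<rceil>) * real (width n)"
      using \<open>k > 0\<close> by (intro mult_mono) (auto simp: real_nat_ceiling_ge)
    then have "real (s n) \<le> real (nat \<lceil>k\<rceil> * width n)" using n0[of n] False by simp
    then have "s n \<le> nat \<lceil>k\<rceil> * width n" by (simp only: of_nat_le_iff)
    also have "\<dots> \<le> c * width n" by (intro mult_le_mono1) (simp add: c_def)
    finally show ?thesis .
  qed
  then show ?thesis by blast
qed

text \<open>A power of two is chosen so that the sizes of vectors can be compared with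
  \<open>N\<close> through exponents.\<close>

lemma symbol_bound:
  assumes "finite (rules M)"
  shows "\<exists>e. \<forall>((q, x, ss), (q', d, as, y)) \<in> rules M. (\<forall>s \<in> set ss. s < 2 ^ e) \<and> (\<forall>(s, m) \<in> set as. s < (2 :: nat) ^ e)"
proof -
  let ?X = "\<Union>((q, x, ss), (q', d, as, y)) \<in> rules M. set ss \<union> fst ` set as"
  have "finite ?X" using assms by (intro finite_UN_I) (auto split: prod.split)
  then obtain e where e: "\<forall>s \<in> ?X. s < e" using finite_nat_set_iff_bounded by blast
  have "s < 2 ^ e" if "s \<in> ?X" for s using e that less_exp[of e] by (meson order_less_trans)
  then show ?thesis by (intro exI[of _ e]) fastforce
qed

lemma list_all2_le_bound:
  fixes xs ys :: "nat list"
  shows "list_all2 (\<le>) xs ys \<Longrightarrow> set ys \<subseteq> {..<N} \<Longrightarrow> set xs \<subseteq> {..<N}"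
  by (induction rule: list_all2_induct) auto

section \<open>Correctness of the configuration graph\<close>

locale reduction = space_tm + pointers w N for N +
  fixes rs :: "(lhs \<times> rhs) list" and u :: "symbol list" and \<Delta> :: "symbol set" and v :: "nat \<Rightarrow> nat"
  assumes rs: "set rs = rules M" and u: "u \<in> lists \<Delta>" and big: "2 * b ^ S \<le> N"
begin

definition m where "m = 2 * ntapes M + 2"

definition \<tau>s where "\<tau>s = concat (map (templates b) rs)"

definition c0 where "c0 = vec (initial M)"

definition es where "es = concat (map (edge_items w N m v) \<tau>s)"

definition fs where "fs = final_items N m (halt_state M) v"

definition graph :: "bool list nfa" where
  "graph = \<lparr>states = set (endpoints es @ fs @ chain_states u c0), trans = set (es @ chain_edges u c0),
     init = chain 0, final = set fs\<rparr>"

lemma m2: "2 \<le> m"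
  by (simp add: m_def)

lemma set_es: "set es = {(state_name (map2 src \<tau> xs), None, state_name (map2 dst \<tau> xs)) | rule x \<tau> xs.
    rule \<in> rules M \<and> (x, \<tau>) \<in> set (templates b rule) \<and> length xs = m \<and> set xs \<subseteq> {..<N} \<and>
    input_cell w (src (\<tau> ! 1) (xs ! 1)) = x}" (is "_ = ?r")
proof -
  have "set es = (\<Union>(x, \<tau>) \<in> set \<tau>s. {(state_name (map2 src \<tau> xs), None, state_name (map2 dst \<tau> xs)) | xs.
     length xs = m \<and> set xs \<subseteq> {..<N} \<and> input_cell w (xs ! 1 + fst (snd (\<tau> ! 1))) = x})"
  proof -
    have "set es = (\<Union>z \<in> set \<tau>s. set (edge_items w N m v z))" by (simp add: es_def)
    also have "\<dots> = (\<Union>(x, \<tau>) \<in> set \<tau>s. {(state_name (map2 src \<tau> xs), None, state_name (map2 dst \<tau> xs)) | xs.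
       length xs = m \<and> set xs \<subseteq> {..<N} \<and> input_cell w (xs ! 1 + fst (snd (\<tau> ! 1))) = x})"
    proof (rule SUP_cong[OF refl])
      fix z
      show "set (edge_items w N m v z) = (case z of (x, \<tau>) \<Rightarrow> {(state_name (map2 src \<tau> xs), None, state_name (map2 dst \<tau> xs)) | xs.
         length xs = m \<and> set xs \<subseteq> {..<N} \<and> input_cell w (xs ! 1 + fst (snd (\<tau> ! 1))) = x})"
        by (cases z) (simp only: prod.case set_edge_items[OF m2])
    qed
    finally show ?thesis .
  qed
  also have "\<dots> = ?r"
  proof (intro equalityI subsetI)
    fix y :: "bool list \<times> symbol option \<times> bool list"
    assume "y \<in> (\<Union>(x, \<tau>) \<in> set \<tau>s. {(state_name (map2 src \<tau> xs), None, state_name (map2 dst \<tau> xs)) | xs.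
     length xs = m \<and> set xs \<subseteq> {..<N} \<and> input_cell w (xs ! 1 + fst (snd (\<tau> ! 1))) = x})"
    then obtain x \<tau> xs where *: "(x, \<tau>) \<in> set \<tau>s" "y = (state_name (map2 src \<tau> xs), None, state_name (map2 dst \<tau> xs))"
      "length xs = m" "set xs \<subseteq> {..<N}" "input_cell w (xs ! 1 + fst (snd (\<tau> ! 1))) = x" by blast
    then obtain rule where r: "rule \<in> rules M" "(x, \<tau>) \<in> set (templates b rule)" by (auto simp: \<tau>s_def rs)
    have "input_cell w (src (\<tau> ! 1) (xs ! 1)) = x" using *(5) templates_length(2)[OF tm r] by simp
    then show "y \<in> ?r" using * r by blast
  next
    fix y :: "bool list \<times> symbol option \<times> bool list"
    assume "y \<in> ?r"
    then obtain rule x \<tau> xs where *: "rule \<in> rules M" "(x, \<tau>) \<in> set (templates b rule)"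
      "y = (state_name (map2 src \<tau> xs), None, state_name (map2 dst \<tau> xs))"
      "length xs = m" "set xs \<subseteq> {..<N}" "input_cell w (src (\<tau> ! 1) (xs ! 1)) = x" by blast
    have "(x, \<tau>) \<in> set \<tau>s" using *(1,2) by (auto simp: \<tau>s_def rs)
    moreover have "input_cell w (xs ! 1 + fst (snd (\<tau> ! 1))) = x" using *(6) templates_length(2)[OF tm *(1,2)] by simp
    ultimately show "y \<in> (\<Union>(x, \<tau>) \<in> set \<tau>s. {(state_name (map2 src \<tau> xs), None, state_name (map2 dst \<tau> xs)) | xs.
     length xs = m \<and> set xs \<subseteq> {..<N} \<and> input_cell w (xs ! 1 + fst (snd (\<tau> ! 1))) = x})"
      using *(3-5) by blast
  qed
  finally show ?thesis .
qed

lemma set_chain_edges: "set (chain_edges u c0) = {(chain k, Some (u ! k), chain (Suc k)) | k. k < length u} \<union>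
    {(chain (length u), None, state_name c0)}"
  by (auto simp: chain_edges_def)

lemma is_nfa_graph: "is_nfa \<Delta> graph"
proof -
  have e: "p \<in> set (endpoints ts) \<and> q \<in> set (endpoints ts)" if "(p, x, q) \<in> set ts" for p x q and ts :: "(bool list \<times> symbol option \<times> bool list) list"
    using that by (force simp: endpoints_def)
  have c: "chain k \<in> set (chain_states u c0)" if "k \<le> length u" for k
    using that by (auto simp: chain_states_def)
  have "state_name c0 \<in> set (chain_states u c0)" by (simp add: chain_states_def)
  moreover have "u ! k \<in> \<Delta>" if "k < length u" for k using u that by auto
  moreover have "x = None" if "(p, x, q) \<in> set es" for p x q using that by (auto simp: set_es)
  ultimately have "trans graph \<subseteq> states graph \<times> insert None (Some ` \<Delta>) \<times> states graph"
    using e c by (fastforce simp: graph_def set_chain_edges)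
  moreover have "init graph \<in> states graph" using c[of 0] by (simp add: graph_def)
  ultimately show ?thesis by (auto simp: is_nfa_def graph_def)
qed

lemma graph_step:
  assumes "reaches M w c" "step M w c c'"
  shows "(state_name (vec c), None, state_name (vec c')) \<in> trans graph"
proof -
  have proper: "proper c" using assms(1) by (rule reaches_proper)
  obtain rule x \<tau> xs where *: "rule \<in> rules M" "(x, \<tau>) \<in> set (templates b rule)" "length xs = 2 * ntapes M + 2"
    "map2 src \<tau> xs = vec c" "map2 dst \<tau> xs = vec c'" "input_cell w (src (\<tau> ! 1) (xs ! 1)) = x"
    "list_all2 (\<le>) xs (0 # tl (vec c))"
    using vec_complete[OF proper assms(2)] by blast
  have "set (0 # tl (vec c)) \<subseteq> {..<N}" using vec_bound[OF proper N big] N by simp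
  with *(7) have xs: "set xs \<subseteq> {..<N}" by (rule list_all2_le_bound)
  have "(state_name (map2 src \<tau> xs), None, state_name (map2 dst \<tau> xs)) \<in> set es"
    unfolding set_es mem_Collect_eq
    by (rule exI[of _ rule], rule exI[of _ x], rule exI[of _ \<tau>], rule exI[of _ xs])
      (intro conjI HOL.refl xs *(1,2,6), simp add: *(3) m_def)
  then show ?thesis using *(4,5) by (simp add: graph_def)
qed

lemma graph_reaches:
  assumes "reaches M w c"
  shows "nfa_path graph (state_name c0) [] (state_name (vec c))"
proof -
  have "(step M w)\<^sup>*\<^sup>* (initial M) c" using assms by (simp add: reaches_def)
  then show ?thesis
  proof (induction rule: rtranclp_induct)
    case base
    show ?case unfolding c0_def by (rule nfa_path.empty)
  next
    case (step c c')
    have "(state_name (vec c), None, state_name (vec c')) \<in> trans graph"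
      using graph_step step(1,2) by (simp add: reaches_def)
    then have "nfa_path graph (state_name (vec c)) [] (state_name (vec c'))"
      by (rule nfa_path.epsilon) (rule nfa_path.empty)
    from nfa_path_append[OF step.IH this] show ?case by simp
  qed
qed

lemma graph_chain: "k \<le> length u \<Longrightarrow> nfa_path graph (chain k) (drop k u) (state_name c0)"
proof (induction k rule: inc_induct)
  case base
  have "(chain (length u), None, state_name c0) \<in> trans graph" by (simp add: graph_def chain_edges_def)
  from nfa_path.epsilon[OF this nfa_path.empty] show ?case by simp
next
  case (step k)
  have "(chain k, Some (u ! k), chain (Suc k)) \<in> trans graph" using step(2) by (simp add: graph_def set_chain_edges)
  from nfa_path.letter[OF this step.IH] show ?case using step(2) by (simp add: Cons_nth_drop_Suc)
qed

text \<open>The invariant of paths from the initial state. It keeps them away from edges between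
  vectors that code no reachable configuration.\<close>

definition good_state :: "bool list \<Rightarrow> bool" where
  "good_state p \<longleftrightarrow> (\<exists>k. p = chain k) \<or> (\<exists>c. reaches M w c \<and> p = state_name (vec c))"

lemma good_step:
  assumes "good_state p" "(p, x, q) \<in> trans graph"
  shows "good_state q"
proof -
  have "(p, x, q) \<in> set es \<or> (p, x, q) \<in> set (chain_edges u c0)" using assms(2) by (auto simp: graph_def)
  then show ?thesis
  proof
    assume "(p, x, q) \<in> set (chain_edges u c0)"
    then have "(\<exists>k. q = chain k) \<or> q = state_name c0" unfolding set_chain_edges by auto
    moreover have "reaches M w (initial M)" by (simp add: reaches_def)
    ultimately show ?thesis unfolding good_state_def c0_def by blast
  next
    assume "(p, x, q) \<in> set es"
    then obtain rule y \<tau> xs where *: "rule \<in> rules M" "(y, \<tau>) \<in> set (templates b rule)" "length xs = m"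
      "input_cell w (src (\<tau> ! 1) (xs ! 1)) = y" "p = state_name (map2 src \<tau> xs)" "q = state_name (map2 dst \<tau> xs)"
      unfolding set_es by blast
    obtain c where c: "reaches M w c" "map2 src \<tau> xs = vec c" using assms(1) *(5) by (auto simp: good_state_def)
    obtain c' where "step M w c c'" "map2 dst \<tau> xs = vec c'"
      using vec_sound[OF reaches_proper[OF c(1)] *(1,2) _ c(2) *(4)] *(3) unfolding m_def by blast
    moreover from this have "reaches M w c'" using c(1) unfolding reaches_def by (meson rtranclp.rtrancl_into_rtrancl)
    moreover have "q = state_name (vec c')" using *(6) calculation(2) by simp
    ultimately show ?thesis unfolding good_state_def by blast
  qed
qed

lemma good_path: "nfa_path graph p z q \<Longrightarrow> good_state p \<Longrightarrow> good_state q"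
  by (induction rule: nfa_path.induct) (blast intro: good_step)+

lemma set_fs: "set fs = {state_name (halt_state M # tl xs) | xs. length xs = m \<and> set xs \<subseteq> {..<N}}"
  unfolding fs_def by (rule set_final_items)

lemma graph_accepts:
  assumes "accepts M w"
  shows "u \<in> lang graph"
proof -
  obtain c where c: "reaches M w c" "state c = halt_state M" using assms by (auto simp: accepts_def)
  have proper: "proper c" using c(1) by (rule reaches_proper)
  \<comment> \<open>The state component is replaced by 0, as it may exceed \<open>N\<close>; the
    final names put the halting state in its place.\<close>
  have "set (0 # tl (vec c)) \<subseteq> {..<N}" using vec_bound[OF proper N big] N by simp
  moreover have "length (0 # tl (vec c)) = m" using length_vec[OF proper] by (simp add: m_def)
  moreover have "state_name (vec c) = state_name (halt_state M # tl (0 # tl (vec c)))" using c(2) by (simp add: vec_def)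
  ultimately have "state_name (vec c) \<in> set fs"
    unfolding set_fs by (intro CollectI exI[of _ "0 # tl (vec c)"] conjI)
  moreover have "nfa_path graph (chain 0) (u @ []) (state_name (vec c))"
    using nfa_path_append graph_chain[of 0] graph_reaches[OF c(1)] by fastforce
  ultimately show ?thesis by (auto simp: lang_def graph_def)
qed

lemma accepts_graph:
  assumes "z \<in> lang graph"
  shows "accepts M w"
proof -
  obtain q where q: "q \<in> set fs" "nfa_path graph (chain 0) z q" using assms by (auto simp: lang_def graph_def)
  have "good_state (chain 0)" unfolding good_state_def by blast
  then have good: "good_state q" using good_path[OF q(2)] by blast
  obtain xs where xs: "q = state_name (halt_state M # tl xs)" using q(1) unfolding set_fs by blast
  then obtain c where c: "reaches M w c" "q = state_name (vec c)" using good unfolding good_state_def by auto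
  then have "vec c = halt_state M # tl xs" using xs by simp
  with c(1) show ?thesis unfolding accepts_def by (auto simp: vec_def)
qed

lemma encodes_graph:
  "encodes (enc_states (endpoints es @ fs @ chain_states u c0) @ [3] @
       enc_transitions (es @ chain_edges u c0) @ [3] @ enc_state (chain 0) @ [3] @ enc_states fs) graph"
  unfolding encodes_def
  by (intro exI[of _ "endpoints es @ fs @ chain_states u c0"] exI[of _ "es @ chain_edges u c0"] exI[of _ fs])
    (simp add: graph_def)

text \<open>If the machine accepts, \<open>u\<close> lies in both languages. If it does not, the
  automaton accepts no word at all and so meets no filter.\<close>

lemma graph_RRn:
  assumes "u \<in> F" "encodes z graph"
  shows "z \<in> RRn \<Delta> F \<longleftrightarrow> accepts M w"
proof
  assume "z \<in> RRn \<Delta> F"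
  then obtain A where "encodes z A" "lang A \<inter> F \<noteq> {}" unfolding RRn_def by blast
  then show "accepts M w" using encodes_unique[OF assms(2)] accepts_graph by blast
next
  assume "accepts M w"
  then show "z \<in> RRn \<Delta> F" using graph_accepts assms is_nfa_graph unfolding RRn_def by blast
qed

text \<open>The generating program must be fixed before the input is known, so the initial vector
  has to be independent of \<open>w\<close> and \<open>S\<close>.\<close>

lemma c0_eq: "c0 = start_state M # 0 # concat (replicate (ntapes M) [1, 0])"
proof -
  have "right_num b (\<lambda>_. 0) k 0 = 0" for k
  proof -
    have "right_num b (\<lambda>_. 0) k h = 0" for h by (induction k arbitrary: h) auto
    then show ?thesis .
  qed
  then have "num (\<lambda>_. 0, 0) = (1, 0)" by (simp add: num_def)
  then show ?thesis by (simp add: c0_def vec_def initial_def nums_def)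
qed

end

theorem RRn_hard:
  assumes "finite \<Sigma>" "A \<in> NL \<Sigma>" "F \<subseteq> lists \<Delta>" "F \<noteq> {}"
  shows "logspace_reducible \<Sigma> A (nfa_alphabet \<Delta>) (RRn \<Delta> F)"
proof -
  obtain M s where M: "is_tm M" "\<And>w. w \<in> lists \<Sigma> \<Longrightarrow> w \<in> A \<longleftrightarrow> accepts M w"
    and s: "(\<lambda>n. real (s n)) \<in> O(\<lambda>n. ln (real n))" "space_bounded M \<Sigma> s"
    using assms(2) unfolding NL_def logspace_def by blast
  obtain u where u_F: "u \<in> F" "u \<in> lists \<Delta>" using assms(3,4) by blast
  have fin: "finite (rules M)" using M(1) by (simp add: is_tm_def)
  then obtain rs where rs: "set rs = rules M" using finite_list by blast
  obtain e where e: "\<forall>((q, x, ss), (q', d, as, y)) \<in> rules M. (\<forall>s \<in> set ss. s < 2 ^ e) \<and> (\<forall>(s, m) \<in> set as. s < (2 :: nat) ^ e)"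
    using symbol_bound[OF fin] by blast
  \<comment> \<open>One bit more than the symbols require, so that the base is at least 2 even if
    only the blank occurs.\<close>
  define b :: nat where "b = 2 ^ Suc e"
  have b2: "2 \<le> b" by (simp add: b_def)
  have symbs: "(\<forall>s \<in> set ss. s < b) \<and> (\<forall>(s, m) \<in> set as. s < b)"
    if "((q, x, ss), (q', d, as, y)) \<in> rules M" for q x ss q' d as y
    using e that unfolding b_def by fastforce
  obtain c where c: "\<And>n. s n \<le> c * width n" using log_width_bound[OF s(1)] by blast
  \<comment> \<open>Since \<open>2 * b ^ S\<close> equals \<open>2 ^ (1 + Suc e * S)\<close>,
    \<open>S\<close> is at most \<open>c * width n\<close>, and the width is at least 1, this
    exponent is at most \<open>C * width n\<close>.\<close>
  define C where "C = Suc (Suc e * c)"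
  define dim where "dim = 2 * ntapes M + 2"
  define temps where "temps = concat (map (templates b) rs)"
  define start where "start = start_state M # 0 # concat (replicate (ntapes M) [1, 0 :: nat])"
  define p where "p = generator dim (halt_state M) temps u start"
  have len: "length \<tau> = dim" if "(x, \<tau>) \<in> set temps" for x \<tau>
    using that templates_length(1)[OF M(1)] by (auto simp: temps_def rs dim_def)
  have "bounded (Suc dim) p" unfolding p_def by (rule bounded_generator) (use len in \<open>auto simp: dim_def\<close>)
  then obtain T where T: "is_tm T" "logspace T \<Sigma>" "det p \<longrightarrow> deterministic T"
    "\<And>w. w \<in> lists \<Sigma> \<Longrightarrow> \<exists>x < (2 ^ C) ^ width (length w).
       (\<forall>s. ((length w + 1, \<lambda>_. x, []), s) \<in> sem w ((2 ^ C) ^ width (length w)) p \<longrightarrow>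
         (\<exists>c. reaches T w c \<and> state c = halt_state T \<and> written c = snd (snd s)))"
    using program_to_tm[OF assms(1), of "Suc dim" p C] unfolding C_def by (metis zero_less_Suc)
  have red: "\<exists>z. (\<exists>c. reaches T w c \<and> state c = halt_state T \<and> written c = z) \<and>
      z \<in> lists (nfa_alphabet \<Delta>) \<and> (w \<in> A \<longleftrightarrow> z \<in> RRn \<Delta> F)" if w: "w \<in> lists \<Sigma>" for w
  proof -
    let ?n = "length w"
    define N where "N = (2 ^ C :: nat) ^ width ?n"
    define S where "S = s ?n"
    obtain x where x: "x < N" "\<And>s. ((?n + 1, \<lambda>_. x, []), s) \<in> sem w N p \<Longrightarrow>
         \<exists>c. reaches T w c \<and> state c = halt_state T \<and> written c = snd (snd s)"
      using T(4)[OF w] unfolding N_def by blast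
    have "2 ^ 1 * b ^ S = 2 ^ (1 + Suc e * S)" by (simp only: b_def power_mult[symmetric] power_add)
    also have "\<dots> \<le> (2 :: nat) ^ (C * width ?n)"
    proof (rule power_increasing)
      have "Suc e * S \<le> Suc e * (c * width ?n)" unfolding S_def by (intro mult_le_mono2 c)
      moreover have "1 \<le> width ?n" by (rule width_ge_1)
      ultimately show "1 + Suc e * S \<le> C * width ?n" unfolding C_def by (simp add: algebra_simps)
    qed simp
    also have "\<dots> = N" by (simp add: N_def power_mult)
    finally have big: "2 * b ^ S \<le> N" by simp
    have "(2 :: nat) ^ width ?n \<le> (2 ^ C) ^ width ?n"
      by (rule power_mono) (use self_le_power[of "2 :: nat" C] in \<open>auto simp: C_def\<close>)
    then have N: "?n + 1 < N" using width_pos[of ?n] unfolding N_def by linarith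
    define v where "v = (\<lambda>j. if j < Suc dim then 0 else x)"
    interpret reduction b S M w N rs u \<Delta> v
    proof unfold_locales
      show "h < S" if "reaches M w c" "(t, h) \<in> set (work c)" for c t h
        using s(2) w that unfolding space_bounded_def S_def by blast
    qed (use b2 M(1) symbs N rs u_F(2) big in blast)+
    let ?z = "enc_states (endpoints es @ fs @ chain_states u c0) @ [3] @
       enc_transitions (es @ chain_edges u c0) @ [3] @ enc_state (chain 0) @ [3] @ enc_states fs"
    have p: "p = generator m (halt_state M) \<tau>s u c0"
      unfolding p_def dim_def temps_def start_def m_def \<tau>s_def c0_eq ..
    have v: "v = (\<lambda>j. if j < Suc m then 0 else x)" unfolding v_def dim_def m_def ..
    have "\<exists>s. ((?n + 1, \<lambda>_. x, []), s) \<in> sem w N p \<and> snd (snd s) = ?z"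
      using sem_generator[OF m2 _ x(1), of \<tau>s "halt_state M" u c0] len
      unfolding p Let_def v[symmetric] es_def[symmetric] fs_def[symmetric] temps_def dim_def
        \<tau>s_def[symmetric] m_def[symmetric] by blast
    then have "\<exists>c. reaches T w c \<and> state c = halt_state T \<and> written c = ?z" using x(2) by metis
    moreover have "?z \<in> RRn \<Delta> F \<longleftrightarrow> w \<in> A" using graph_RRn[OF u_F(1) encodes_graph] M(2)[OF w] by blast
    moreover have "?z \<in> lists (nfa_alphabet \<Delta>)"
      by (rule encodes_lists[OF is_nfa_graph encodes_graph])
    ultimately show ?thesis by blast
  qed
  \<comment> \<open>The reduction is obtained by choosing the printed word for each input.\<close>
  then obtain f where f: "\<And>w. w \<in> lists \<Sigma> \<Longrightarrow> (\<exists>c. reaches T w c \<and> state c = halt_state T \<and> written c = f w) \<and>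
      f w \<in> lists (nfa_alphabet \<Delta>) \<and> (w \<in> A \<longleftrightarrow> f w \<in> RRn \<Delta> F)"
    by metis
  have "det p" unfolding p_def by (rule det_generator)
  then have "logspace_computable \<Sigma> f"
    unfolding logspace_computable_def computes_def using T(1-3) f by blast
  then show ?thesis unfolding logspace_reducible_def using f by blast
qed

theorem proposition1:
  fixes \<Delta> :: "symbol set" and F :: "symbol list set"
  assumes "finite \<Delta>" and "F \<subseteq> lists \<Delta>" and "regular \<Delta> F" and "F \<noteq> {}"
  shows "NL_complete (nfa_alphabet \<Delta>) (RRn \<Delta> F)"
  unfolding NL_complete_def
proof (intro conjI allI impI)
  show "finite (nfa_alphabet \<Delta>)" using assms(1) by (simp add: nfa_alphabet_def)
  show "RRn \<Delta> F \<in> NL (nfa_alphabet \<Delta>)" using assms(1,3) by (rule RRn_in_NL)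
  show "logspace_reducible \<Sigma> A (nfa_alphabet \<Delta>) (RRn \<Delta> F)" if "finite \<Sigma>" "A \<in> NL \<Sigma>" for \<Sigma> A
    using that assms(2,4) by (rule RRn_hard)
qed

end
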